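(* Let $\mathscr{Z}\subset S^1$ be an admissible subset, let $k$ be an algebraically closed field, and let $\mathscr{C}(\mathscr{Z})$ be the associated Igusa--Todorov cluster category of Dynkin type $A_\infty$. Let $\mathscr{X}$ be a set of diagonals of $\mathscr{Z}$. Then $\operatorname{add} E(\mathscr{X})$ is the first half of a torsion pair in $\mathscr{C}(\mathscr{Z})$ (i.e. there is a full subcategory $Y$ such that $(\operatorname{add}E(\mathscr{X}),Y)$ is a torsion pair) if and only if $\mathscr{X}$ satisfies condition PC1, condition PC2, and the Ptolemy condition.
   Context: Cyclic order. The circle $S^1$ has its usual topology and the anticlockwise cyclic order: $x_0<x_1<\dots<x_n$ means that, moving anticlockwise around the circle, after encountering $x_{i-1}$ the next element of $\{x_0,\dots,x_n\}$ encountered is $x_i$, for $i=1,\dots,n$. Weak inequalities are defined analogously. Intervals such as $[a,b]$ are taken anticlockwise from $a$ to $b$ and carry the induced linear order. Admissible subsets. A subset $\mathscr{Z}\subset S^1$ is admissible if (1) it is infinite; (2) it is discrete, i.e. each $z\in\mathscr{Z}$ has an open neighbourhood in $S^1$ containing no other element of $\mathscr{Z}$; (3) it satisfies the two-sided limit condition: each $x\in S^1$ which is the limit of a sequence from $\mathscr{Z}$ is a limit of both an increasing and a decreasing sequence from $\mathscr{Z}$ with respect to the cyclic order. Each $z\in\mathscr{Z}$ then has a unique predecessor $z^-\in\mathscr{Z}$ with $(z^-,z)\cap\mathscr{Z}=\varnothing$ and a unique successor $z^+\in\mathscr{Z}$ with $(z,z^+)\cap\mathscr{Z}=\varnothing$;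 write $z^{--}=(z^-)^-$. $\overline{\mathscr{Z}}$ is the closure of $\mathscr{Z}$ in $S^1$. Diagonals. A diagonal of $\mathscr{Z}$ is a subset $\{x_0,x_1\}\subset\mathscr{Z}$ with $x_1\notin\{x_0^-,x_0,x_0^+\}$. Diagonals $\{x_0,x_1\}$ and $\{y_0,y_1\}$ cross if $x_0<y_0<x_1<y_1$ or $x_0<y_1<x_1<y_0$. Convergence. For a sequence $(z_i)_{i\ge 0}$ from $\mathscr{Z}$ converging to $p\in\overline{\mathscr{Z}}$: $z_i\to p$ from below if there is $\mu\in S^1\setminus\{p\}$ with $z_i\in[\mu,p]$ from some step; $z_i\to p$ from above if there is $\nu\in S^1\setminus\{p\}$ with $z_i\in[p,\nu]$ from some step. (If $p\in\mathscr{Z}$, then $z_i=p$ from some step and the convergence is both from below and from above.) Conditions on a set $\mathscr{X}$ of diagonals. PC1: If there is a sequence $\{x_0^i,x_1^i\}_{i\ge 0}$ from $\mathscr{X}$ with $x_0^i\to p$ from below and $x_1^i\to q$ from below with $p\ne q$, then there is a sequence $\{x_0'^i,x_1'^i\}_{i\ge 0}$ from $\mathscr{X}$ with $x_0'^i\to p$ from above and $x_1'^i\to q$ from above. PC2: If there is a sequence $\{x_0^i,x_1^i\}_{i\ge 0}$ from $\mathscr{X}$ with $x_0^i\to p$ from below and $x_1^i\to q$ from above with $p\ne q$, then there is a sequence $\{x_0'^i,x_1'^i\}_{i\ge 0}$ from $\mathscr{X}$ with $x_0'^i\to p$ from above and $x_1'^i\to q$ from above. Ptolemy condition: whenever $\{x_0,x_1\}\in\mathscr{X}$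 and $\{y_0,y_1\}\in\mathscr{X}$ cross, those of $\{x_0,y_0\},\{x_0,y_1\},\{x_1,y_0\},\{x_1,y_1\}$ which are diagonals of $\mathscr{Z}$ also lie in $\mathscr{X}$. The category. $\mathscr{C}(\mathscr{Z})$ is the cluster category constructed from $\mathscr{Z}$ and $k$ by Igusa and Todorov ("Cluster categories coming from cyclic posets", Comm. Algebra 43 (2015), 4367--4402). It has the following properties. (i) It is a $k$-linear Hom-finite Krull--Schmidt triangulated category, with suspension $\Sigma$. (ii) It is 2-Calabi--Yau: there are natural isomorphisms $\operatorname{Ext}^1(A,B)\cong\operatorname{Hom}_k(\operatorname{Ext}^1(B,A),k)$. (iii) To each diagonal $X=\{x_0,x_1\}$ there is an indecomposable object $E(X)=E(x_0,x_1)$, giving a bijection from diagonals of $\mathscr{Z}$ to isomorphism classes of indecomposable objects. (iv) $\Sigma E(x_0,x_1)=E(x_0^-,x_1^-)$. (v) $\operatorname{Ext}^1(E(X),E(Y))\cong k$ if $X$ and $Y$ cross, and $0$ otherwise. (vi) $\operatorname{Hom}(E(X),E(Y))\cong k$ if one can write $X=\{x_0,x_1\}$, $Y=\{y_0,y_1\}$ with $x_0\le y_0\le x_1^{--}<x_1\le y_1\le x_0^{--}$, and $0$ otherwise. (vii) In the situation of (vi) with $x_0\le y_0\le x_1^{--}<x_1\le y_1\le x_0^{--}$, a nonzero morphism $E(X)\to E(Y)$ factors through $E(S)$ if and only if one can write $S=\{s_0,s_1\}$ with $x_0\le s_0\le y_0$ and $x_1\le s_1\le y_1$. For a set $\mathscr{X}$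 of diagonals, $E(\mathscr{X})=\{E(X)\mid X\in\mathscr{X}\}$ and $\operatorname{add}E(\mathscr{X})$ is the full subcategory of all objects isomorphic to direct summands of finite direct sums of objects of $E(\mathscr{X})$. Torsion pairs. A pair $(X,Y)$ of full subcategories of a triangulated category $\mathscr{T}$ with suspension $\Sigma$ is a torsion pair if (T1) $\operatorname{Hom}_{\mathscr{T}}(x,y)=0$ for all $x\in X$, $y\in Y$; and (T2) for each $t\in\mathscr{T}$ there are $x\in X$, $y\in Y$ and a distinguished triangle $x\to t\to y\to\Sigma x$. *)

theory Defs
  imports "HOL-Analysis.Analysis" "HOL-Algebra.Algebraic_Closure"
begin

section \<open>Cyclic order on the circle\<close>

abbreviation circle :: "complex set" where
  "circle \<equiv> sphere 0 1"

definition ccw_angle :: "complex \<Rightarrow> complex \<Rightarrow> real" where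
  "ccw_angle a x = Arg2pi (x / a)"
  \<comment> \<open>anticlockwise angle from \<open>a\<close> to \<open>x\<close>, in \<open>[0, 2\<pi>)\<close>\<close>

text \<open>
  A chain \<open>x\<^sub>0 < \<dots> < x\<^sub>n\<close> is read as in a single anticlockwise turn starting at \<open>x\<^sub>0\<close>: the angles
  measured from \<open>x\<^sub>0\<close> increase.  In particular \<open>a \<le> x \<le> b\<close> says that \<open>x\<close> lies in \<open>[a, b]\<close>, and
  \<open>[a, a] = {a}\<close>.
\<close>

definition cyc_less :: "complex list \<Rightarrow> bool" where
  "cyc_less xs \<longleftrightarrow> sorted_wrt (<) (map (ccw_angle (hd xs)) xs)"

definition cyc_le :: "complex list \<Rightarrow> bool" where
  "cyc_le xs \<longleftrightarrow> sorted_wrt (\<le>) (map (ccw_angle (hd xs)) xs)"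

definition closed_arc :: "complex \<Rightarrow> complex \<Rightarrow> complex set" where
  "closed_arc a b = {x \<in> circle. cyc_le [a, x, b]}"

definition open_arc :: "complex \<Rightarrow> complex \<Rightarrow> complex set" where
  "open_arc a b = {x \<in> circle. cyc_less [a, x, b]}"

text \<open>
  Monotone sequences are weakly monotone, so that a point of a discrete set is the limit of the
  constant increasing (and decreasing) sequence at that point.
\<close>

definition cyc_increasing :: "(nat \<Rightarrow> complex) \<Rightarrow> bool" where
  "cyc_increasing z \<longleftrightarrow> (\<forall>n. cyc_le (map z [0..<n]))"

definition cyc_decreasing :: "(nat \<Rightarrow> complex) \<Rightarrow> bool" where
  "cyc_decreasing z \<longleftrightarrow> (\<forall>n. cyc_le (map z (rev [0..<n])))"

section \<open>Admissible subsets and diagonals\<close>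

definition two_sided_limit_condition :: "complex set \<Rightarrow> bool" where
  "two_sided_limit_condition Z \<longleftrightarrow>
    (\<forall>x \<in> circle. (\<exists>z. range z \<subseteq> Z \<and> z \<longlonglongrightarrow> x) \<longrightarrow>
      (\<exists>z. range z \<subseteq> Z \<and> cyc_increasing z \<and> z \<longlonglongrightarrow> x) \<and>
      (\<exists>z. range z \<subseteq> Z \<and> cyc_decreasing z \<and> z \<longlonglongrightarrow> x))"

definition admissible :: "complex set \<Rightarrow> bool" where
  "admissible Z \<longleftrightarrow> Z \<subseteq> circle \<and> infinite Z \<and> discrete Z \<and> two_sided_limit_condition Z"

text \<open>As \<open>open_arc z z\<close> is empty, \<open>z\<close> itself has to be excluded as a candidate neighbour of \<open>z\<close>.\<close>

definition predecessor :: "complex set \<Rightarrow> complex \<Rightarrow> complex" where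
  "predecessor Z z = (THE w. w \<in> Z \<and> w \<noteq> z \<and> open_arc w z \<inter> Z = {})"

definition successor :: "complex set \<Rightarrow> complex \<Rightarrow> complex" where
  "successor Z z = (THE w. w \<in> Z \<and> w \<noteq> z \<and> open_arc z w \<inter> Z = {})"

definition diagonals :: "complex set \<Rightarrow> complex set set" where
  "diagonals Z = {{x0, x1} | x0 x1.
     x0 \<in> Z \<and> x1 \<in> Z \<and> x1 \<notin> {predecessor Z x0, x0, successor Z x0}}"

definition cross :: "complex set \<Rightarrow> complex set \<Rightarrow> bool" where
  "cross P Y \<longleftrightarrow> (\<exists>x0 x1 y0 y1. P = {x0, x1} \<and> Y = {y0, y1} \<and>
     (cyc_less [x0, y0, x1, y1] \<or> cyc_less [x0, y1, x1, y0]))"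

definition converges_from_below :: "(nat \<Rightarrow> complex) \<Rightarrow> complex \<Rightarrow> bool" where
  "converges_from_below z p \<longleftrightarrow> z \<longlonglongrightarrow> p \<and>
     (\<exists>\<mu> \<in> circle - {p}. \<forall>\<^sub>F i in sequentially. z i \<in> closed_arc \<mu> p)"

definition converges_from_above :: "(nat \<Rightarrow> complex) \<Rightarrow> complex \<Rightarrow> bool" where
  "converges_from_above z p \<longleftrightarrow> z \<longlonglongrightarrow> p \<and>
     (\<exists>\<nu> \<in> circle - {p}. \<forall>\<^sub>F i in sequentially. z i \<in> closed_arc p \<nu>)"

definition PC1 :: "complex set \<Rightarrow> complex set set \<Rightarrow> bool" where
  "PC1 Z \<D> \<longleftrightarrow> (\<forall>p \<in> closure Z. \<forall>q \<in> closure Z. p \<noteq> q \<longrightarrow>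
     (\<exists>x0 x1. (\<forall>i. {x0 i, x1 i} \<in> \<D>) \<and> converges_from_below x0 p \<and> converges_from_below x1 q) \<longrightarrow>
     (\<exists>x0' x1'. (\<forall>i. {x0' i, x1' i} \<in> \<D>) \<and> converges_from_above x0' p \<and> converges_from_above x1' q))"

definition PC2 :: "complex set \<Rightarrow> complex set set \<Rightarrow> bool" where
  "PC2 Z \<D> \<longleftrightarrow> (\<forall>p \<in> closure Z. \<forall>q \<in> closure Z. p \<noteq> q \<longrightarrow>
     (\<exists>x0 x1. (\<forall>i. {x0 i, x1 i} \<in> \<D>) \<and> converges_from_below x0 p \<and> converges_from_above x1 q) \<longrightarrow>
     (\<exists>x0' x1'. (\<forall>i. {x0' i, x1' i} \<in> \<D>) \<and> converges_from_above x0' p \<and> converges_from_above x1' q))"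

definition ptolemy :: "complex set \<Rightarrow> complex set set \<Rightarrow> bool" where
  "ptolemy Z \<D> \<longleftrightarrow>
    (\<forall>x0 x1 y0 y1. {x0, x1} \<in> \<D> \<longrightarrow> {y0, y1} \<in> \<D> \<longrightarrow> cross {x0, x1} {y0, y1} \<longrightarrow>
      {{x0, y0}, {x0, y1}, {x1, y0}, {x1, y1}} \<inter> diagonals Z \<subseteq> \<D>)"

section \<open>Vector spaces as modules over a field\<close>

definition linear_maps ::
  "('k, 'r) ring_scheme \<Rightarrow> ('k, 'a, 'x) module_scheme \<Rightarrow> ('k, 'b, 'y) module_scheme \<Rightarrow> ('a \<Rightarrow> 'b) set"
  where
  "linear_maps K M N = {\<phi> \<in> carrier M \<rightarrow>\<^sub>E carrier N.
     (\<forall>x \<in> carrier M. \<forall>y \<in> carrier M. \<phi> (x \<oplus>\<^bsub>M\<^esub> y) = \<phi> x \<oplus>\<^bsub>N\<^esub> \<phi> y) \<and>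
     (\<forall>a \<in> carrier K. \<forall>x \<in> carrier M. \<phi> (a \<odot>\<^bsub>M\<^esub> x) = a \<odot>\<^bsub>N\<^esub> \<phi> x)}"

definition linear_isos ::
  "('k, 'r) ring_scheme \<Rightarrow> ('k, 'a, 'x) module_scheme \<Rightarrow> ('k, 'b, 'y) module_scheme \<Rightarrow> ('a \<Rightarrow> 'b) set"
  where
  "linear_isos K M N = {\<phi> \<in> linear_maps K M N. bij_betw \<phi> (carrier M) (carrier N)}"

definition ground_module :: "('k, 'r) ring_scheme \<Rightarrow> ('k, 'k) module" where
  "ground_module K = \<lparr>carrier = carrier K, mult = mult K, one = one K,
     zero = zero K, add = add K, smult = mult K\<rparr>"

text \<open>The multiplicative fields of a \<open>module\<close> record carry no meaning.\<close>

definition dual_module :: "('k, 'r) ring_scheme \<Rightarrow> ('k, 'a, 'x) module_scheme \<Rightarrow> ('k, 'a \<Rightarrow> 'k) module"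
  where
  "dual_module K M = \<lparr>carrier = linear_maps K M (ground_module K), mult = undefined, one = undefined,
     zero = (\<lambda>x \<in> carrier M. \<zero>\<^bsub>K\<^esub>),
     add = (\<lambda>\<phi> \<psi>. \<lambda>x \<in> carrier M. \<phi> x \<oplus>\<^bsub>K\<^esub> \<psi> x),
     smult = (\<lambda>a \<phi>. \<lambda>x \<in> carrier M. a \<otimes>\<^bsub>K\<^esub> \<phi> x)\<rparr>"

definition is_zero_space :: "('k, 'a, 'x) module_scheme \<Rightarrow> bool" where
  "is_zero_space M \<longleftrightarrow> carrier M = {\<zero>\<^bsub>M\<^esub>}"

definition is_one_dimensional :: "('k, 'r) ring_scheme \<Rightarrow> ('k, 'a, 'x) module_scheme \<Rightarrow> bool" where
  "is_one_dimensional K M \<longleftrightarrow> linear_isos K M (ground_module K) \<noteq> {}"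

definition finite_dimensional :: "('k, 'r) ring_scheme \<Rightarrow> ('k, 'a, 'x) module_scheme \<Rightarrow> bool" where
  "finite_dimensional K M \<longleftrightarrow> (\<exists>B. finite B \<and> B \<subseteq> carrier M \<and>
     (\<forall>x \<in> carrier M. \<exists>a \<in> B \<rightarrow> carrier K. x = (\<Oplus>\<^bsub>M\<^esub>b \<in> B. a b \<odot>\<^bsub>M\<^esub> b)))"

section \<open>Linear categories\<close>

text \<open>
  Composition (written in the order of functions) and the action of the suspension on morphisms do
  not take objects as arguments, since every small category can be presented with pairwise disjoint
  hom-sets.  Nothing is required of them outside the hom-sets.
\<close>

record ('o, 'm, 'k) lincat =
  Ob :: "'o set"
  Hom :: "'o \<Rightarrow> 'o \<Rightarrow> ('k, 'm) module"
  Id :: "'o \<Rightarrow> 'm"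
  Comp :: "'m \<Rightarrow> 'm \<Rightarrow> 'm" (infixl "\<cdot>\<index>" 75)

locale linear_category =
  fixes K :: "('k, 'r) ring_scheme" and C :: "('o, 'm, 'k, 'c) lincat_scheme"
  assumes ground_field: "field K"
    and Hom_module: "\<lbrakk>A \<in> Ob C; B \<in> Ob C\<rbrakk> \<Longrightarrow> module K (Hom C A B)"
    and Id_closed: "A \<in> Ob C \<Longrightarrow> Id C A \<in> carrier (Hom C A A)"
    and Comp_closed: "\<lbrakk>A \<in> Ob C; B \<in> Ob C; D \<in> Ob C;
      f \<in> carrier (Hom C A B); g \<in> carrier (Hom C B D)\<rbrakk> \<Longrightarrow> g \<cdot>\<^bsub>C\<^esub> f \<in> carrier (Hom C A D)"
    and Comp_Id: "\<lbrakk>A \<in> Ob C; B \<in> Ob C; f \<in> carrier (Hom C A B)\<rbrakk> \<Longrightarrow> f \<cdot>\<^bsub>C\<^esub> Id C A = f"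
    and Id_Comp: "\<lbrakk>A \<in> Ob C; B \<in> Ob C; f \<in> carrier (Hom C A B)\<rbrakk> \<Longrightarrow> Id C B \<cdot>\<^bsub>C\<^esub> f = f"
    and Comp_assoc: "\<lbrakk>A \<in> Ob C; B \<in> Ob C; D \<in> Ob C; F \<in> Ob C;
      f \<in> carrier (Hom C A B); g \<in> carrier (Hom C B D); h \<in> carrier (Hom C D F)\<rbrakk>
      \<Longrightarrow> (h \<cdot>\<^bsub>C\<^esub> g) \<cdot>\<^bsub>C\<^esub> f = h \<cdot>\<^bsub>C\<^esub> (g \<cdot>\<^bsub>C\<^esub> f)"
    and Comp_add_left: "\<lbrakk>A \<in> Ob C; B \<in> Ob C; D \<in> Ob C;
      f \<in> carrier (Hom C A B); g \<in> carrier (Hom C B D); g' \<in> carrier (Hom C B D)\<rbrakk>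
      \<Longrightarrow> (g \<oplus>\<^bsub>Hom C B D\<^esub> g') \<cdot>\<^bsub>C\<^esub> f = g \<cdot>\<^bsub>C\<^esub> f \<oplus>\<^bsub>Hom C A D\<^esub> g' \<cdot>\<^bsub>C\<^esub> f"
    and Comp_add_right: "\<lbrakk>A \<in> Ob C; B \<in> Ob C; D \<in> Ob C;
      f \<in> carrier (Hom C A B); f' \<in> carrier (Hom C A B); g \<in> carrier (Hom C B D)\<rbrakk>
      \<Longrightarrow> g \<cdot>\<^bsub>C\<^esub> (f \<oplus>\<^bsub>Hom C A B\<^esub> f') = g \<cdot>\<^bsub>C\<^esub> f \<oplus>\<^bsub>Hom C A D\<^esub> g \<cdot>\<^bsub>C\<^esub> f'"
    and Comp_smult_left: "\<lbrakk>A \<in> Ob C; B \<in> Ob C; D \<in> Ob C; a \<in> carrier K;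
      f \<in> carrier (Hom C A B); g \<in> carrier (Hom C B D)\<rbrakk>
      \<Longrightarrow> (a \<odot>\<^bsub>Hom C B D\<^esub> g) \<cdot>\<^bsub>C\<^esub> f = a \<odot>\<^bsub>Hom C A D\<^esub> (g \<cdot>\<^bsub>C\<^esub> f)"
    and Comp_smult_right: "\<lbrakk>A \<in> Ob C; B \<in> Ob C; D \<in> Ob C; a \<in> carrier K;
      f \<in> carrier (Hom C A B); g \<in> carrier (Hom C B D)\<rbrakk>
      \<Longrightarrow> g \<cdot>\<^bsub>C\<^esub> (a \<odot>\<^bsub>Hom C A B\<^esub> f) = a \<odot>\<^bsub>Hom C A D\<^esub> (g \<cdot>\<^bsub>C\<^esub> f)"

definition isomorphism :: "('o, 'm, 'k, 'c) lincat_scheme \<Rightarrow> 'o \<Rightarrow> 'o \<Rightarrow> 'm \<Rightarrow> bool" where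
  "isomorphism C A B f \<longleftrightarrow> f \<in> carrier (Hom C A B) \<and>
     (\<exists>g \<in> carrier (Hom C B A). g \<cdot>\<^bsub>C\<^esub> f = Id C A \<and> f \<cdot>\<^bsub>C\<^esub> g = Id C B)"

definition isomorphic :: "('o, 'm, 'k, 'c) lincat_scheme \<Rightarrow> 'o \<Rightarrow> 'o \<Rightarrow> bool" where
  "isomorphic C A B \<longleftrightarrow> A \<in> Ob C \<and> B \<in> Ob C \<and> (\<exists>f. isomorphism C A B f)"

definition zero_object :: "('o, 'm, 'k, 'c) lincat_scheme \<Rightarrow> 'o \<Rightarrow> bool" where
  "zero_object C A \<longleftrightarrow> A \<in> Ob C \<and> Id C A = \<zero>\<^bsub>Hom C A A\<^esub>"

text \<open>\<open>D\<close> is a biproduct of the finite family \<open>As\<close>; for the empty family it is a zero object.\<close>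

definition direct_sum :: "('o, 'm, 'k, 'c) lincat_scheme \<Rightarrow> 'o list \<Rightarrow> 'o \<Rightarrow> bool" where
  "direct_sum C As D \<longleftrightarrow> set As \<subseteq> Ob C \<and> D \<in> Ob C \<and>
    (\<exists>\<iota> \<pi>. (\<forall>j < length As. \<iota> j \<in> carrier (Hom C (As ! j) D) \<and> \<pi> j \<in> carrier (Hom C D (As ! j))) \<and>
      (\<forall>j < length As. \<forall>l < length As.
        \<pi> j \<cdot>\<^bsub>C\<^esub> \<iota> l = (if j = l then Id C (As ! j) else \<zero>\<^bsub>Hom C (As ! l) (As ! j)\<^esub>)) \<and>
      (\<Oplus>\<^bsub>Hom C D D\<^esub>j \<in> {..<length As}. \<iota> j \<cdot>\<^bsub>C\<^esub> \<pi> j) = Id C D)"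

definition has_finite_direct_sums :: "('o, 'm, 'k, 'c) lincat_scheme \<Rightarrow> bool" where
  "has_finite_direct_sums C \<longleftrightarrow> (\<forall>As. set As \<subseteq> Ob C \<longrightarrow> (\<exists>D. direct_sum C As D))"

definition direct_summand :: "('o, 'm, 'k, 'c) lincat_scheme \<Rightarrow> 'o \<Rightarrow> 'o \<Rightarrow> bool" where
  "direct_summand C A D \<longleftrightarrow> (\<exists>B. direct_sum C [A, B] D)"

definition indecomposable :: "('o, 'm, 'k, 'c) lincat_scheme \<Rightarrow> 'o \<Rightarrow> bool" where
  "indecomposable C A \<longleftrightarrow> A \<in> Ob C \<and> \<not> zero_object C A \<and>
     (\<forall>B D. direct_sum C [B, D] A \<longrightarrow> zero_object C B \<or> zero_object C D)"

text \<open>A ring is local if it is nonzero and the sum of any two non-units is a non-unit.\<close>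

definition local_endomorphism_ring :: "('o, 'm, 'k, 'c) lincat_scheme \<Rightarrow> 'o \<Rightarrow> bool" where
  "local_endomorphism_ring C A \<longleftrightarrow> A \<in> Ob C \<and> Id C A \<noteq> \<zero>\<^bsub>Hom C A A\<^esub> \<and>
     (\<forall>f \<in> carrier (Hom C A A). \<forall>g \<in> carrier (Hom C A A).
       \<not> isomorphism C A A f \<longrightarrow> \<not> isomorphism C A A g \<longrightarrow>
       \<not> isomorphism C A A (f \<oplus>\<^bsub>Hom C A A\<^esub> g))"

definition krull_schmidt :: "('o, 'm, 'k, 'c) lincat_scheme \<Rightarrow> bool" where
  "krull_schmidt C \<longleftrightarrow> has_finite_direct_sums C \<and>
     (\<forall>A \<in> Ob C. \<exists>As. (\<forall>B \<in> set As. local_endomorphism_ring C B) \<and> direct_sum C As A)"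

definition hom_finite :: "('k, 'r) ring_scheme \<Rightarrow> ('o, 'm, 'k, 'c) lincat_scheme \<Rightarrow> bool" where
  "hom_finite K C \<longleftrightarrow> (\<forall>A \<in> Ob C. \<forall>B \<in> Ob C. finite_dimensional K (Hom C A B))"

definition factors_through ::
  "('o, 'm, 'k, 'c) lincat_scheme \<Rightarrow> 'o \<Rightarrow> 'o \<Rightarrow> 'm \<Rightarrow> 'o \<Rightarrow> bool" where
  "factors_through C A B f S \<longleftrightarrow>
     (\<exists>u \<in> carrier (Hom C A S). \<exists>v \<in> carrier (Hom C S B). f = v \<cdot>\<^bsub>C\<^esub> u)"

definition add_closure :: "('o, 'm, 'k, 'c) lincat_scheme \<Rightarrow> 'o set \<Rightarrow> 'o set" where
  "add_closure C S = {A. \<exists>A' As D. isomorphic C A A' \<and> direct_summand C A' D \<and>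
     set As \<subseteq> S \<and> direct_sum C As D}"

section \<open>Triangulated categories\<close>

text \<open>An element \<open>(A, B, P, f, g, h)\<close> of \<open>Tri\<close> is the triangle \<open>A \<rightarrow> B \<rightarrow> P \<rightarrow> \<Sigma>A\<close>.\<close>

record ('o, 'm, 'k) tricat = "('o, 'm, 'k) lincat" +
  Susp :: "'o \<Rightarrow> 'o"
  SuspM :: "'m \<Rightarrow> 'm"
  Tri :: "('o \<times> 'o \<times> 'o \<times> 'm \<times> 'm \<times> 'm) set"

definition candidate_triangles ::
  "('o, 'm, 'k, 'c) tricat_scheme \<Rightarrow> ('o \<times> 'o \<times> 'o \<times> 'm \<times> 'm \<times> 'm) set" where
  "candidate_triangles C = {(A, B, P, f, g, h). A \<in> Ob C \<and> B \<in> Ob C \<and> P \<in> Ob C \<and>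
     f \<in> carrier (Hom C A B) \<and> g \<in> carrier (Hom C B P) \<and> h \<in> carrier (Hom C P (Susp C A))}"

locale linear_triangulated_category = linear_category K C
  for K :: "('k, 'r) ring_scheme" and C :: "('o, 'm, 'k, 'c) tricat_scheme" +
  assumes finite_direct_sums: "has_finite_direct_sums C"
    \<comment> \<open>the suspension is a linear autoequivalence\<close>
    and Susp_closed: "A \<in> Ob C \<Longrightarrow> Susp C A \<in> Ob C"
    and Susp_Id: "A \<in> Ob C \<Longrightarrow> SuspM C (Id C A) = Id C (Susp C A)"
    and Susp_Comp: "\<lbrakk>A \<in> Ob C; B \<in> Ob C; D \<in> Ob C;
      f \<in> carrier (Hom C A B); g \<in> carrier (Hom C B D)\<rbrakk>
      \<Longrightarrow> SuspM C (g \<cdot>\<^bsub>C\<^esub> f) = SuspM C g \<cdot>\<^bsub>C\<^esub> SuspM C f"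
    and Susp_linear_iso: "\<lbrakk>A \<in> Ob C; B \<in> Ob C\<rbrakk> \<Longrightarrow>
      restrict (SuspM C) (carrier (Hom C A B)) \<in>
        linear_isos K (Hom C A B) (Hom C (Susp C A) (Susp C B))"
    and Susp_ess_surj: "B \<in> Ob C \<Longrightarrow> \<exists>A \<in> Ob C. isomorphic C (Susp C A) B"
    \<comment> \<open>the distinguished triangles\<close>
    and Tri_candidate: "Tri C \<subseteq> candidate_triangles C"
    and Tri_iso_closed: "\<lbrakk>(A, B, P, f, g, h) \<in> Tri C;
      (A', B', P', f', g', h') \<in> candidate_triangles C;
      isomorphism C A A' a; isomorphism C B B' b; isomorphism C P P' c;
      b \<cdot>\<^bsub>C\<^esub> f = f' \<cdot>\<^bsub>C\<^esub> a; c \<cdot>\<^bsub>C\<^esub> g = g' \<cdot>\<^bsub>C\<^esub> b; SuspM C a \<cdot>\<^bsub>C\<^esub> h = h' \<cdot>\<^bsub>C\<^esub> c\<rbrakk>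
      \<Longrightarrow> (A', B', P', f', g', h') \<in> Tri C"
    and Tri_Id: "\<lbrakk>A \<in> Ob C; zero_object C P\<rbrakk>
      \<Longrightarrow> (A, A, P, Id C A, \<zero>\<^bsub>Hom C A P\<^esub>, \<zero>\<^bsub>Hom C P (Susp C A)\<^esub>) \<in> Tri C"
    and Tri_cone: "\<lbrakk>A \<in> Ob C; B \<in> Ob C; f \<in> carrier (Hom C A B)\<rbrakk>
      \<Longrightarrow> \<exists>P g h. (A, B, P, f, g, h) \<in> Tri C"
    and Tri_rotate: "(A, B, P, f, g, h) \<in> candidate_triangles C \<Longrightarrow>
      (A, B, P, f, g, h) \<in> Tri C \<longleftrightarrow>
      (B, P, Susp C A, g, h, \<ominus>\<^bsub>Hom C (Susp C A) (Susp C B)\<^esub> SuspM C f) \<in> Tri C"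
    and Tri_fill: "\<lbrakk>(A, B, P, f, g, h) \<in> Tri C; (A', B', P', f', g', h') \<in> Tri C;
      a \<in> carrier (Hom C A A'); b \<in> carrier (Hom C B B'); b \<cdot>\<^bsub>C\<^esub> f = f' \<cdot>\<^bsub>C\<^esub> a\<rbrakk>
      \<Longrightarrow> \<exists>c \<in> carrier (Hom C P P'). c \<cdot>\<^bsub>C\<^esub> g = g' \<cdot>\<^bsub>C\<^esub> b \<and> SuspM C a \<cdot>\<^bsub>C\<^esub> h = h' \<cdot>\<^bsub>C\<^esub> c"
    and Tri_octahedral: "\<lbrakk>(A, B, P, f, i, i') \<in> Tri C; (B, D, Y, g, j, j') \<in> Tri C;
      (A, D, W, g \<cdot>\<^bsub>C\<^esub> f, l, l') \<in> Tri C\<rbrakk>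
      \<Longrightarrow> \<exists>u v. (P, W, Y, u, v, SuspM C i \<cdot>\<^bsub>C\<^esub> j') \<in> Tri C \<and>
        u \<cdot>\<^bsub>C\<^esub> i = l \<cdot>\<^bsub>C\<^esub> g \<and> l' \<cdot>\<^bsub>C\<^esub> u = i' \<and> v \<cdot>\<^bsub>C\<^esub> l = j \<and> j' \<cdot>\<^bsub>C\<^esub> v = SuspM C f \<cdot>\<^bsub>C\<^esub> l'"

definition Ext1 :: "('o, 'm, 'k, 'c) tricat_scheme \<Rightarrow> 'o \<Rightarrow> 'o \<Rightarrow> ('k, 'm) module" where
  "Ext1 C A B = Hom C A (Susp C B)"

text \<open>
  The isomorphisms \<open>Ext\<^sup>1(A, B) \<cong> Ext\<^sup>1(B, A)\<^sup>*\<close> are natural in both arguments: for \<open>f : A' \<rightarrow> A\<close> and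
  \<open>g : B \<rightarrow> B'\<close> they intertwine \<open>e \<mapsto> \<Sigma>g \<circ> e \<circ> f\<close> with the transpose of \<open>e' \<mapsto> \<Sigma>f \<circ> e' \<circ> g\<close>.
\<close>

definition two_calabi_yau :: "('k, 'r) ring_scheme \<Rightarrow> ('o, 'm, 'k, 'c) tricat_scheme \<Rightarrow> bool" where
  "two_calabi_yau K C \<longleftrightarrow> (\<exists>\<Phi> :: 'o \<Rightarrow> 'o \<Rightarrow> 'm \<Rightarrow> 'm \<Rightarrow> 'k.
     (\<forall>A \<in> Ob C. \<forall>B \<in> Ob C. \<Phi> A B \<in> linear_isos K (Ext1 C A B) (dual_module K (Ext1 C B A))) \<and>
     (\<forall>A \<in> Ob C. \<forall>A' \<in> Ob C. \<forall>B \<in> Ob C. \<forall>B' \<in> Ob C.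
       \<forall>f \<in> carrier (Hom C A' A). \<forall>g \<in> carrier (Hom C B B').
       \<forall>e \<in> carrier (Ext1 C A B). \<forall>e' \<in> carrier (Ext1 C B' A').
         \<Phi> A' B' (SuspM C g \<cdot>\<^bsub>C\<^esub> e \<cdot>\<^bsub>C\<^esub> f) e' = \<Phi> A B e (SuspM C f \<cdot>\<^bsub>C\<^esub> e' \<cdot>\<^bsub>C\<^esub> g)))"

definition torsion_pair :: "('o, 'm, 'k, 'c) tricat_scheme \<Rightarrow> 'o set \<Rightarrow> 'o set \<Rightarrow> bool" where
  "torsion_pair C U V \<longleftrightarrow> U \<subseteq> Ob C \<and> V \<subseteq> Ob C \<and>
     (\<forall>u \<in> U. \<forall>v \<in> V. is_zero_space (Hom C u v)) \<and>
     (\<forall>t \<in> Ob C. \<exists>u \<in> U. \<exists>v \<in> V. \<exists>f g h. (u, t, v, f, g, h) \<in> Tri C)"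

section \<open>Igusa--Todorov cluster categories\<close>

text \<open>The chain \<open>x\<^sub>0 \<le> y\<^sub>0 \<le> x\<^sub>1\<^sup>-\<^sup>- < x\<^sub>1 \<le> y\<^sub>1 \<le> x\<^sub>0\<^sup>-\<^sup>-\<close>.\<close>

definition hom_position ::
  "complex set \<Rightarrow> complex \<Rightarrow> complex \<Rightarrow> complex \<Rightarrow> complex \<Rightarrow> bool" where
  "hom_position Z x0 x1 y0 y1 \<longleftrightarrow>
     cyc_le [x0, y0, predecessor Z (predecessor Z x1), x1, y1, predecessor Z (predecessor Z x0)] \<and>
     predecessor Z (predecessor Z x1) \<noteq> x1"

text \<open>
  The Igusa--Todorov cluster category of \<open>Z\<close> over \<open>K\<close> enters through its known properties:
  \<open>E\<close> assigns to each diagonal its indecomposable object.  Values of \<open>E\<close> on sets that are not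
  diagonals are irrelevant.
\<close>

locale igusa_todorov_category = linear_triangulated_category K C
  for Z :: "complex set" and K :: "('k, 'r) ring_scheme" and C :: "('o, 'm, 'k, 'c) tricat_scheme"
    and E :: "complex set \<Rightarrow> 'o" +
  assumes Hom_finite: "hom_finite K C"
    and Krull_Schmidt: "krull_schmidt C"
    and Calabi_Yau: "two_calabi_yau K C"
    and E_indecomposable: "P \<in> diagonals Z \<Longrightarrow> indecomposable C (E P)"
    and E_inj: "\<lbrakk>P \<in> diagonals Z; Y \<in> diagonals Z; isomorphic C (E P) (E Y)\<rbrakk> \<Longrightarrow> P = Y"
    and E_surj: "indecomposable C A \<Longrightarrow> \<exists>P \<in> diagonals Z. isomorphic C A (E P)"
    and Susp_E: "{x0, x1} \<in> diagonals Z \<Longrightarrow>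
      isomorphic C (Susp C (E {x0, x1})) (E {predecessor Z x0, predecessor Z x1})"
    and Ext1_E_cross: "\<lbrakk>P \<in> diagonals Z; Y \<in> diagonals Z; cross P Y\<rbrakk>
      \<Longrightarrow> is_one_dimensional K (Ext1 C (E P) (E Y))"
    and Ext1_E_noncross: "\<lbrakk>P \<in> diagonals Z; Y \<in> diagonals Z; \<not> cross P Y\<rbrakk>
      \<Longrightarrow> is_zero_space (Ext1 C (E P) (E Y))"
    and Hom_E_nonzero: "\<lbrakk>P \<in> diagonals Z; Y \<in> diagonals Z;
      \<exists>x0 x1 y0 y1. P = {x0, x1} \<and> Y = {y0, y1} \<and> hom_position Z x0 x1 y0 y1\<rbrakk>
      \<Longrightarrow> is_one_dimensional K (Hom C (E P) (E Y))"
    and Hom_E_zero: "\<lbrakk>P \<in> diagonals Z; Y \<in> diagonals Z;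
      \<nexists>x0 x1 y0 y1. P = {x0, x1} \<and> Y = {y0, y1} \<and> hom_position Z x0 x1 y0 y1\<rbrakk>
      \<Longrightarrow> is_zero_space (Hom C (E P) (E Y))"
    and factors_E: "\<lbrakk>{x0, x1} \<in> diagonals Z; {y0, y1} \<in> diagonals Z; S \<in> diagonals Z;
      hom_position Z x0 x1 y0 y1; f \<in> carrier (Hom C (E {x0, x1}) (E {y0, y1}));
      f \<noteq> \<zero>\<^bsub>Hom C (E {x0, x1}) (E {y0, y1})\<^esub>\<rbrakk>
      \<Longrightarrow> factors_through C (E {x0, x1}) (E {y0, y1}) f (E S) \<longleftrightarrow>
        (\<exists>s0 s1. S = {s0, s1} \<and> cyc_le [x0, s0, y0] \<and> cyc_le [x1, s1, y1])"

end

theory Submission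
  imports Defs
begin

text \<open>
  The proof passes through a finiteness condition on a set \<open>D\<close> of diagonals.  Write \<open>D\<close> also for the
  corresponding set of indecomposable objects.

  If \<open>(add D, Y)\<close> is a torsion pair, the triangle of an object \<open>t\<close> shows two things: every morphism
  from \<open>D\<close> to \<open>t\<close> factors through one fixed object of \<open>add D\<close>, and every \<open>t\<close> all of whose morphisms to
  the right orthogonal of \<open>D\<close> vanish lies in \<open>add D\<close>.  Conversely, these two properties give back a
  torsion pair: choose the approximation \<open>x \<rightarrow> t\<close> minimal (\<open>minimal_approximation\<close>) and apply Wakamatsu's
  lemma to its cone (\<open>wakamatsu\<close>).  So everything depends on two properties of \<open>D\<close>, and both can be read off from the diagonals.

  \<^item> Factorisation.  Morphisms from \<open>{x0, x1}\<close> to \<open>{a, b}\<close> live on a rectangle of pairs \<open>(x0, x1)\<close>, and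
    such a morphism factors through \<open>{s0, s1}\<close> exactly if \<open>(s0, s1)\<close> lies above \<open>(x0, x1)\<close> in the product
    order of that rectangle.  Hence approximations exist iff, in each rectangle, \<open>D\<close> has a finite
    dominating subset (\<open>finitely_dominated\<close>).  By compactness this is a local question at the pairs
    \<open>(p, q)\<close> of limit points: elements of \<open>D\<close> that approach \<open>(p, q)\<close> from any of the four quadrants must be
    dominated, near \<open>(p, q)\<close>, by an element of \<open>D\<close> in the upper right quadrant.  This is what PC1 and PC2
    say (\<open>PC_imp_finitely_dominated\<close>, \<open>finitely_dominated_imp_PC\<close>).

  \<^item> Double orthogonality.  There is a nonzero morphism from \<open>P\<close> to \<open>Q\<close> iff \<open>P\<close> crosses the diagonal
    of the successors of the end points of \<open>Q\<close>.  So the second property says: a diagonal that crosses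
    only diagonals which are themselves crossed by a member of \<open>D\<close> belongs to \<open>D\<close> (\<open>perp_closed\<close>).  The
    Ptolemy condition follows, because a diagonal that crosses a side of the quadrilateral of two
    crossing diagonals crosses one of these two.  For the converse one has to find, for \<open>{a, b}\<close> outside
    \<open>D\<close>, a diagonal that crosses \<open>{a, b}\<close> and no member of \<open>D\<close>; its end points are two successive maxima,
    which exist by finite domination (\<open>noncrossed_crossing_diagonal\<close>).

  Cyclic inequalities are turned into linear inequalities between anticlockwise angles from a common base
  point (\<open>ccw_angle_rebase\<close>), so that they are in reach of linear arithmetic.
\<close>

section \<open>Anticlockwise angles\<close>

lemma ccw_angle_bounds [simp]: "0 \<le> ccw_angle a x" "ccw_angle a x < 2 * pi"
  by (simp_all add: ccw_angle_def Arg2pi_lt_2pi Arg2pi_ge_0)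

lemma mult_cis_ccw_angle:
  assumes "a \<in> circle" "x \<in> circle"
  shows "a * cis (ccw_angle a x) = x"
proof -
  have "cmod (x / a) = 1" using assms by (simp add: norm_divide)
  then have "exp (\<i> * of_real (Arg2pi (x / a))) = x / a"
    by (simp only: complex_norm_eq_1_exp)
  moreover have "a \<noteq> 0" using assms by auto
  ultimately show ?thesis
    by (simp add: ccw_angle_def cis_conv_exp)
qed

lemma ccw_angle_unique:
  assumes "a \<in> circle" "a * cis t = x" "0 \<le> t" "t < 2 * pi"
  shows "ccw_angle a x = t"
proof -
  have "a \<noteq> 0" using assms by auto
  then have "x / a = of_real 1 * exp (\<i> * of_real t)"
    using assms(2) by (auto simp: cis_conv_exp)
  then show ?thesis
    unfolding ccw_angle_def using Arg2pi_unique[of 1 t "x / a"] assms by simp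
qed

lemma ccw_angle_self [simp]: "a \<in> circle \<Longrightarrow> ccw_angle a a = 0"
  by (rule ccw_angle_unique) auto

lemma ccw_angle_inj:
  assumes "w \<in> circle" "x \<in> circle" "y \<in> circle"
  shows "ccw_angle w x = ccw_angle w y \<longleftrightarrow> x = y"
  using mult_cis_ccw_angle[OF assms(1,2)] mult_cis_ccw_angle[OF assms(1,3)] by metis

lemma ccw_angle_eq_0:
  assumes "w \<in> circle" "x \<in> circle"
  shows "ccw_angle w x = 0 \<longleftrightarrow> x = w"
  using ccw_angle_inj[of w x w] assms by simp

text \<open>
  The key to all order arguments: once a base point \<open>w\<close> is chosen, every cyclic relation becomes a
  statement about the real numbers \<open>ccw_angle w x\<close>, with a correction by a full turn where \<open>w\<close> is passed.
\<close>

lemma ccw_angle_rebase: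
  assumes "w \<in> circle" "a \<in> circle" "x \<in> circle"
  shows "ccw_angle a x = (if ccw_angle w a \<le> ccw_angle w x
    then ccw_angle w x - ccw_angle w a else ccw_angle w x - ccw_angle w a + 2 * pi)"
proof (rule ccw_angle_unique[OF assms(2)])
  let ?s = "ccw_angle w x - ccw_angle w a"
  let ?t = "if ccw_angle w a \<le> ccw_angle w x then ?s else ?s + 2 * pi"
  have "cis ?t = cis ?s" by (simp add: cis.ctr)
  moreover have "a * cis ?s = w * cis (ccw_angle w a) * cis ?s"
    using mult_cis_ccw_angle[OF assms(1,2)] by simp
  moreover have "w * cis (ccw_angle w a) * cis ?s = w * cis (ccw_angle w x)"
    by (simp add: mult.assoc cis_mult)
  ultimately show "a * cis ?t = x"
    using mult_cis_ccw_angle[OF assms(1,3)] by metis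
  show "0 \<le> ?t" "?t < 2 * pi"
    using ccw_angle_bounds[of w a] ccw_angle_bounds[of w x] by (auto simp del: ccw_angle_bounds)
qed

lemma cyc_le_3 [simp]: "a \<in> circle \<Longrightarrow> cyc_le [a, x, b] \<longleftrightarrow> ccw_angle a x \<le> ccw_angle a b"
  by (simp add: cyc_le_def)

lemma cyc_less_3 [simp]:
  "a \<in> circle \<Longrightarrow> cyc_less [a, x, b] \<longleftrightarrow> 0 < ccw_angle a x \<and> ccw_angle a x < ccw_angle a b"
  by (auto simp: cyc_less_def)

lemma dist_cis_le: "dist (cis s) (cis t) \<le> \<bar>s - t\<bar>"
proof -
  have "norm (exp (\<i> * of_real (s - t)) - 1) \<le> \<bar>s - t\<bar>"
    using dist_exp_i_1[of "s - t"] abs_sin_x_le_abs_x[of "(s-t)/2"] by (simp add: cis_conv_exp)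
  moreover have "cis s - cis t = cis t * (cis (s - t) - 1)"
    by (simp add: algebra_simps cis_mult)
  ultimately show ?thesis
    by (simp add: dist_norm norm_mult cis_conv_exp del: of_real_diff)
qed

lemma dist_le_ccw_angle:
  assumes "x \<in> circle" "z \<in> circle"
  shows "dist z x \<le> ccw_angle x z" "dist z x \<le> 2 * pi - ccw_angle x z"
proof -
  have z: "z = x * cis (ccw_angle x z)" using mult_cis_ccw_angle[OF assms] by simp
  have eq: "dist z x = dist (cis (ccw_angle x z)) 1"
    using assms(1) by (subst z) (simp add: dist_norm norm_mult flip: right_diff_distrib' [of x _ 1, simplified])
  show "dist z x \<le> ccw_angle x z"
    using dist_cis_le[of "ccw_angle x z" 0] eq by simp
  show "dist z x \<le> 2 * pi - ccw_angle x z"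
    using dist_cis_le[of "ccw_angle x z" "2 * pi"] eq ccw_angle_bounds(2)[of x z]
    by (simp add: abs_if del: ccw_angle_bounds)
qed

text \<open>
  The circle minus a small arc around \<open>x\<close> is the compact image of an interval of angles, so it stays away
  from \<open>x\<close>.
\<close>

lemma ccw_angle_near:
  assumes "x \<in> circle" "0 < \<delta>"
  obtains \<epsilon> where "0 < \<epsilon>"
    "\<And>z. z \<in> circle \<Longrightarrow> dist z x < \<epsilon> \<Longrightarrow> ccw_angle x z < \<delta> \<or> 2 * pi - \<delta> < ccw_angle x z"
proof -
  let ?S = "(\<lambda>t. x * cis t) ` {\<delta>..2 * pi - \<delta>}"
  have "compact ?S"
    by (intro compact_continuous_image continuous_intros compact_Icc)
  then have "open (- ?S)" by (simp add: compact_imp_closed open_Compl)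
  moreover have "x \<in> - ?S"
  proof
    assume "x \<in> ?S"
    then obtain t where t: "\<delta> \<le> t" "t \<le> 2 * pi - \<delta>" "x * cis t = x" by auto
    then have "ccw_angle x x = t" using ccw_angle_unique[of x t x] assms by simp
    then show False using t assms by simp
  qed
  ultimately obtain \<epsilon> where "0 < \<epsilon>" and e: "ball x \<epsilon> \<subseteq> - ?S"
    using open_contains_ball by blast
  show ?thesis
  proof
    show "0 < \<epsilon>" by fact
    fix z assume z: "z \<in> circle" "dist z x < \<epsilon>"
    then have "z \<notin> ?S" using e by (auto simp: dist_commute subset_iff)
    then show "ccw_angle x z < \<delta> \<or> 2 * pi - \<delta> < ccw_angle x z"
      using mult_cis_ccw_angle[OF assms(1) z(1)] by (metis atLeastAtMost_iff image_eqI not_le)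
  qed
qed

section \<open>One-sided convergence, predecessors and successors\<close>

lemma circle_ccw_angle:
  assumes "a \<in> circle" "0 \<le> t" "t < 2 * pi"
  shows "a * cis t \<in> circle" "ccw_angle a (a * cis t) = t"
  using assms ccw_angle_unique[OF assms(1) refl assms(2,3)] by (auto simp: norm_mult)

text \<open>
  Replacing arcs and limits by angles: an approach from above is one with angles tending to \<open>0\<close>, an
  approach from below one with angles tending to a full turn, unless the point itself is met, whose angle
  is \<open>0\<close> and not \<open>2\<pi>\<close>.
\<close>

lemma converges_from_above_iff:
  assumes "\<And>i. z i \<in> circle" "p \<in> circle"
  shows "converges_from_above z p \<longleftrightarrow> (\<forall>\<delta>>0. \<forall>\<^sub>F i in sequentially. ccw_angle p (z i) < \<delta>)"
proof (intro iffI allI impI)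
  fix \<delta> :: real
  assume "converges_from_above z p" and "0 < \<delta>"
  then obtain \<nu> where lim: "z \<longlonglongrightarrow> p" and \<nu>: "\<nu> \<in> circle" "\<nu> \<noteq> p"
    and ev: "\<forall>\<^sub>F i in sequentially. z i \<in> closed_arc p \<nu>"
    unfolding converges_from_above_def by blast
  define \<delta>' where "\<delta>' = min \<delta> (2 * pi - ccw_angle p \<nu>)"
  have "0 < \<delta>'" using \<open>0 < \<delta>\<close> by (simp add: \<delta>'_def)
  then obtain \<epsilon> where "0 < \<epsilon>" and near:
    "\<And>z. z \<in> circle \<Longrightarrow> dist z p < \<epsilon> \<Longrightarrow> ccw_angle p z < \<delta>' \<or> 2 * pi - \<delta>' < ccw_angle p z"
    using ccw_angle_near[OF assms(2)] by metis
  have "\<forall>\<^sub>F i in sequentially. dist (z i) p < \<epsilon>"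
    using lim \<open>0 < \<epsilon>\<close> by (simp add: tendsto_iff)
  then show "\<forall>\<^sub>F i in sequentially. ccw_angle p (z i) < \<delta>"
    using ev
  proof eventually_elim
    case (elim i)
    then have "ccw_angle p (z i) \<le> ccw_angle p \<nu>"
      using assms by (simp add: closed_arc_def)
    with near[OF assms(1) elim(1)] show ?case by (auto simp: \<delta>'_def)
  qed
next
  assume small: "\<forall>\<delta>>0. \<forall>\<^sub>F i in sequentially. ccw_angle p (z i) < \<delta>"
  have "z \<longlonglongrightarrow> p"
    unfolding tendsto_iff
  proof (intro allI impI)
    fix \<epsilon> :: real assume "0 < \<epsilon>"
    then have "\<forall>\<^sub>F i in sequentially. ccw_angle p (z i) < \<epsilon>" using small by blast
    then show "\<forall>\<^sub>F i in sequentially. dist (z i) p < \<epsilon>"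
      by eventually_elim (use dist_le_ccw_angle(1)[OF assms(2) assms(1)] in \<open>meson le_less_trans\<close>)
  qed
  moreover have "\<exists>\<nu>\<in>circle - {p}. \<forall>\<^sub>F i in sequentially. z i \<in> closed_arc p \<nu>"
  proof
    have nu: "p * cis pi \<in> circle" "ccw_angle p (p * cis pi) = pi"
      using circle_ccw_angle[OF assms(2), of pi] by auto
    then show "p * cis pi \<in> circle - {p}" using assms(2) by fastforce
    have "\<forall>\<^sub>F i in sequentially. ccw_angle p (z i) < pi" using small by simp
    then show "\<forall>\<^sub>F i in sequentially. z i \<in> closed_arc p (p * cis pi)"
      by eventually_elim (use assms nu in \<open>simp add: closed_arc_def\<close>)
  qed
  ultimately show "converges_from_above z p" unfolding converges_from_above_def by blast
qed

lemma converges_from_below_iff: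
  assumes "\<And>i. z i \<in> circle" "p \<in> circle"
  shows "converges_from_below z p \<longleftrightarrow>
    (\<forall>\<delta>>0. \<forall>\<^sub>F i in sequentially. z i = p \<or> 2 * pi - \<delta> < ccw_angle p (z i))"
proof (intro iffI allI impI)
  fix \<delta> :: real
  assume "converges_from_below z p" and "0 < \<delta>"
  then obtain \<mu> where lim: "z \<longlonglongrightarrow> p" and \<mu>: "\<mu> \<in> circle" "\<mu> \<noteq> p"
    and ev: "\<forall>\<^sub>F i in sequentially. z i \<in> closed_arc \<mu> p"
    unfolding converges_from_below_def by blast
  define \<delta>' where "\<delta>' = min \<delta> (ccw_angle p \<mu>)"
  have "ccw_angle p \<mu> \<noteq> 0" using \<mu> assms(2) ccw_angle_eq_0 by blast
  then have "0 < \<delta>'" using \<open>0 < \<delta>\<close> ccw_angle_bounds(1)[of p \<mu>]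
    by (simp add: \<delta>'_def del: ccw_angle_bounds)
  then obtain \<epsilon> where "0 < \<epsilon>" and near:
    "\<And>z. z \<in> circle \<Longrightarrow> dist z p < \<epsilon> \<Longrightarrow> ccw_angle p z < \<delta>' \<or> 2 * pi - \<delta>' < ccw_angle p z"
    using ccw_angle_near[OF assms(2)] by metis
  have "\<forall>\<^sub>F i in sequentially. dist (z i) p < \<epsilon>"
    using lim \<open>0 < \<epsilon>\<close> by (simp add: tendsto_iff)
  then show "\<forall>\<^sub>F i in sequentially. z i = p \<or> 2 * pi - \<delta> < ccw_angle p (z i)"
    using ev
  proof eventually_elim
    case (elim i)
    then have "ccw_angle \<mu> (z i) \<le> ccw_angle \<mu> p"
      using \<mu> by (simp add: closed_arc_def)
    then have "z i = p \<or> ccw_angle p \<mu> \<le> ccw_angle p (z i)"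
      using ccw_angle_rebase[OF assms(2) \<mu>(1), of "z i"] ccw_angle_rebase[OF assms(2) \<mu>(1), of p]
        assms \<mu> ccw_angle_eq_0[OF assms(2), of "z i"] ccw_angle_bounds[of p "z i"] \<open>ccw_angle p \<mu> \<noteq> 0\<close>
        ccw_angle_bounds[of p \<mu>]
      by (auto split: if_splits simp del: ccw_angle_bounds)
    with near[OF assms(1) elim(1)] show ?case by (auto simp: \<delta>'_def)
  qed
next
  assume small: "\<forall>\<delta>>0. \<forall>\<^sub>F i in sequentially. z i = p \<or> 2 * pi - \<delta> < ccw_angle p (z i)"
  have "z \<longlonglongrightarrow> p"
    unfolding tendsto_iff
  proof (intro allI impI)
    fix \<epsilon> :: real assume e: "0 < \<epsilon>"
    then have "\<forall>\<^sub>F i in sequentially. z i = p \<or> 2 * pi - \<epsilon> < ccw_angle p (z i)" using small by blast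
    then show "\<forall>\<^sub>F i in sequentially. dist (z i) p < \<epsilon>"
      by eventually_elim (use dist_le_ccw_angle(2)[OF assms(2) assms(1)] e in \<open>smt (verit) dist_self\<close>)
  qed
  moreover have "\<exists>\<mu>\<in>circle - {p}. \<forall>\<^sub>F i in sequentially. z i \<in> closed_arc \<mu> p"
  proof
    have mu: "p * cis pi \<in> circle" "ccw_angle p (p * cis pi) = pi"
      using circle_ccw_angle[OF assms(2), of pi] by auto
    then show "p * cis pi \<in> circle - {p}" using assms(2) by fastforce
    have "\<forall>\<^sub>F i in sequentially. z i = p \<or> 2 * pi - pi < ccw_angle p (z i)"
      using small pi_gt_zero by blast
    then show "\<forall>\<^sub>F i in sequentially. z i \<in> closed_arc (p * cis pi) p"
    proof eventually_elim
      case (elim i)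
      then show ?case
        using mu assms(1)[of i] assms(2) ccw_angle_rebase[OF assms(2) mu(1) assms(1), of i]
          ccw_angle_rebase[OF assms(2) mu(1) assms(2)] ccw_angle_bounds[of p "z i"]
        unfolding closed_arc_def mu(2) mem_Collect_eq cyc_le_3[OF mu(1)]
        by (auto split: if_splits simp del: ccw_angle_bounds)
    qed
  qed
  ultimately show "converges_from_below z p" unfolding converges_from_below_def by blast
qed

locale admissible_set =
  fixes Z :: "complex set"
  assumes adm: "admissible Z"
begin

lemma in_circle: "z \<in> Z \<Longrightarrow> z \<in> circle"
  using adm by (auto simp: admissible_def)

lemma closure_in_circle: "z \<in> closure Z \<Longrightarrow> z \<in> circle"
  using closure_minimal[of Z circle] adm by (auto simp: admissible_def)

lemma isolated:
  assumes "z \<in> Z"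
  obtains \<delta> where "0 < \<delta>"
    "\<And>x. x \<in> Z \<Longrightarrow> x \<noteq> z \<Longrightarrow> \<delta> \<le> ccw_angle z x \<and> ccw_angle z x \<le> 2 * pi - \<delta>"
proof -
  have "z isolated_in Z" using adm assms by (auto simp: admissible_def discrete_def)
  then obtain \<delta> where "0 < \<delta>" and d: "\<forall>y\<in>Z. dist z y < \<delta> \<longrightarrow> y = z"
    unfolding isolated_in_dist_Ex_iff by blast
  show ?thesis
  proof
    show "0 < \<delta>" by fact
    fix x assume "x \<in> Z" "x \<noteq> z"
    then have "\<delta> \<le> dist x z" using d by (auto simp: dist_commute not_less)
    then show "\<delta> \<le> ccw_angle z x \<and> ccw_angle z x \<le> 2 * pi - \<delta>"
      using dist_le_ccw_angle[OF in_circle[OF assms] in_circle[OF \<open>x \<in> Z\<close>]] by linarith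
  qed
qed

text \<open>
  The form in which the two-sided limit condition is used.  The sequences it provides are monotone only
  in the sense of chains read from their own first element.  Letting the later term tend to \<open>x\<close> in these
  chains shows that the angles measured from \<open>x\<close> are bounded away from the wrong side.
\<close>

lemma limit_from_both_sides:
  assumes "x \<in> closure Z" "x \<notin> Z" "0 < \<delta>"
  shows "\<exists>z\<in>Z. 0 < ccw_angle x z \<and> ccw_angle x z < \<delta>" "\<exists>z\<in>Z. 2 * pi - \<delta> < ccw_angle x z"
proof -
  have x: "x \<in> circle" using assms closure_in_circle by blast
  have pos: "0 < ccw_angle x z" if "z \<in> Z" for z
    using ccw_angle_eq_0[OF x in_circle[OF that]] ccw_angle_bounds(1)[of x z] that assms(2)
    by (auto simp del: ccw_angle_bounds)
  have ex: "\<exists>z. range z \<subseteq> Z \<and> z \<longlonglongrightarrow> x"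
    using assms(1) unfolding closure_sequential by (auto simp: image_subset_iff)
  obtain y z where y: "range y \<subseteq> Z" "cyc_increasing y" "y \<longlonglongrightarrow> x"
    and z: "range z \<subseteq> Z" "cyc_decreasing z" "z \<longlonglongrightarrow> x"
    using adm x ex unfolding admissible_def two_sided_limit_condition_def by blast
  have near: "\<exists>n\<ge>N. ccw_angle x (u n) < d \<or> 2 * pi - d < ccw_angle x (u n)"
    if u: "u \<longlonglongrightarrow> x" "0 < d" "range u \<subseteq> Z" for u :: "nat \<Rightarrow> complex" and d N
  proof -
    obtain \<epsilon> where "0 < \<epsilon>" and near:
      "\<And>z. z \<in> circle \<Longrightarrow> dist z x < \<epsilon> \<Longrightarrow> ccw_angle x z < d \<or> 2 * pi - d < ccw_angle x z"
      using ccw_angle_near[OF x \<open>0 < d\<close>] by metis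
    obtain M where "\<forall>n\<ge>M. dist (u n) x < \<epsilon>"
      using metric_LIMSEQ_D[OF u(1) \<open>0 < \<epsilon>\<close>] by blast
    then have "dist (u (max M N)) x < \<epsilon>" by simp
    then show ?thesis using near[of "u (max M N)"] u(3) in_circle by (intro exI[of _ "max M N"]) auto
  qed
  have yZ: "y i \<in> Z" and zZ: "z i \<in> Z" for i using y z by auto
  note yC = in_circle[OF yZ] and zC = in_circle[OF zZ]
  note ypos = pos[OF yZ] and zpos = pos[OF zZ]
  have ymono: "ccw_angle (y 0) (y i) \<le> ccw_angle (y 0) (y j)" if "i < j" for i j
  proof -
    have "cyc_le (map y [0..<Suc j])" using y(2) unfolding cyc_increasing_def by blast
    then have "sorted_wrt (\<le>) (map (\<lambda>i. ccw_angle (y 0) (y i)) [0..<Suc j])"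
      by (simp add: cyc_le_def hd_append o_def del: upt_Suc) (simp add: upt_conv_Cons del: upt_Suc)
    then show ?thesis
      using that sorted_wrt_nth_less[of "(\<le>)" "map (\<lambda>i. ccw_angle (y 0) (y i)) [0..<Suc j]" i j]
      by (simp del: upt_Suc)
  qed
  have zmono: "ccw_angle (z n) (z j) \<le> ccw_angle (z n) (z i)" if "i < j" "j < n" for i j n
  proof -
    have "cyc_le (map z (rev [0..<Suc n]))" using z(2) unfolding cyc_decreasing_def by blast
    then have "sorted_wrt (\<le>) (map (\<lambda>i. ccw_angle (z n) (z i)) (rev [0..<Suc n]))"
      by (simp add: cyc_le_def o_def)
    then show ?thesis
      using that sorted_wrt_nth_less[of "(\<le>)" "map (\<lambda>i. ccw_angle (z n) (z i)) (rev [0..<Suc n])" "n - j" "n - i"]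
      by (simp add: rev_nth del: upt_Suc)
  qed
  have yge: "ccw_angle x (y 0) \<le> ccw_angle x (y i)" for i
  proof (rule ccontr)
    assume less: "\<not> ?thesis"
    define d where "d = min (ccw_angle x (y i)) (2 * pi - ccw_angle x (y 0))"
    have "0 < d" using ypos[of i] by (simp add: d_def)
    then obtain j where "j \<ge> Suc i" "ccw_angle x (y j) < d \<or> 2 * pi - d < ccw_angle x (y j)"
      using near[OF y(3) _ y(1)] by blast
    then show False
      using ymono[of i j] less ccw_angle_rebase[OF x yC yC, of 0 i] ccw_angle_rebase[OF x yC yC, of 0 j]
        ypos[of 0] ypos[of i] ypos[of j] ccw_angle_bounds(2)[of x "y j"]
      by (auto simp: d_def min_def split: if_splits simp del: ccw_angle_bounds)
  qed
  have zle: "ccw_angle x (z i) \<le> ccw_angle x (z 0)" for i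
  proof (rule ccontr)
    assume less: "\<not> ?thesis"
    then have "0 < i" by (cases i) auto
    define d where "d = min (ccw_angle x (z 0)) (2 * pi - ccw_angle x (z i))"
    have "0 < d" using zpos[of 0] by (simp add: d_def)
    then obtain j where "j \<ge> Suc i" "ccw_angle x (z j) < d \<or> 2 * pi - d < ccw_angle x (z j)"
      using near[OF z(3) _ z(1)] by blast
    then show False
      using zmono[of 0 i j] \<open>0 < i\<close> less ccw_angle_rebase[OF x zC zC, of j i] ccw_angle_rebase[OF x zC zC, of j 0]
        zpos[of 0] zpos[of i] zpos[of j] ccw_angle_bounds(2)[of x "z j"]
      by (auto simp: d_def min_def split: if_splits simp del: ccw_angle_bounds)
  qed
  have "0 < min \<delta> (ccw_angle x (y 0))" using assms(3) ypos[of 0] by simp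
  then obtain j where "ccw_angle x (y j) < min \<delta> (ccw_angle x (y 0)) \<or> 2 * pi - min \<delta> (ccw_angle x (y 0)) < ccw_angle x (y j)"
    using near[OF y(3) _ y(1)] by blast
  then have "2 * pi - \<delta> < ccw_angle x (y j)" using yge[of j] by (auto simp: min_def split: if_splits)
  then show "\<exists>z\<in>Z. 2 * pi - \<delta> < ccw_angle x z" using yZ by blast
  have "0 < min \<delta> (2 * pi - ccw_angle x (z 0))" using assms(3) by simp
  then obtain j where "ccw_angle x (z j) < min \<delta> (2 * pi - ccw_angle x (z 0)) \<or>
     2 * pi - min \<delta> (2 * pi - ccw_angle x (z 0)) < ccw_angle x (z j)"
    using near[OF z(3) _ z(1)] by blast
  then have "ccw_angle x (z j) < \<delta>" using zle[of j] by (auto simp: min_def split: if_splits)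
  then show "\<exists>z\<in>Z. 0 < ccw_angle x z \<and> ccw_angle x z < \<delta>" using zZ zpos by blast
qed

text \<open>
  The infimum of the angles from \<open>z\<close> to the other points is positive, as \<open>z\<close> is isolated.  It is attained:
  otherwise it would belong to a limit point approached from above only, against the two-sided condition.
\<close>

lemma successor_exists:
  assumes "z \<in> Z"
  shows "\<exists>w\<in>Z. w \<noteq> z \<and> (\<forall>x\<in>Z. x \<noteq> z \<longrightarrow> ccw_angle z w \<le> ccw_angle z x)"
proof -
  have zC: "z \<in> circle" using assms in_circle by blast
  obtain \<delta> where "0 < \<delta>" and iso:
    "\<And>x. x \<in> Z \<Longrightarrow> x \<noteq> z \<Longrightarrow> \<delta> \<le> ccw_angle z x \<and> ccw_angle z x \<le> 2 * pi - \<delta>"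
    using isolated[OF assms] by metis
  define S where "S = ccw_angle z ` (Z - {z})"
  have "infinite Z" using adm by (simp add: admissible_def)
  then have "S \<noteq> {}" unfolding S_def by (metis finite.emptyI finite_Diff2 finite_insert image_is_empty)
  have bdd: "bdd_below S" unfolding S_def by (intro bdd_belowI[of _ 0]) auto
  have low: "Inf S \<le> ccw_angle z x" if "x \<in> Z" "x \<noteq> z" for x
    using that bdd by (auto simp: S_def intro!: cInf_lower)
  have "\<delta> \<le> Inf S" using \<open>S \<noteq> {}\<close> iso by (auto simp: S_def intro!: cInf_greatest)
  obtain x0 where "x0 \<in> Z" "x0 \<noteq> z" using \<open>S \<noteq> {}\<close> by (auto simp: S_def)
  then have "Inf S < 2 * pi" using low[of x0] ccw_angle_bounds(2)[of z x0] by linarith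
  define p where "p = z * cis (Inf S)"
  have p: "p \<in> circle" "ccw_angle z p = Inf S"
    using circle_ccw_angle[OF zC, of "Inf S"] \<open>0 < \<delta>\<close> \<open>\<delta> \<le> Inf S\<close> \<open>Inf S < 2 * pi\<close> by (auto simp: p_def)
  have "p \<in> closure Z"
    unfolding closure_approachable
  proof (intro allI impI)
    fix e :: real assume "0 < e"
    then obtain x where x: "x \<in> Z" "x \<noteq> z" "ccw_angle z x < Inf S + e"
      using cInf_lessD[OF \<open>S \<noteq> {}\<close>, of "Inf S + e"] by (auto simp: S_def)
    have "ccw_angle p x < e"
      using ccw_angle_rebase[OF zC p(1) in_circle[OF x(1)]] low[OF x(1,2)] x(3) by (simp add: p(2))
    then show "\<exists>y\<in>Z. dist y p < e"
      using dist_le_ccw_angle(1)[OF p(1) in_circle[OF x(1)]] x(1) by force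
  qed
  have "p \<in> Z"
  proof (rule ccontr)
    assume "p \<notin> Z"
    then obtain y where y: "y \<in> Z" "2 * pi - Inf S < ccw_angle p y"
      using limit_from_both_sides(2)[OF \<open>p \<in> closure Z\<close>, of "Inf S"] \<open>0 < \<delta>\<close> \<open>\<delta> \<le> Inf S\<close> by auto
    then have "y \<noteq> z" using ccw_angle_rebase[OF zC p(1) zC] p(2) \<open>0 < \<delta>\<close> \<open>\<delta> \<le> Inf S\<close> zC by auto
    then have "Inf S \<le> ccw_angle z y" using low y by blast
    then show False
      using ccw_angle_rebase[OF zC p(1) in_circle[OF y(1)]] p(2) y(2) ccw_angle_bounds(2)[of z y]
      by (auto simp del: ccw_angle_bounds)
  qed
  moreover have "p \<noteq> z" using p \<open>0 < \<delta>\<close> \<open>\<delta> \<le> Inf S\<close> zC by auto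
  ultimately show ?thesis using low p(2) by metis
qed

lemma predecessor_exists:
  assumes "z \<in> Z"
  shows "\<exists>w\<in>Z. w \<noteq> z \<and> (\<forall>x\<in>Z. ccw_angle z x \<le> ccw_angle z w)"
proof -
  have zC: "z \<in> circle" using assms in_circle by blast
  obtain \<delta> where "0 < \<delta>" and iso:
    "\<And>x. x \<in> Z \<Longrightarrow> x \<noteq> z \<Longrightarrow> \<delta> \<le> ccw_angle z x \<and> ccw_angle z x \<le> 2 * pi - \<delta>"
    using isolated[OF assms] by metis
  define S where "S = ccw_angle z ` (Z - {z})"
  have "infinite Z" using adm by (simp add: admissible_def)
  then have "S \<noteq> {}" unfolding S_def by (metis finite.emptyI finite_Diff2 finite_insert image_is_empty)
  have bdd: "bdd_above S" unfolding S_def by (intro bdd_aboveI[of _ "2*pi"]) (auto intro: less_imp_le)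
  have up: "ccw_angle z x \<le> Sup S" if "x \<in> Z" "x \<noteq> z" for x
    using that bdd by (auto simp: S_def intro!: cSup_upper)
  have "Sup S \<le> 2 * pi - \<delta>" using \<open>S \<noteq> {}\<close> iso by (auto simp: S_def intro!: cSup_least)
  obtain x0 where "x0 \<in> Z" "x0 \<noteq> z" using \<open>S \<noteq> {}\<close> by (auto simp: S_def)
  then have "0 < Sup S" using up[of x0] iso[of x0] \<open>0 < \<delta>\<close> by linarith
  define p where "p = z * cis (Sup S)"
  have p: "p \<in> circle" "ccw_angle z p = Sup S"
    using circle_ccw_angle[OF zC, of "Sup S"] \<open>0 < \<delta>\<close> \<open>Sup S \<le> 2 * pi - \<delta>\<close> \<open>0 < Sup S\<close> by (auto simp: p_def)
  have "p \<in> closure Z"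
    unfolding closure_approachable
  proof (intro allI impI)
    fix e :: real assume "0 < e"
    then obtain x where x: "x \<in> Z" "x \<noteq> z" "Sup S - e < ccw_angle z x"
      using less_cSupD[OF \<open>S \<noteq> {}\<close>, of "Sup S - e"] by (auto simp: S_def)
    have "2 * pi - ccw_angle p x < e \<or> x = p"
      using ccw_angle_rebase[OF zC p(1) in_circle[OF x(1)]] up[OF x(1,2)] x(3)
        ccw_angle_inj[OF zC in_circle[OF x(1)] p(1)] by (auto simp: p(2))
    then show "\<exists>y\<in>Z. dist y p < e"
      using dist_le_ccw_angle(2)[OF p(1) in_circle[OF x(1)]] x(1) \<open>0 < e\<close> by force
  qed
  have "p \<in> Z"
  proof (rule ccontr)
    assume "p \<notin> Z"
    then obtain y where y: "y \<in> Z" "0 < ccw_angle p y" "ccw_angle p y < 2 * pi - Sup S"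
      using limit_from_both_sides(1)[OF \<open>p \<in> closure Z\<close>, of "2 * pi - Sup S"] \<open>0 < \<delta>\<close> \<open>Sup S \<le> 2 * pi - \<delta>\<close> by auto
    then have "y \<noteq> z" using ccw_angle_rebase[OF zC p(1) zC] p(2) \<open>0 < Sup S\<close> zC by auto
    then have "ccw_angle z y \<le> Sup S" using up y by blast
    then show False
      using ccw_angle_rebase[OF zC p(1) in_circle[OF y(1)]] p(2) y ccw_angle_bounds[of z y]
      by (auto simp del: ccw_angle_bounds split: if_splits)
  qed
  moreover have "p \<noteq> z" using p \<open>0 < Sup S\<close> zC by auto
  ultimately show ?thesis using up p(2) zC by (metis ccw_angle_self ccw_angle_bounds(1))
qed

abbreviation su :: "complex \<Rightarrow> complex" where "su \<equiv> successor Z"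
abbreviation pr :: "complex \<Rightarrow> complex" where "pr \<equiv> predecessor Z"

lemma successor_props:
  assumes "z \<in> Z"
  shows "su z \<in> Z" "su z \<noteq> z" "\<And>x. x \<in> Z \<Longrightarrow> x \<noteq> z \<Longrightarrow> ccw_angle z (su z) \<le> ccw_angle z x"
proof -
  have zC: "z \<in> circle" using assms in_circle by blast
  obtain w where w: "w \<in> Z" "w \<noteq> z" and least: "\<And>x. x \<in> Z \<Longrightarrow> x \<noteq> z \<Longrightarrow> ccw_angle z w \<le> ccw_angle z x"
    using successor_exists[OF assms] by blast
  have pos: "0 < ccw_angle z x" if "x \<in> Z" "x \<noteq> z" for x
    using ccw_angle_eq_0[OF zC in_circle[OF that(1)]] ccw_angle_bounds(1)[of z x] that(2)
    by (auto simp del: ccw_angle_bounds)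
  have "su z = w"
    unfolding successor_def
  proof (rule the_equality)
    show "w \<in> Z \<and> w \<noteq> z \<and> open_arc z w \<inter> Z = {}"
      using w least zC by (force simp: open_arc_def)
    fix v assume v: "v \<in> Z \<and> v \<noteq> z \<and> open_arc z v \<inter> Z = {}"
    then have "w \<notin> open_arc z v" using w by blast
    then have "ccw_angle z v \<le> ccw_angle z w"
      using pos[OF w] zC in_circle[OF w(1)] by (simp add: open_arc_def)
    then show "v = w" using least[of v] v ccw_angle_inj[OF zC, of v w] in_circle w by auto
  qed
  then show "su z \<in> Z" "su z \<noteq> z" "\<And>x. x \<in> Z \<Longrightarrow> x \<noteq> z \<Longrightarrow> ccw_angle z (su z) \<le> ccw_angle z x"
    using w least by auto
qed

lemma predecessor_props:
  assumes "z \<in> Z"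
  shows "pr z \<in> Z" "pr z \<noteq> z" "\<And>x. x \<in> Z \<Longrightarrow> ccw_angle z x \<le> ccw_angle z (pr z)"
proof -
  have zC: "z \<in> circle" using assms in_circle by blast
  obtain w where w: "w \<in> Z" "w \<noteq> z" and greatest: "\<And>x. x \<in> Z \<Longrightarrow> ccw_angle z x \<le> ccw_angle z w"
    using predecessor_exists[OF assms] by blast
  have pos: "0 < ccw_angle z x" if "x \<in> Z" "x \<noteq> z" for x
    using ccw_angle_eq_0[OF zC in_circle[OF that(1)]] ccw_angle_bounds(1)[of z x] that(2)
    by (auto simp del: ccw_angle_bounds)
  have arc: "x \<in> open_arc v z \<longleftrightarrow> ccw_angle z v < ccw_angle z x" if "x \<in> Z" "v \<in> Z" "v \<noteq> z" for x v
    using ccw_angle_rebase[OF zC in_circle[OF that(2)] in_circle[OF that(1)]] pos[OF that(2,3)]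
      ccw_angle_rebase[OF zC in_circle[OF that(2)] zC] in_circle[OF that(1)] in_circle[OF that(2)]
      ccw_angle_bounds[of z x] ccw_angle_bounds[of z v] zC
    unfolding open_arc_def mem_Collect_eq cyc_less_3[OF in_circle[OF that(2)]]
    by (auto simp del: ccw_angle_bounds split: if_splits)
  have "pr z = w"
    unfolding predecessor_def
  proof (rule the_equality)
    show "w \<in> Z \<and> w \<noteq> z \<and> open_arc w z \<inter> Z = {}"
      using w greatest arc[OF _ w] by force
    fix v assume v: "v \<in> Z \<and> v \<noteq> z \<and> open_arc v z \<inter> Z = {}"
    then have "w \<notin> open_arc v z" using w by blast
    then have "ccw_angle z w \<le> ccw_angle z v" using arc[of w v] v w by auto
    then show "v = w" using greatest[of v] v ccw_angle_inj[OF zC, of v w] in_circle w by auto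
  qed
  then show "pr z \<in> Z" "pr z \<noteq> z" "\<And>x. x \<in> Z \<Longrightarrow> ccw_angle z x \<le> ccw_angle z (pr z)"
    using w greatest by auto
qed

end

section \<open>Crossing diagonals and orthogonality\<close>

definition cyc_between :: "complex \<Rightarrow> complex \<Rightarrow> complex \<Rightarrow> bool" where
  "cyc_between a x b \<longleftrightarrow> 0 < ccw_angle a x \<and> ccw_angle a x < ccw_angle a b"

lemma cyc_between_base:
  assumes "w \<in> circle" "a \<in> circle" "x \<in> circle" "b \<in> circle"
  shows "cyc_between a x b \<longleftrightarrow>
    ccw_angle w a < ccw_angle w x \<and> ccw_angle w x < ccw_angle w b \<or>
    ccw_angle w x < ccw_angle w b \<and> ccw_angle w b < ccw_angle w a \<or>
    ccw_angle w b < ccw_angle w a \<and> ccw_angle w a < ccw_angle w x"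
  using ccw_angle_rebase[OF assms(1,2,3)] ccw_angle_rebase[OF assms(1,2,4)]
    ccw_angle_bounds[of w a] ccw_angle_bounds[of w b] ccw_angle_bounds[of w x]
  unfolding cyc_between_def by (auto simp del: ccw_angle_bounds split: if_splits)

lemma ccw_angle_pos:
  assumes "w \<in> circle" "x \<in> circle"
  shows "0 < ccw_angle w x \<longleftrightarrow> x \<noteq> w"
  using ccw_angle_eq_0[OF assms] ccw_angle_bounds(1)[of w x] by (auto simp del: ccw_angle_bounds)

lemma cyc_less_4:
  assumes "x0 \<in> circle" "y0 \<in> circle" "x1 \<in> circle" "y1 \<in> circle"
  shows "cyc_less [x0, y0, x1, y1] \<longleftrightarrow> cyc_between x0 y0 x1 \<and> cyc_between x1 y1 x0"
  using assms cyc_between_base[OF assms(1,3,4,1)] ccw_angle_bounds[of x0 y1] ccw_angle_pos[OF assms(1,4)]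
  by (auto simp: cyc_less_def cyc_between_def simp del: ccw_angle_bounds)

lemma cross_iff:
  assumes "x0 \<in> circle" "y0 \<in> circle" "x1 \<in> circle" "y1 \<in> circle"
  shows "cross {x0, x1} {y0, y1} \<longleftrightarrow> cyc_between x0 y0 x1 \<and> cyc_between x1 y1 x0 \<or> cyc_between x0 y1 x1 \<and> cyc_between x1 y0 x0"
proof -
  have "cyc_between x0 y1 x1 \<and> cyc_between x1 y0 x0" if "cyc_less [x1, y0, x0, y1]"
    using that assms by (simp add: cyc_less_4)
  moreover have "cross {x0, x1} {y0, y1} \<longleftrightarrow> cyc_less [x0, y0, x1, y1] \<or> cyc_less [x0, y1, x1, y0] \<or>
     cyc_less [x1, y0, x0, y1] \<or> cyc_less [x1, y1, x0, y0]"
    unfolding cross_def doubleton_eq_iff by blast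
  ultimately show ?thesis using assms by (auto simp: cyc_less_4)
qed

lemma cross_commute:
  assumes "x0 \<in> circle" "y0 \<in> circle" "x1 \<in> circle" "y1 \<in> circle" "cross {x0, x1} {y0, y1}"
  shows "cross {y0, y1} {x0, x1}"
proof -
  have "cyc_less [b, c, d, a]" if "cyc_less [a, b, c, d]" "a \<in> circle" "b \<in> circle" "c \<in> circle" "d \<in> circle" for a b c d
    using that ccw_angle_rebase[OF that(2,3,2)] ccw_angle_rebase[OF that(2,3,4)] ccw_angle_rebase[OF that(2,3,5)]
      ccw_angle_bounds(2)[of a d]
    by (auto simp: cyc_less_def simp del: ccw_angle_bounds)
  then have "cyc_less [x0, y0, x1, y1] \<Longrightarrow> cyc_less [y0, x1, y1, x0]" "cyc_less [x0, y1, x1, y0] \<Longrightarrow> cyc_less [y1, x1, y0, x0]"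
    using assms by blast+
  then show ?thesis using assms(5) assms(1-4) by (auto simp: cross_iff cyc_less_4)
qed

context admissible_set
begin

lemma su_in [simp]: "z \<in> Z \<Longrightarrow> su z \<in> Z" and pr_in [simp]: "z \<in> Z \<Longrightarrow> pr z \<in> Z"
  using successor_props predecessor_props by auto

text \<open>
  In the linear order with least element \<open>w\<close>, the successor is the next element, and \<open>w\<close> follows the
  last one.
\<close>

lemma successor_base:
  assumes "w \<in> Z" "z \<in> Z"
  shows "su z = w \<or> ccw_angle w z < ccw_angle w (su z)"
    and "x \<in> Z \<Longrightarrow> ccw_angle w z < ccw_angle w x \<Longrightarrow> ccw_angle w (su z) \<le> ccw_angle w x"
    and "x \<in> Z \<Longrightarrow> su z = w \<Longrightarrow> ccw_angle w x \<le> ccw_angle w z"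
proof -
  note C = in_circle[OF assms(1)] in_circle[OF assms(2)] in_circle[OF su_in[OF assms(2)]]
  note sp = successor_props[OF assms(2)]
  have pos: "0 < ccw_angle z (su z)" using ccw_angle_pos C sp by blast
  have ge: "ccw_angle w z \<le> ccw_angle w (su z)" if "su z \<noteq> w"
  proof (rule ccontr)
    assume n: "\<not> ?thesis"
    moreover have "0 < ccw_angle w (su z)" using that C ccw_angle_pos by blast
    moreover have "w \<noteq> z" using n C by auto
    ultimately show False
      using sp(3)[OF assms(1)] ccw_angle_rebase[OF C(1,2,3)] ccw_angle_rebase[OF C(1,2,1)] C(1)
      by (auto split: if_splits)
  qed
  show 1: "su z = w \<or> ccw_angle w z < ccw_angle w (su z)"
    using ge ccw_angle_inj[OF C] sp(2) by (metis order_less_le)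
  show "ccw_angle w (su z) \<le> ccw_angle w x" if x: "x \<in> Z" "ccw_angle w z < ccw_angle w x"
  proof -
    have "x \<noteq> z" using x by auto
    then show ?thesis
      using sp(3)[OF x(1)] ccw_angle_rebase[OF C(1,2,3)] ccw_angle_rebase[OF C(1,2) in_circle[OF x(1)]]
        x(2) ge C(1) by (auto split: if_splits)
  qed
  show "ccw_angle w x \<le> ccw_angle w z" if x: "x \<in> Z" "su z = w"
  proof (rule ccontr)
    assume n: "\<not> ?thesis"
    then have "x \<noteq> z" by auto
    then show False
      using sp(3)[OF x(1)] ccw_angle_rebase[OF C(1,2,1)] ccw_angle_rebase[OF C(1,2) in_circle[OF x(1)]]
        x(2) n C(1) ccw_angle_bounds(2)[of w x] ccw_angle_bounds(1)[of w z] pos by (auto split: if_splits simp del: ccw_angle_bounds)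
  qed
qed

lemma pr_su [simp]: assumes "z \<in> Z" shows "pr (su z) = z"
proof -
  have "ccw_angle (su z) (pr (su z)) = ccw_angle (su z) z"
    using successor_base(3)[OF su_in[OF assms] assms pr_in[OF su_in[OF assms]] refl]
      predecessor_props(3)[OF su_in[OF assms] assms] by linarith
  then show ?thesis using ccw_angle_inj in_circle assms su_in pr_in by metis
qed

lemma su_pr [simp]: assumes "z \<in> Z" shows "su (pr z) = z"
proof (rule ccontr)
  assume n: "su (pr z) \<noteq> z"
  then have "ccw_angle z (pr z) < ccw_angle z (su (pr z))"
    using successor_base(1)[OF assms pr_in[OF assms]] by blast
  then show False using predecessor_props(3)[OF assms su_in[OF pr_in[OF assms]]] by linarith
qed

lemma predecessor_base:
  assumes "w \<in> Z" "z \<in> Z" 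
  shows "z \<noteq> w \<Longrightarrow> ccw_angle w (pr z) < ccw_angle w z"
    and "x \<in> Z \<Longrightarrow> ccw_angle w x < ccw_angle w z \<Longrightarrow> ccw_angle w x \<le> ccw_angle w (pr z)"
    and "x \<in> Z \<Longrightarrow> ccw_angle w x \<le> ccw_angle w (pr w)"
  using successor_base(1)[OF assms(1) pr_in[OF assms(2)]] successor_base(2)[OF assms(1) pr_in[OF assms(2)], of x]
    successor_base(3)[OF assms(1) pr_in[OF assms(1)], of x] assms
  by (auto simp: not_less[symmetric])

lemma successor_iff_none_between:
  assumes "x \<in> Z" "y \<in> Z" "x \<noteq> y"
  shows "y = su x \<longleftrightarrow> (\<forall>z\<in>Z. \<not> cyc_between x z y)"
proof
  have s: "su x \<noteq> x" using successor_props assms by blast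
  show "\<forall>z\<in>Z. \<not> cyc_between x z y" if "y = su x"
    using that successor_props(3)[OF assms(1)] ccw_angle_self[OF in_circle[OF assms(1)]]
    unfolding cyc_between_def by (metis less_irrefl not_le)
  assume n: "\<forall>z\<in>Z. \<not> cyc_between x z y"
  then have "\<not> cyc_between x (su x) y" using su_in assms by blast
  then have "ccw_angle x y \<le> ccw_angle x (su x)"
    using s ccw_angle_pos in_circle assms su_in unfolding cyc_between_def by (meson not_less)
  moreover have "ccw_angle x (su x) \<le> ccw_angle x y" using successor_props(3)[OF assms(1,2)] assms by auto
  ultimately show "y = su x" using ccw_angle_inj in_circle assms su_in by (metis order_antisym)
qed

lemma diagonal_pair_iff:
  "{x, y} \<in> diagonals Z \<longleftrightarrow> x \<in> Z \<and> y \<in> Z \<and> x \<noteq> y \<and> y \<noteq> su x \<and> x \<noteq> su y"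
proof -
  have 1: "y = pr x \<longleftrightarrow> x = su y" if "x \<in> Z" "y \<in> Z" for x y using that by auto
  have "{x, y} \<in> diagonals Z \<longleftrightarrow> x \<in> Z \<and> y \<in> Z \<and> (y \<notin> {pr x, x, su x} \<or> x \<notin> {pr y, y, su y})"
    unfolding diagonals_def by (auto simp: doubleton_eq_iff)
  then show ?thesis using 1[of x y] 1[of y x] by auto
qed

text \<open>
  Describing diagonals by points on both sides makes them accessible to order arguments that do not
  mention neighbours.
\<close>

lemma diagonal_iff_between:
  "{x, y} \<in> diagonals Z \<longleftrightarrow> x \<in> Z \<and> y \<in> Z \<and> (\<exists>z\<in>Z. cyc_between x z y) \<and> (\<exists>z\<in>Z. cyc_between y z x)"
proof -
  have "\<not> cyc_between x z x" if "x \<in> Z" for z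
    using in_circle[OF that] by (auto simp: cyc_between_def)
  then show ?thesis
    using diagonal_pair_iff[of x y] successor_iff_none_between[of x y] successor_iff_none_between[of y x] by (cases "x = y") auto
qed

lemma diagonalE:
  assumes "P \<in> diagonals Z"
  obtains x y where "P = {x, y}" "x \<in> Z" "y \<in> Z"
  using assms unfolding diagonals_def by auto

text \<open>
  Passing from \<open>a\<close>, \<open>b\<close> to their successors replaces the weak inequalities and double predecessors by
  one strict chain, as no point of \<open>Z\<close> lies between a point and its successor: \<open>x1 \<le> b\<close> amounts to
  \<open>x1 < su b\<close>, and \<open>a \<le> pr (pr x1)\<close> to \<open>su a < x1\<close>.
\<close>

lemma hom_position_iff:
  assumes "x0 \<in> Z" "x1 \<in> Z" "a \<in> Z" "b \<in> Z"
  shows "hom_position Z x0 x1 a b \<longleftrightarrow> cyc_less [x0, su a, x1, su b]"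
proof -
  let ?t = "ccw_angle x0"
  have C: "x0 \<in> circle" using in_circle assms by blast
  have hp: "hom_position Z x0 x1 a b \<longleftrightarrow>
    ?t a \<le> ?t (pr (pr x1)) \<and> ?t (pr (pr x1)) \<le> ?t x1 \<and> ?t x1 \<le> ?t b \<and> ?t b \<le> ?t (pr (pr x0)) \<and> pr (pr x1) \<noteq> x1"
    using C by (auto simp: hom_position_def cyc_le_def)
  have cl: "cyc_less [x0, su a, x1, su b] \<longleftrightarrow> 0 < ?t (su a) \<and> ?t (su a) < ?t x1 \<and> ?t x1 < ?t (su b)"
    using C by (auto simp: cyc_less_def)
  have inj: "?t x = ?t y \<longleftrightarrow> x = y" if "x \<in> Z" "y \<in> Z" for x y
    using ccw_angle_inj C in_circle that by blast
  have ne: "pr x \<noteq> x" if "x \<in> Z" for x using predecessor_props that by blast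
  note prb = predecessor_base[OF assms(1)]
  have pp: "?t (pr (pr x0)) < ?t (pr x0)" using prb(1)[of "pr x0"] ne[of x0] assms by simp
  note Z = assms pr_in[OF assms(2)] pr_in[OF pr_in[OF assms(2)]] pr_in[OF assms(1)] su_in[OF assms(3)] su_in[OF assms(4)]
  show ?thesis
    unfolding hp cl
  proof safe
    assume h: "?t a \<le> ?t (pr (pr x1))" "?t (pr (pr x1)) \<le> ?t x1" "?t x1 \<le> ?t b" "?t b \<le> ?t (pr (pr x0))" "pr (pr x1) \<noteq> x1"
    have lt: "?t (pr (pr x1)) < ?t x1" using h inj[of "pr (pr x1)" x1] assms by auto
    then have "x1 \<noteq> x0" using C by (auto simp del: ccw_angle_bounds) (metis ccw_angle_bounds(1) not_le)
    have "pr x1 \<noteq> x0" using prb(3)[OF assms(1) assms(2)] lt by auto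
    then have l2: "?t (pr (pr x1)) < ?t (pr x1)" "?t (pr x1) < ?t x1"
      using prb(1)[of "pr x1"] prb(1)[of x1] \<open>x1 \<noteq> x0\<close> assms by auto
    have sa: "?t (su a) \<le> ?t (pr x1)" using successor_base(2)[OF assms(1,3) Z(5)] h(1) l2 by linarith
    have sb: "?t (su b) \<le> ?t (pr x0)" using successor_base(2)[OF assms(1,4) Z(7)] h pp by linarith
    have "su a \<noteq> x0"
      using successor_base(3)[OF assms(1,3) assms(2)] h(1) l2 by auto
    moreover have "su b \<noteq> x0"
      using successor_base(3)[OF assms(1,4) Z(7)] h pp by auto
    ultimately show "0 < ?t (su a)" "?t (su a) < ?t x1" "?t x1 < ?t (su b)"
      using successor_base(1)[OF assms(1,3)] successor_base(1)[OF assms(1,4)] sa sb l2 h ccw_angle_bounds(1)[of x0 a]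
      by (auto simp del: ccw_angle_bounds)
  next
    assume h: "0 < ?t (su a)" "?t (su a) < ?t x1" "?t x1 < ?t (su b)"
    then have ne0: "su a \<noteq> x0" "x1 \<noteq> x0" "su b \<noteq> x0"
      using C by auto
    have la: "?t a < ?t (su a)" and lb: "?t b < ?t (su b)"
      using successor_base(1)[OF assms(1,3)] successor_base(1)[OF assms(1,4)] ne0 by auto
    have 1: "?t (su a) \<le> ?t (pr x1)" using prb(2)[OF assms(2) Z(8)] h by blast
    then have "pr x1 \<noteq> x0" using h C by auto
    then have 2: "?t (pr (pr x1)) < ?t (pr x1)" "?t (pr x1) < ?t x1"
      using prb(1)[of "pr x1"] prb(1)[of x1] ne0 assms by auto
    show "?t a \<le> ?t (pr (pr x1))" using prb(2)[OF Z(5) assms(3)] la 1 by linarith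
    show "?t (pr (pr x1)) \<le> ?t x1" using 2 by linarith
    show "?t x1 \<le> ?t b" using prb(2)[OF Z(9) assms(2)] h assms by simp
    have "?t (su b) \<le> ?t (pr x0)" using prb(3)[OF assms(1) Z(9)] .
    then show "?t b \<le> ?t (pr (pr x0))" using prb(2)[OF Z(7) assms(4)] lb by linarith
    show False if "pr (pr x1) = x1" using that 2 by simp
  qed
qed

text \<open>
  The combinatorial criterion for the existence of nonzero morphisms between the two indecomposables.
\<close>

definition hom_nonzero :: "complex set \<Rightarrow> complex set \<Rightarrow> bool" where
  "hom_nonzero U Y \<longleftrightarrow> (\<exists>x0 x1 y0 y1. U = {x0, x1} \<and> Y = {y0, y1} \<and> hom_position Z x0 x1 y0 y1)"

text \<open>
  This is the combinatorial shadow of \<open>Hom(U, Y) = Ext\<^sup>1(U, \<Sigma>\<^sup>-\<^sup>1 Y)\<close>.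
\<close>

lemma hom_nonzero_iff_cross:
  assumes "U \<in> diagonals Z" "Y \<in> diagonals Z"
  shows "hom_nonzero U Y \<longleftrightarrow> cross U (su ` Y)"
proof -
  obtain x0 x1 where U: "U = {x0, x1}" "x0 \<in> Z" "x1 \<in> Z" using assms diagonalE by metis
  obtain y0 y1 where Y: "Y = {y0, y1}" "y0 \<in> Z" "y1 \<in> Z" using assms diagonalE by metis
  note C = in_circle[OF U(2)] in_circle[OF U(3)] in_circle[OF su_in[OF Y(2)]] in_circle[OF su_in[OF Y(3)]]
  have "hom_nonzero U Y \<longleftrightarrow> hom_position Z x0 x1 y0 y1 \<or> hom_position Z x1 x0 y0 y1
      \<or> hom_position Z x0 x1 y1 y0 \<or> hom_position Z x1 x0 y1 y0"
    unfolding hom_nonzero_def U(1) Y(1) doubleton_eq_iff by blast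
  also have "\<dots> \<longleftrightarrow> cross {x0, x1} {su y0, su y1}"
    using C by (auto simp: hom_position_iff U Y cross_iff cyc_less_4)
  finally show ?thesis by (simp add: U Y)
qed

lemma su_image_diagonal:
  assumes "P \<in> diagonals Z" shows "su ` P \<in> diagonals Z"
proof -
  obtain x y where P: "P = {x, y}" "x \<in> Z" "y \<in> Z" using assms diagonalE by metis
  have inj: "su a = su b \<longleftrightarrow> a = b" if "a \<in> Z" "b \<in> Z" for a b using pr_su that by metis
  show ?thesis using assms P by (auto simp: diagonal_pair_iff inj)
qed

lemma su_image_surj:
  assumes "P \<in> diagonals Z" obtains Q where "Q \<in> diagonals Z" "su ` Q = P"
proof -
  obtain x y where P: "P = {x, y}" "x \<in> Z" "y \<in> Z" using assms diagonalE by metis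
  show ?thesis
  proof
    show "su ` {pr x, pr y} = P" using P by simp
    have "pr x \<noteq> pr y" if "x \<noteq> y" using that P su_pr by metis
    moreover have "pr x \<noteq> y" "pr y \<noteq> x" using assms P diagonal_pair_iff by auto
    ultimately show "{pr x, pr y} \<in> diagonals Z" using assms P by (auto simp: diagonal_pair_iff)
  qed
qed

text \<open>
  \<open>D\<close> contains the left orthogonal of its right orthogonal, as far as indecomposable objects are
  concerned.
\<close>

definition perp_closed :: "complex set set \<Rightarrow> bool" where
  "perp_closed D \<longleftrightarrow> (\<forall>S\<in>diagonals Z.
     (\<forall>Q\<in>diagonals Z. (\<forall>U\<in>D. \<not> hom_nonzero U Q) \<longrightarrow> \<not> hom_nonzero S Q) \<longrightarrow> S \<in> D)"

text \<open>
  Taking successors permutes the diagonals, so the shift in the crossing criterion disappears.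
\<close>

lemma perp_closed_iff:
  assumes "D \<subseteq> diagonals Z"
  shows "perp_closed D \<longleftrightarrow> (\<forall>S\<in>diagonals Z.
     (\<forall>Q\<in>diagonals Z. (\<forall>U\<in>D. \<not> cross U Q) \<longrightarrow> \<not> cross S Q) \<longrightarrow> S \<in> D)"
proof -
  have "(\<forall>Q\<in>diagonals Z. (\<forall>U\<in>D. \<not> hom_nonzero U Q) \<longrightarrow> \<not> hom_nonzero S Q) \<longleftrightarrow>
     (\<forall>Q\<in>diagonals Z. (\<forall>U\<in>D. \<not> cross U Q) \<longrightarrow> \<not> cross S Q)" if "S \<in> diagonals Z" for S
  proof -
    have "(\<forall>Q\<in>diagonals Z. (\<forall>U\<in>D. \<not> hom_nonzero U Q) \<longrightarrow> \<not> hom_nonzero S Q) \<longleftrightarrow>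
       (\<forall>Q\<in>diagonals Z. (\<forall>U\<in>D. \<not> cross U (su ` Q)) \<longrightarrow> \<not> cross S (su ` Q))"
      using hom_nonzero_iff_cross assms that by (meson subsetD)
    also have "\<dots> \<longleftrightarrow> (\<forall>Q\<in>diagonals Z. (\<forall>U\<in>D. \<not> cross U Q) \<longrightarrow> \<not> cross S Q)"
      using su_image_diagonal su_image_surj by metis
    finally show ?thesis .
  qed
  then show ?thesis unfolding perp_closed_def by auto
qed

text \<open>
  A diagonal \<open>Q\<close> crossing the side \<open>{x0, y0}\<close> of the quadrilateral enters the triangle between this side and
  the two diagonals \<open>{x0, x1}\<close> and \<open>{y0, y1}\<close>; it can leave it only by crossing one of the latter.
\<close>

lemma perp_closed_imp_ptolemy:
  assumes D: "D \<subseteq> diagonals Z" and "perp_closed D"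
  shows "ptolemy Z D"
proof -
  have main: "{x0, y0} \<in> D" if x: "{x0, x1} \<in> D" and y: "{y0, y1} \<in> D"
    and cr: "cross {x0, x1} {y0, y1}" and S: "{x0, y0} \<in> diagonals Z" for x0 x1 y0 y1
  proof -
    have Z: "x0 \<in> Z" "x1 \<in> Z" "y0 \<in> Z" "y1 \<in> Z" using x y D diagonal_pair_iff by auto
    note C = Z[THEN in_circle]
    have "\<not> cross {x0, y0} Q" if Q: "Q \<in> diagonals Z" "\<forall>U\<in>D. \<not> cross U Q" for Q
    proof -
      obtain q q' where q: "Q = {q, q'}" "q \<in> Z" "q' \<in> Z" using Q diagonalE by metis
      note Cq = in_circle[OF q(2)] in_circle[OF q(3)]
      have nc: "\<not> cross {x0, x1} {q, q'}" "\<not> cross {y0, y1} {q, q'}" using Q x y q by auto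
      have b0: "cyc_between a b x0 \<longleftrightarrow> 0 < ccw_angle x0 a \<and> ccw_angle x0 a < ccw_angle x0 b"
        if "a \<in> circle" "b \<in> circle" for a b
        using cyc_between_base[OF C(1) that C(1)] C(1) ccw_angle_bounds(1)[of x0 b] ccw_angle_bounds(1)[of x0 a]
        by (auto simp del: ccw_angle_bounds)
      show ?thesis
      proof
        assume S: "cross {x0, y0} Q"
        note facts = cr[unfolded cross_iff[OF C(1,3,2,4)] b0[OF C(2,3)] b0[OF C(2,4)]]
          S[unfolded q(1) cross_iff[OF C(1) Cq(1) C(3) Cq(2)] b0[OF C(3) Cq(1)] b0[OF C(3) Cq(2)]]
          nc(1)[unfolded cross_iff[OF C(1) Cq(1) C(2) Cq(2)] b0[OF C(2) Cq(1)] b0[OF C(2) Cq(2)]]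
          nc(2)[unfolded cross_iff[OF C(3) Cq(1) C(4) Cq(2)] cyc_between_base[OF C(1,3) Cq(1) C(4)] cyc_between_base[OF C(1,4) Cq(1) C(3)]
            cyc_between_base[OF C(1,3) Cq(2) C(4)] cyc_between_base[OF C(1,4) Cq(2) C(3)]]
        from facts show False
          unfolding cyc_between_def by argo
      qed
    qed
    then show ?thesis using assms perp_closed_iff S by blast
  qed
  show ?thesis
    unfolding ptolemy_def
  proof (intro allI impI subsetI)
    fix x0 x1 y0 y1 s
    assume h: "{x0, x1} \<in> D" "{y0, y1} \<in> D" "cross {x0, x1} {y0, y1}"
      "s \<in> {{x0, y0}, {x0, y1}, {x1, y0}, {x1, y1}} \<inter> diagonals Z"
    then show "s \<in> D"
      using main[of x0 x1 y0 y1] main[of x0 x1 y1 y0] main[of x1 x0 y0 y1] main[of x1 x0 y1 y0]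
      by (auto simp: insert_commute)
  qed
qed

text \<open>
  The pairs \<open>(s0, s1)\<close> above \<open>(x0, x1)\<close> are those through which a nonzero morphism to \<open>{a, b}\<close> factors, so
  \<open>F\<close> lists the summands of a right approximation of \<open>{a, b}\<close>.
\<close>

definition finitely_dominated :: "complex set set \<Rightarrow> bool" where
  "finitely_dominated D \<longleftrightarrow> (\<forall>a b. {a, b} \<in> diagonals Z \<longrightarrow>
     (\<exists>F. finite F \<and> F \<subseteq> D \<and> (\<forall>x0 x1. {x0, x1} \<in> D \<longrightarrow> hom_position Z x0 x1 a b \<longrightarrow>
        (\<exists>s0 s1. {s0, s1} \<in> F \<and> cyc_le [x0, s0, a] \<and> cyc_le [x1, s1, b]))))"

end

section \<open>A non-crossed diagonal from the Ptolemy condition\<close>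

lemma finite_max:
  fixes f :: "'a \<Rightarrow> real"
  assumes "finite A" "A \<noteq> {}"
  obtains m where "m \<in> A" "\<And>x. x \<in> A \<Longrightarrow> f x \<le> f m"
proof -
  have "Max (f ` A) \<in> f ` A" using assms by (intro Max_in) auto
  then obtain m where "m \<in> A" "f m = Max (f ` A)" by auto
  then show ?thesis using that[of m] Max_ge[of "f ` A"] assms(1) by auto
qed

context admissible_set
begin

lemma diagonal_between_base:
  assumes "w \<in> Z" "x \<in> Z" "z \<in> Z" "y \<in> Z" "z' \<in> Z"
    and "ccw_angle w x < ccw_angle w z" "ccw_angle w z < ccw_angle w y"
    and "ccw_angle w z' < ccw_angle w x \<or> ccw_angle w y < ccw_angle w z'"
  shows "{x, y} \<in> diagonals Z"
proof -
  note C = assms(1-5)[THEN in_circle]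
  have "cyc_between x z y" using cyc_between_base[OF C(1-4)] assms by blast
  moreover have "cyc_between y z' x" using cyc_between_base[OF C(1,4,5,2)] assms by linarith
  ultimately show ?thesis using diagonal_iff_between assms by blast
qed

text \<open>
  The diagonal is \<open>{v, u}\<close>, in the order \<open>b < v < a < u\<close> seen from \<open>b\<close>.  The point \<open>v\<close> is the last one before
  \<open>a\<close> that is joined to \<open>b\<close> by an element of \<open>D\<close>, or the successor of \<open>b\<close>.  The point \<open>u\<close> is the last one
  before \<open>b\<close> that is joined to a point of \<open>(v, a]\<close>, or the successor of \<open>a\<close>.  These maxima exist since
  finitely many elements of \<open>D\<close> dominate all others.  Suppose that an element of \<open>D\<close> crosses \<open>{v, u}\<close>.  If it
  joins \<open>(v, a]\<close> to \<open>(u, b]\<close>, it contradicts one of the two choices directly.  Otherwise it crosses \<open>{b, v}\<close>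
  or the element of \<open>D\<close> that ends in \<open>u\<close>, and the Ptolemy condition produces one that does, after one step
  or two.  Choosing \<open>u\<close> from the neighbours of \<open>a\<close> alone would miss the elements of \<open>D\<close> that cross \<open>{a, b}\<close>.
\<close>

lemma noncrossed_crossing_diagonal:
  assumes D: "D \<subseteq> diagonals Z" and fd: "finitely_dominated D" and pt: "ptolemy Z D"
    and S: "{a, b} \<in> diagonals Z" "{a, b} \<notin> D"
  shows "\<exists>G\<in>diagonals Z. cross {a, b} G \<and> (\<forall>U\<in>D. \<not> cross U G)"
proof -
  have Z: "a \<in> Z" "b \<in> Z" "a \<noteq> b" "b \<noteq> su a" "a \<noteq> su b" using S diagonal_pair_iff by auto
  note aC = in_circle[OF Z(1)] and bC = in_circle[OF Z(2)]
  let ?t = "ccw_angle b"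
  have DZ: "x \<in> Z \<and> y \<in> Z" if "{x, y} \<in> D" for x y using that D diagonal_pair_iff by blast
  have inj: "?t x = ?t y \<longleftrightarrow> x = y" if "x \<in> Z" "y \<in> Z" for x y
    using ccw_angle_inj bC in_circle that by blast
  have tb: "?t b = 0" using bC by simp
  have pos: "0 < ?t x" if "x \<in> Z" "x \<noteq> b" for x using that ccw_angle_pos bC in_circle by blast
  have sub: "0 < ?t (su b)" "\<And>x. x \<in> Z \<Longrightarrow> 0 < ?t x \<Longrightarrow> ?t (su b) \<le> ?t x"
    using successor_base(1,2)[OF Z(2) Z(2)] tb pos successor_props(2)[OF Z(2)] su_in[OF Z(2)] by auto
  have sua: "?t a < ?t (su a)" "\<And>x. x \<in> Z \<Longrightarrow> ?t a < ?t x \<Longrightarrow> ?t (su a) \<le> ?t x"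
    using successor_base(1,2)[OF Z(2) Z(1)] Z(4) by auto
  have ta: "?t (su b) < ?t a"
    using sub(2)[OF Z(1) pos[OF Z(1,3)]] inj[OF Z(1) su_in[OF Z(2)]] Z(5) by linarith
  obtain F where F: "finite F" "F \<subseteq> D" and dom: "\<And>x0 x1. {x0, x1} \<in> D \<Longrightarrow> hom_position Z x0 x1 a b \<Longrightarrow>
        \<exists>s0 s1. {s0, s1} \<in> F \<and> cyc_le [x0, s0, a] \<and> cyc_le [x1, s1, b]"
    using fd[unfolded finitely_dominated_def, rule_format, OF S(1)] by metis
  have "finite P" if "P \<in> diagonals Z" for P
    using diagonalE[OF that] by (metis finite.emptyI finite_insert)
  then have finU: "finite (\<Union>F)" using F D by blast
  have pos_iff: "hom_position Z x y a b \<longleftrightarrow> ?t (su b) < ?t x \<and> ?t x \<le> ?t a \<and> (?t (su a) < ?t y \<or> y = b)"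
    if "x \<in> Z" "y \<in> Z" for x y
  proof -
    note C = in_circle[OF that(1)] in_circle[OF that(2)] in_circle[OF su_in[OF Z(1)]] in_circle[OF su_in[OF Z(2)]]
    have "?t x < ?t (su a) \<longleftrightarrow> ?t x \<le> ?t a" using sua(1) sua(2)[OF that(1)] by linarith
    then show ?thesis
      unfolding hom_position_iff[OF that Z(1,2)] cyc_less_4[OF C(1,3,2,4)] cyc_between_base[OF bC C(1,3,2)] cyc_between_base[OF bC C(2,4,1)]
      using ta sua(1) tb sub(1) pos[OF that(2)] sub(2)[OF that(2)] by (cases "y = b") auto
  qed
  \<comment> \<open>\<open>su b\<close> stands in if no element of \<open>D\<close> joins \<open>b\<close> to \<open>(b, a)\<close>\<close>
  define V where "V = {v \<in> (\<Union>F). {b, v} \<in> D \<and> 0 < ?t v \<and> ?t v < ?t a} \<union> {su b}"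
  have "finite V" "V \<noteq> {}" by (auto simp: V_def intro: finite_subset[OF _ finU])
  then obtain v where v: "v \<in> V" and vmax0: "\<And>x. x \<in> V \<Longrightarrow> ?t x \<le> ?t v"
    using finite_max[of V ?t] by metis
  have vZ: "v \<in> Z" using v DZ Z by (auto simp: V_def)
  have vD: "v \<noteq> su b \<Longrightarrow> {b, v} \<in> D" and tv: "0 < ?t v" "?t (su b) \<le> ?t v" "?t v < ?t a"
    using v sub ta vmax0[of "su b"] by (auto simp: V_def)
  have vmax: "?t x \<le> ?t v" if x: "{b, x} \<in> D" "?t x \<le> ?t a" for x
  proof (rule ccontr)
    assume n: "\<not> ?t x \<le> ?t v"
    have xZ: "x \<in> Z" using DZ x by blast
    have "x \<noteq> a" using x S by (auto simp: insert_commute)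
    have "hom_position Z x b a b" using pos_iff[OF xZ Z(2)] n tv x by auto
    then obtain s0 s1 where s: "{s0, s1} \<in> F" "cyc_le [x, s0, a]" "cyc_le [b, s1, b]"
      using dom[of x b] x by (auto simp: insert_commute)
    have sZ: "s0 \<in> Z" "s1 \<in> Z" using s F DZ by blast+
    have "?t s1 = 0" using s(3) bC ccw_angle_bounds(1)[of b s1] by (simp del: ccw_angle_bounds)
    then have "s1 = b" using sZ pos by force
    have "?t x \<le> ?t s0 \<and> ?t s0 \<le> ?t a"
      using s(2) in_circle[OF xZ] ccw_angle_rebase[OF bC in_circle[OF xZ] in_circle[OF sZ(1)]]
        ccw_angle_rebase[OF bC in_circle[OF xZ] aC] x ccw_angle_bounds[of b s0] ccw_angle_bounds[of b a]
      by (auto split: if_splits simp del: ccw_angle_bounds)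
    moreover have "s0 \<noteq> a" using s(1) \<open>s1 = b\<close> F S by auto
    ultimately have "s0 \<in> V"
      using s(1) \<open>s1 = b\<close> F n tv inj[OF sZ(1) Z(1)] by (auto simp: V_def insert_commute)
    then show False using vmax0 n \<open>?t x \<le> ?t s0 \<and> ?t s0 \<le> ?t a\<close> by force
  qed
  have noSb: False if "{b, x} \<in> D" "?t v < ?t x" "?t x \<le> ?t a" for x using vmax that by force
  \<comment> \<open>again \<open>su a\<close> is the default\<close>
  define W where "W = {u \<in> (\<Union>F). ?t a < ?t u \<and> (\<exists>x. {x, u} \<in> D \<and> ?t v < ?t x \<and> ?t x \<le> ?t a)} \<union> {su a}"
  have "finite W" "W \<noteq> {}" by (auto simp: W_def intro: finite_subset[OF _ finU])
  then obtain u where u: "u \<in> W" and umax0: "\<And>x. x \<in> W \<Longrightarrow> ?t x \<le> ?t u"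
    using finite_max[of W ?t] by metis
  have uZ: "u \<in> Z" using u DZ Z by (auto simp: W_def)
  have uD: "\<exists>x. {x, u} \<in> D \<and> ?t v < ?t x \<and> ?t x \<le> ?t a" if "u \<noteq> su a" using u that by (auto simp: W_def)
  have tu: "?t a < ?t u" "?t (su a) \<le> ?t u"
    using u sua umax0[of "su a"] by (auto simp: W_def)
  have umax: "?t y \<le> ?t u" if y: "{x, y} \<in> D" "?t v < ?t x" "?t x \<le> ?t a" for x y
  proof (rule ccontr)
    assume n: "\<not> ?t y \<le> ?t u"
    have xZ: "x \<in> Z" and yZ: "y \<in> Z" using DZ y by blast+
    have "hom_position Z x y a b" using pos_iff[OF xZ yZ] n tv tu y by auto
    then obtain s0 s1 where s: "{s0, s1} \<in> F" "cyc_le [x, s0, a]" "cyc_le [y, s1, b]"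
      using dom[of x y] y by blast
    have sZ: "s0 \<in> Z" "s1 \<in> Z" using s F DZ by blast+
    have s0: "?t x \<le> ?t s0" "?t s0 \<le> ?t a"
      using s(2) in_circle[OF xZ] ccw_angle_rebase[OF bC in_circle[OF xZ] in_circle[OF sZ(1)]]
        ccw_angle_rebase[OF bC in_circle[OF xZ] aC] y ccw_angle_bounds[of b s0] ccw_angle_bounds[of b a]
      by (auto split: if_splits simp del: ccw_angle_bounds)
    have "s1 \<noteq> b"
      using noSb[of s0] s0 y s(1) F by (auto simp: insert_commute)
    have s1: "?t y \<le> ?t s1"
      using s(3) in_circle[OF yZ] ccw_angle_rebase[OF bC in_circle[OF yZ] in_circle[OF sZ(2)]]
        ccw_angle_rebase[OF bC in_circle[OF yZ] bC] pos[OF sZ(2) \<open>s1 \<noteq> b\<close>] tb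
      by (auto split: if_splits simp del: ccw_angle_bounds)
    have "s1 \<in> W"
      using s(1) F n tu s0 s1 y by (auto simp: W_def intro!: exI[of _ s0])
    then show False using umax0[of s1] s1 n by simp
  qed
  have pt': "{x, y} \<in> D" if "{x, x1} \<in> D" "{y, y1} \<in> D" "cross {x, x1} {y, y1}" "{x, y} \<in> diagonals Z" for x x1 y y1
    using pt that unfolding ptolemy_def by blast
  have crossI: "cross {x0, x1} {y0, y1}" if "x0 \<in> Z" "y0 \<in> Z" "x1 \<in> Z" "y1 \<in> Z"
    "?t x0 < ?t y0" "?t y0 < ?t x1" "?t x1 < ?t y1 \<or> ?t y1 < ?t x0" for x0 y0 x1 y1
  proof -
    note C = that(1-4)[THEN in_circle]
    have "cyc_between x0 y0 x1 \<and> cyc_between x1 y1 x0"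
      unfolding cyc_between_base[OF bC C(1-3)] cyc_between_base[OF bC C(3,4,1)] using that by linarith
    then show ?thesis using cross_iff[OF C] by blast
  qed
  have G: "{v, u} \<in> diagonals Z"
    by (rule diagonal_between_base[OF Z(2) vZ Z(1) uZ Z(2)]) (use tv tu tb in auto)
  have ncr: "\<not> (?t v < ?t c0 \<and> ?t c0 < ?t u \<and> (?t c1 < ?t v \<or> ?t u < ?t c1))" if c: "{c0, c1} \<in> D" for c0 c1
  proof
    assume h: "?t v < ?t c0 \<and> ?t c0 < ?t u \<and> (?t c1 < ?t v \<or> ?t u < ?t c1)"
    have cZ: "c0 \<in> Z" "c1 \<in> Z" using c DZ by auto
    have diag_b: "{b, x} \<in> diagonals Z" if "x \<in> Z" "?t v < ?t x" "?t x < ?t u" for x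
      by (rule diagonal_between_base[OF Z(2) Z(2) su_in[OF Z(2)] that(1) uZ]) (use that tv tb sub in auto)
    have b_c0: "{b, c0} \<in> D" if "c1 \<noteq> b" "?t c1 < ?t v"
    proof -
      have "0 < ?t c1" using that pos cZ by blast
      then have "v \<noteq> su b" using sub(2)[OF cZ(2)] that by auto
      then have "{b, v} \<in> D" using vD by blast
      moreover have "cross {b, v} {c1, c0}" using h that \<open>0 < ?t c1\<close> tb by (intro crossI[OF Z(2) cZ(2) vZ cZ(1)]) auto
      moreover have "cross {b, v} {c0, c1}" using calculation by (simp add: insert_commute)
      ultimately show ?thesis using pt'[of b v c0 c1] c diag_b[of c0] h cZ by blast
    qed
    show False
    proof (cases "?t c0 \<le> ?t a")
      case True
      then show False
        using noSb[of c0] c h umax[OF c] b_c0 by (cases "c1 = b") (auto simp: insert_commute)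
    next
      case False
      then have "u \<noteq> su a" using sua(2)[OF cZ(1)] h by auto
      then obtain x where x: "{x, u} \<in> D" "?t v < ?t x" "?t x \<le> ?t a" using uD by blast
      have xZ: "x \<in> Z" using x DZ by blast
      show False
      proof (cases "?t u < ?t c1")
        case True
        have "cross {x, u} {c0, c1}" using x h True False by (intro crossI[OF xZ cZ(1) uZ cZ(2)]) auto
        then have "cross {x, u} {c1, c0}" by (simp add: insert_commute)
        moreover have "{x, c1} \<in> diagonals Z"
          by (rule diagonal_between_base[OF Z(2) xZ uZ cZ(2) Z(2)]) (use x tu tv True tb in auto)
        ultimately have "{x, c1} \<in> D" using pt'[of x u c1 c0] x c by (simp add: insert_commute)
        then show False using umax[of x c1] x True by auto
      next
        case F2: False
        then have "{b, c0} \<in> D" using b_c0 h c by (cases "c1 = b") (auto simp: insert_commute)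
        moreover have "cross {x, u} {c0, b}" using x h False tb tv by (intro crossI[OF xZ cZ(1) uZ Z(2)]) auto
        then have "cross {x, u} {b, c0}" by (simp add: insert_commute)
        moreover have "{x, b} \<in> diagonals Z" using diag_b[of x] xZ x tu by (simp add: insert_commute)
        ultimately have "{x, b} \<in> D" using pt'[of x u b c0] x by blast
        then show False using noSb[of x] x by (simp add: insert_commute)
      qed
    qed
  qed
  have "\<not> cross U {v, u}" if U: "U \<in> D" for U
  proof
    assume cr: "cross U {v, u}"
    obtain x y where xy: "U = {x, y}" "x \<in> Z" "y \<in> Z" using U D diagonalE by blast
    have "cross {v, u} {x, y}" using cr xy vZ uZ in_circle by (auto intro: cross_commute)
    then have "(?t v < ?t x \<and> ?t x < ?t u \<and> (?t y < ?t v \<or> ?t u < ?t y)) \<or>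
        (?t v < ?t y \<and> ?t y < ?t u \<and> (?t x < ?t v \<or> ?t u < ?t x))"
      using tv tu in_circle[OF vZ] in_circle[OF uZ] in_circle[OF xy(2)] in_circle[OF xy(3)]
      by (auto simp: cross_iff cyc_between_base[OF bC])
    then show False using ncr[of x y] ncr[of y x] U xy by (auto simp: insert_commute)
  qed
  moreover have "cross {v, u} {a, b}"
    using tv tu tb by (intro crossI[OF vZ Z(1) uZ Z(2)]) auto
  then have "cross {a, b} {v, u}"
    using cross_commute[of v a u b] in_circle vZ uZ Z by blast
  ultimately show ?thesis using G by blast
qed

lemma ptolemy_imp_perp_closed:
  assumes "D \<subseteq> diagonals Z" "finitely_dominated D" "ptolemy Z D"
  shows "perp_closed D"
  unfolding perp_closed_iff[OF assms(1)]
proof (intro ballI impI)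
  fix S assume S: "S \<in> diagonals Z" "\<forall>Q\<in>diagonals Z. (\<forall>U\<in>D. \<not> cross U Q) \<longrightarrow> \<not> cross S Q"
  obtain a b where "S = {a, b}" using diagonalE[OF S(1)] by metis
  then show "S \<in> D" using noncrossed_crossing_diagonal[OF assms, of a b] S by blast
qed

end

section \<open>From finite domination to PC1 and PC2\<close>

lemma converges_near:
  assumes "\<And>i. z i \<in> circle" "p \<in> circle" "z \<longlonglongrightarrow> p" "0 < \<delta>"
  shows "\<forall>\<^sub>F i in sequentially. ccw_angle p (z i) < \<delta> \<or> 2 * pi - \<delta> < ccw_angle p (z i)"
proof -
  obtain \<epsilon> where "0 < \<epsilon>" and near:
    "\<And>z. z \<in> circle \<Longrightarrow> dist z p < \<epsilon> \<Longrightarrow> ccw_angle p z < \<delta> \<or> 2 * pi - \<delta> < ccw_angle p z"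
    using ccw_angle_near[OF assms(2,4)] by metis
  have "\<forall>\<^sub>F i in sequentially. dist (z i) p < \<epsilon>"
    using assms(3) \<open>0 < \<epsilon>\<close> by (simp add: tendsto_iff)
  then show ?thesis by eventually_elim (use near assms(1) in blast)
qed

lemma converges_from_below_or_above:
  assumes "\<And>i. z i \<in> circle" "p \<in> circle" "z \<longlonglongrightarrow> p"
  shows "(\<And>i. ccw_angle p (z i) < pi) \<Longrightarrow> converges_from_above z p"
    "(\<And>i. \<not> ccw_angle p (z i) < pi) \<Longrightarrow> converges_from_below z p"
proof -
  assume s: "\<And>i. ccw_angle p (z i) < pi"
  show "converges_from_above z p"
    unfolding converges_from_above_iff[OF assms(1,2)]
  proof (intro allI impI)
    fix \<delta> :: real assume "0 < \<delta>"
    then have "0 < min \<delta> pi" by simp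
    from converges_near[OF assms this] show "\<forall>\<^sub>F i in sequentially. ccw_angle p (z i) < \<delta>"
    proof eventually_elim
      case (elim i) then show ?case using s[of i] by (auto simp: min_def split: if_splits)
    qed
  qed
next
  assume s: "\<And>i. \<not> ccw_angle p (z i) < pi"
  show "converges_from_below z p"
    unfolding converges_from_below_iff[OF assms(1,2)]
  proof (intro allI impI)
    fix \<delta> :: real assume "0 < \<delta>"
    then have "0 < min \<delta> pi" by simp
    from converges_near[OF assms this]
    show "\<forall>\<^sub>F i in sequentially. z i = p \<or> 2 * pi - \<delta> < ccw_angle p (z i)"
    proof eventually_elim
      case (elim i) then show ?case using s[of i] by (auto simp: min_def split: if_splits)
    qed
  qed
qed

lemma eventually_sequentially_ex: "\<forall>\<^sub>F i in sequentially. P i \<Longrightarrow> \<exists>i. P i"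
  by (auto simp: eventually_sequentially)

context admissible_set
begin

lemma eventually_eq_limit:
  assumes "\<And>i. z i \<in> Z" "p \<in> Z" "z \<longlonglongrightarrow> p"
  shows "\<forall>\<^sub>F i in sequentially. z i = p"
proof -
  obtain \<delta> where "0 < \<delta>" and d:
    "\<And>x. x \<in> Z \<Longrightarrow> x \<noteq> p \<Longrightarrow> \<delta> \<le> ccw_angle p x \<and> ccw_angle p x \<le> 2 * pi - \<delta>"
    using isolated[OF assms(2)] by metis
  have "\<forall>\<^sub>F i in sequentially. ccw_angle p (z i) < \<delta> \<or> 2 * pi - \<delta> < ccw_angle p (z i)"
    using converges_near[of z p \<delta>] in_circle assms \<open>0 < \<delta>\<close> by blast
  then show ?thesis by eventually_elim (use d assms(1) in force)
qed

text \<open>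
  If \<open>s\<close> lies beyond \<open>t\<close>, as seen from \<open>p\<close>, then \<open>[x i, t]\<close> shrinks to \<open>[p, t]\<close> and finally excludes \<open>s\<close>.
\<close>

lemma not_between_below:
  assumes x: "\<And>i. x i \<in> Z" "converges_from_below x p" "p \<in> closure Z"
    and t: "t \<in> Z" "p \<in> Z \<Longrightarrow> t = p" and s: "s \<in> Z" "\<not> ccw_angle p s \<le> ccw_angle p t"
  shows "\<forall>\<^sub>F i in sequentially. \<not> cyc_le [x i, s, t]"
proof -
  note C = closure_in_circle[OF x(3)] in_circle[OF x(1)] in_circle[OF t(1)] in_circle[OF s(1)]
  have "\<forall>\<^sub>F i in sequentially. x i = p \<or> 2 * pi - (2 * pi - ccw_angle p s) < ccw_angle p (x i)"
    using x(2) C ccw_angle_bounds(2)[of p s]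
    unfolding converges_from_below_iff[OF C(2,1)] by (metis diff_gt_0_iff_gt)
  then show ?thesis
  proof eventually_elim
    case (elim i)
    then show ?case
      using s(2) ccw_angle_rebase[OF C(1,2,4), of i] ccw_angle_rebase[OF C(1,2,3), of i] C
        ccw_angle_bounds(1)[of p t]
      by (auto split: if_splits simp del: ccw_angle_bounds)
  qed
qed

lemma not_between_above:
  assumes x: "\<And>i. x i \<in> Z" "converges_from_above x p" "p \<in> closure Z"
    and t: "t \<in> Z" "p \<in> Z \<Longrightarrow> t = p" and s: "s \<in> Z" "\<not> ccw_angle p s \<le> ccw_angle p t"
  shows "\<forall>\<^sub>F i in sequentially. \<not> cyc_le [x i, s, t]"
proof -
  note C = closure_in_circle[OF x(3)] in_circle[OF x(1)] in_circle[OF t(1)] in_circle[OF s(1)]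
  show ?thesis
  proof (cases "p \<in> Z")
    case True
    have "x \<longlonglongrightarrow> p" using x(2) by (simp add: converges_from_above_def)
    from eventually_eq_limit[OF x(1) True this] show ?thesis
      by eventually_elim (use s t(2)[OF True] C in simp)
  next
    case False
    then have "t \<noteq> p" using t by auto
    then have "0 < ccw_angle p t" using ccw_angle_pos C by blast
    then have "\<forall>\<^sub>F i in sequentially. ccw_angle p (x i) < ccw_angle p t"
      using x(2) unfolding converges_from_above_iff[OF C(2,1)] by blast
    then show ?thesis
    proof eventually_elim
      case (elim i)
      then show ?case
        using s(2) ccw_angle_rebase[OF C(1,2,4), of i] ccw_angle_rebase[OF C(1,2,3), of i] C
        by (auto split: if_splits)
    qed
  qed
qed

text \<open>
  For a limit point \<open>p\<close> outside \<open>Z\<close>, two points of \<open>Z\<close> close to \<open>p\<close> are chosen, so that the successor of the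
  nearer one is also close to \<open>p\<close>.
\<close>

lemma point_above:
  assumes "p \<in> closure Z" "q \<in> closure Z" "p \<noteq> q" "p \<in> Z \<Longrightarrow> q \<in> Z \<Longrightarrow> q \<noteq> su p" "0 < \<delta>"
  shows "\<exists>t\<in>Z. ccw_angle p t < \<delta> \<and> (p \<in> Z \<longrightarrow> t = p) \<and> cyc_between p (su t) q"
proof -
  note C = closure_in_circle[OF assms(1)] closure_in_circle[OF assms(2)]
  have Q: "0 < ccw_angle p q" using ccw_angle_pos C assms(3) by blast
  show ?thesis
  proof (cases "p \<in> Z")
    case True
    have "cyc_between p (su p) q"
    proof (cases "q \<in> Z")
      case q: True
      then obtain z where "z \<in> Z" "cyc_between p z q" using successor_iff_none_between[OF True q assms(3)] assms(4) True by blast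
      then show ?thesis
        using successor_props[OF True] C ccw_angle_pos in_circle unfolding cyc_between_def
        by (metis ccw_angle_self less_irrefl le_less_trans)
    next
      case False
      then obtain z where z: "z \<in> Z" "2 * pi - ccw_angle p q < ccw_angle q z" 
        using limit_from_both_sides(2)[OF assms(2) _ Q] by (metis add_diff_cancel_left' diff_diff_eq2)
      have "q \<noteq> p" using assms(3) by simp
      then have ne: "z \<noteq> p"
        using z ccw_angle_rebase[OF C(1,2,1)] C Q by auto
      then have "ccw_angle p z < ccw_angle p q"
        using z ccw_angle_rebase[OF C(1,2) in_circle[OF z(1)]] ccw_angle_bounds(2)[of p z]
        by (auto split: if_splits simp del: ccw_angle_bounds)
      then show ?thesis
        using successor_props[OF True] C ccw_angle_pos in_circle z ne unfolding cyc_between_def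
        by (metis le_less_trans)
    qed
    then show ?thesis using True C assms(5) by (intro bexI[of _ p]) auto
  next
    case False
    then obtain t' where t': "t' \<in> Z" "0 < ccw_angle p t'" "ccw_angle p t' < min \<delta> (ccw_angle p q)"
      using limit_from_both_sides(1)[OF assms(1), of "min \<delta> (ccw_angle p q)"] assms(5) Q by auto
    then obtain t where t: "t \<in> Z" "0 < ccw_angle p t" "ccw_angle p t < ccw_angle p t'"
      using limit_from_both_sides(1)[OF assms(1) False, of "ccw_angle p t'"] by auto
    note tC = in_circle[OF t(1)] in_circle[OF t'(1)] in_circle[OF su_in[OF t(1)]]
    have "t' \<noteq> t" using t by auto
    then have "ccw_angle t (su t) \<le> ccw_angle t t'" using successor_props(3)[OF t(1) t'(1)] by blast
    moreover have "su t \<noteq> p" using su_in t False by metis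
    then have "0 < ccw_angle p (su t)" using ccw_angle_pos C tC by blast
    ultimately have "ccw_angle p (su t) \<le> ccw_angle p t'"
      using ccw_angle_rebase[OF C(1) tC(1,3)] ccw_angle_rebase[OF C(1) tC(1,2)] t t'
      by (auto split: if_splits)
    then have "cyc_between p (su t) q" using \<open>0 < ccw_angle p (su t)\<close> t' by (auto simp: cyc_between_def)
    then show ?thesis using t t' False by (intro bexI[of _ t]) auto
  qed
qed

text \<open>
  Apply the domination to a diagonal \<open>{t0, t1}\<close> slightly above \<open>(p, q)\<close>.  Its finite dominating set
  dominates all late members of the sequence.  A dominating pair outside \<open>[p, t0] \<times> [q, t1]\<close> can only
  dominate finitely many of them, so one of the finitely many pairs lies in this small box.
\<close>

lemma finitely_dominated_limit:
  assumes D: "D \<subseteq> diagonals Z" and fd: "finitely_dominated D"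
    and pq: "p \<in> closure Z" "q \<in> closure Z" "p \<noteq> q"
    and x: "\<And>i. {x0 i, x1 i} \<in> D" "converges_from_below x0 p"
      "converges_from_below x1 q \<or> converges_from_above x1 q"
    and "0 < \<delta>"
  shows "\<exists>s0 s1. {s0, s1} \<in> D \<and> ccw_angle p s0 < \<delta> \<and> ccw_angle q s1 < \<delta>"
proof -
  note C = closure_in_circle[OF pq(1)] closure_in_circle[OF pq(2)]
  have xZ: "x0 i \<in> Z" "x1 i \<in> Z" for i using x(1) D diagonal_pair_iff by blast+
  note xC = in_circle[OF xZ(1)] in_circle[OF xZ(2)]
  have x0: "x0 \<longlonglongrightarrow> p" and x1: "x1 \<longlonglongrightarrow> q"
    using x by (auto simp: converges_from_below_def converges_from_above_def)
  have dia: "{p, q} \<in> diagonals Z" if "p \<in> Z" "q \<in> Z"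
  proof -
    have "\<forall>\<^sub>F i in sequentially. x0 i = p \<and> x1 i = q"
      using eventually_eq_limit[OF xZ(1) that(1) x0] eventually_eq_limit[OF xZ(2) that(2) x1]
      by eventually_elim auto
    from eventually_sequentially_ex[OF this] obtain i where "x0 i = p \<and> x1 i = q" by blast
    then show ?thesis using x(1)[of i] D by auto
  qed
  obtain t0 where t0: "t0 \<in> Z" "ccw_angle p t0 < \<delta>" "p \<in> Z \<longrightarrow> t0 = p" "cyc_between p (su t0) q"
    using point_above[OF pq _ \<open>0 < \<delta>\<close>] dia[unfolded diagonal_pair_iff] by metis
  obtain t1 where t1: "t1 \<in> Z" "ccw_angle q t1 < \<delta>" "q \<in> Z \<longrightarrow> t1 = q" "cyc_between q (su t1) p"
    using point_above[OF pq(2,1) pq(3)[symmetric] _ \<open>0 < \<delta>\<close>] dia[unfolded diagonal_pair_iff] by metis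
  define \<tau>0 \<tau>1 where "\<tau>0 = su t0" and "\<tau>1 = su t1"
  have tZ: "\<tau>0 \<in> Z" "\<tau>1 \<in> Z" using t0 t1 by (auto simp: \<tau>0_def \<tau>1_def)
  note tC = in_circle[OF tZ(1)] in_circle[OF tZ(2)]
  have T: "0 < ccw_angle p \<tau>0" "ccw_angle p \<tau>0 < ccw_angle p q" "ccw_angle p q < ccw_angle p \<tau>1"
    using t0(4) t1(4) cyc_between_base[OF C(1,1) tC(1) C(2)] cyc_between_base[OF C tC(2) C(1)] C
      ccw_angle_bounds(1)[of p q] ccw_angle_bounds(1)[of p \<tau>1] unfolding \<tau>0_def[symmetric] \<tau>1_def[symmetric] cyc_between_def
    by (auto simp del: ccw_angle_bounds)
  have ev: "\<forall>\<^sub>F i in sequentially. cyc_less [x0 i, \<tau>0, x1 i, \<tau>1]"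
  proof -
    have "\<forall>\<^sub>F i in sequentially. x0 i = p \<or> 2 * pi - (2 * pi - ccw_angle p \<tau>1) < ccw_angle p (x0 i)"
      using x(2) ccw_angle_bounds(2)[of p \<tau>1] unfolding converges_from_below_iff[OF xC(1) C(1)]
      by (metis diff_gt_0_iff_gt)
    moreover define d where "d = min (ccw_angle p q - ccw_angle p \<tau>0) (ccw_angle p \<tau>1 - ccw_angle p q)"
    have "0 < d" using T by (simp add: d_def)
    from converges_near[OF xC(2) C(2) x1 this]
    have "\<forall>\<^sub>F i in sequentially. ccw_angle q (x1 i) < d \<or> 2 * pi - d < ccw_angle q (x1 i)" .
    ultimately show ?thesis
    proof eventually_elim
      case (elim i)
      have "ccw_angle p \<tau>0 < ccw_angle p (x1 i) \<and> ccw_angle p (x1 i) < ccw_angle p \<tau>1"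
        using elim(2) ccw_angle_rebase[OF C(1,2) xC(2), of i] T ccw_angle_bounds[of p "x1 i"] ccw_angle_bounds(2)[of p \<tau>1]
        by (auto simp: d_def min_def split: if_splits simp del: ccw_angle_bounds)
      then show ?case
        using elim(1) T C
        unfolding cyc_less_4[OF xC(1) tC(1) xC(2) tC(2)] cyc_between_base[OF C(1) xC(1) tC(1) xC(2)] cyc_between_base[OF C(1) xC(2) tC(2) xC(1)]
        by auto
    qed
  qed
  have tdia: "{t0, t1} \<in> diagonals Z"
  proof -
    obtain i where i: "cyc_less [x0 i, \<tau>0, x1 i, \<tau>1]" using eventually_sequentially_ex[OF ev] by blast
    have b: "cyc_between (x0 i) \<tau>0 (x1 i)" "cyc_between (x1 i) \<tau>1 (x0 i)" using i cyc_less_4 xC tC by blast+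
    have "cyc_between \<tau>0 (x1 i) \<tau>1" "cyc_between \<tau>1 (x0 i) \<tau>0"
      using b cyc_between_base[OF C(1)] xC tC by (simp_all) linarith+
    then have "{\<tau>0, \<tau>1} \<in> diagonals Z" using tZ xZ diagonal_iff_between by blast
    then show ?thesis using t0(1) t1(1) unfolding \<tau>0_def \<tau>1_def diagonal_pair_iff by (metis su_in)
  qed
  obtain F where F: "finite F" "F \<subseteq> D" and dom: "\<And>x0 x1. {x0, x1} \<in> D \<Longrightarrow> hom_position Z x0 x1 t0 t1 \<Longrightarrow>
        \<exists>s0 s1. {s0, s1} \<in> F \<and> cyc_le [x0, s0, t0] \<and> cyc_le [x1, s1, t1]"
    using fd[unfolded finitely_dominated_def, rule_format, OF tdia] by metis
  \<comment> \<open>the pairs from \<open>F\<close> outside the small box\<close>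
  define B where "B = {(s0, s1). {s0, s1} \<in> F \<and> \<not> (ccw_angle p s0 \<le> ccw_angle p t0 \<and> ccw_angle q s1 \<le> ccw_angle q t1)}"
  have "finite P" if "P \<in> diagonals Z" for P
    using diagonalE[OF that] by (metis finite.emptyI finite_insert)
  then have "finite (\<Union>F)" using F D by blast
  then have "finite (\<Union>F \<times> \<Union>F)" by simp
  moreover have "B \<subseteq> \<Union>F \<times> \<Union>F" unfolding B_def by blast
  ultimately have "finite B" using finite_subset by blast
  have "\<forall>\<^sub>F i in sequentially. \<not> (cyc_le [x0 i, fst s, t0] \<and> cyc_le [x1 i, snd s, t1])" if "s \<in> B" for s
  proof -
    obtain s0 s1 where s: "s = (s0, s1)" by fastforce
    then have sZ: "s0 \<in> Z" "s1 \<in> Z" using that F D diagonal_pair_iff unfolding B_def by blast+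
    from that consider "\<not> ccw_angle p s0 \<le> ccw_angle p t0" | "\<not> ccw_angle q s1 \<le> ccw_angle q t1"
      unfolding B_def s by blast
    then show ?thesis
    proof cases
      case 1
      have "\<forall>\<^sub>F i in sequentially. \<not> cyc_le [x0 i, s0, t0]"
        using not_between_below[where x = x0, OF xZ(1) x(2) pq(1) t0(1) _ sZ(1) 1] t0(3) by blast
      then show ?thesis by eventually_elim (simp add: s)
    next
      case 2
      have "\<forall>\<^sub>F i in sequentially. \<not> cyc_le [x1 i, s1, t1]"
        using not_between_below[where x = x1, OF xZ(2) _ pq(2) t1(1) _ sZ(2) 2] not_between_above[where x = x1, OF xZ(2) _ pq(2) t1(1) _ sZ(2) 2] t1(3) x(3)
        by blast
      then show ?thesis by eventually_elim (simp add: s)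
    qed
  qed
  then have "\<forall>\<^sub>F i in sequentially. \<forall>s\<in>B. \<not> (cyc_le [x0 i, fst s, t0] \<and> cyc_le [x1 i, snd s, t1])"
    using \<open>finite B\<close> by (intro eventually_ball_finite) auto
  with ev have "\<forall>\<^sub>F i in sequentially. cyc_less [x0 i, \<tau>0, x1 i, \<tau>1] \<and>
      (\<forall>s\<in>B. \<not> (cyc_le [x0 i, fst s, t0] \<and> cyc_le [x1 i, snd s, t1]))"
    by eventually_elim auto
  from eventually_sequentially_ex[OF this] obtain i where i: "cyc_less [x0 i, \<tau>0, x1 i, \<tau>1]"
    "\<forall>s\<in>B. \<not> (cyc_le [x0 i, fst s, t0] \<and> cyc_le [x1 i, snd s, t1])"
    by blast
  have "hom_position Z (x0 i) (x1 i) t0 t1"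
    using hom_position_iff[OF xZ t0(1) t1(1)] i(1) by (simp add: \<tau>0_def \<tau>1_def)
  then obtain s0 s1 where s: "{s0, s1} \<in> F" "cyc_le [x0 i, s0, t0]" "cyc_le [x1 i, s1, t1]"
    using dom x(1) by blast
  then have "(s0, s1) \<notin> B" using i(2) by force
  then have "ccw_angle p s0 \<le> ccw_angle p t0" "ccw_angle q s1 \<le> ccw_angle q t1"
    using s(1) unfolding B_def by blast+
  then show ?thesis using s(1) F t0(2) t1(2) by (intro exI[of _ s0] exI[of _ s1]) auto
qed

lemma finitely_dominated_imp_PC:
  assumes D: "D \<subseteq> diagonals Z" and fd: "finitely_dominated D"
  shows "PC1 Z D" "PC2 Z D"
proof -
  have main: "\<exists>x0' x1'. (\<forall>i. {x0' i, x1' i} \<in> D) \<and> converges_from_above x0' p \<and> converges_from_above x1' q"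
    if h: "p \<in> closure Z" "q \<in> closure Z" "p \<noteq> q" "\<forall>i. {x0 i, x1 i} \<in> D" "converges_from_below x0 p"
      "converges_from_below x1 q \<or> converges_from_above x1 q" for p q x0 x1
  proof -
    have "\<forall>n. \<exists>s0 s1. {s0, s1} \<in> D \<and> ccw_angle p s0 < inverse (real (Suc n)) \<and> ccw_angle q s1 < inverse (real (Suc n))"
      using finitely_dominated_limit[OF D fd h(1-3) _ h(5,6)] h(4) by simp
    then obtain y0 y1 where y: "\<And>n. {y0 n, y1 n} \<in> D" "\<And>n. ccw_angle p (y0 n) < inverse (real (Suc n))"
        "\<And>n. ccw_angle q (y1 n) < inverse (real (Suc n))" by metis
    have yZ: "y0 i \<in> Z" "y1 i \<in> Z" for i using y(1) D diagonal_pair_iff by blast+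
    have ev: "\<forall>\<^sub>F i in sequentially. inverse (real (Suc i)) < \<delta>" if "0 < \<delta>" for \<delta> :: real
      using order_tendstoD(2)[OF LIMSEQ_inverse_real_of_nat that] .
    have "converges_from_above y0 p"
      unfolding converges_from_above_iff[OF in_circle[OF yZ(1)] closure_in_circle[OF h(1)]]
    proof (intro allI impI)
      fix \<delta> :: real assume "0 < \<delta>"
      from ev[OF this] show "\<forall>\<^sub>F i in sequentially. ccw_angle p (y0 i) < \<delta>"
        by eventually_elim (use y(2) in \<open>meson less_trans\<close>)
    qed
    moreover have "converges_from_above y1 q"
      unfolding converges_from_above_iff[OF in_circle[OF yZ(2)] closure_in_circle[OF h(2)]]
    proof (intro allI impI)
      fix \<delta> :: real assume "0 < \<delta>"
      from ev[OF this] show "\<forall>\<^sub>F i in sequentially. ccw_angle q (y1 i) < \<delta>"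
        by eventually_elim (use y(3) in \<open>meson less_trans\<close>)
    qed
    ultimately show ?thesis using y(1) by blast
  qed
  show "PC1 Z D" "PC2 Z D"
    unfolding PC1_def PC2_def using main by blast+
qed

end

section \<open>From PC1 and PC2 to finite domination\<close>

context admissible_set
begin

text \<open>
  If \<open>p\<close> lay between \<open>a\<close> and its successor, then so would any point of \<open>Z\<close> close to \<open>p\<close>.
\<close>

lemma below_predecessor:
  assumes "a \<in> Z" "p \<in> circle" "p \<notin> Z" "z \<in> Z"
    and "ccw_angle p z < ccw_angle p a \<and> ccw_angle p z < ccw_angle p (su a) \<or>
         ccw_angle p z > ccw_angle p a \<and> ccw_angle p z > ccw_angle p (su a)"
  shows "ccw_angle p a < ccw_angle p (su a)"
proof (rule ccontr)
  assume n: "\<not> ?thesis"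
  note C = in_circle[OF assms(1)] in_circle[OF su_in[OF assms(1)]] in_circle[OF assms(4)]
  have ne: "su a \<noteq> a" using successor_props assms by blast
  then have "ccw_angle p (su a) < ccw_angle p a"
    using n ccw_angle_inj[OF assms(2) C(1,2)] by auto
  then have "cyc_between a z (su a)" using cyc_between_base[OF assms(2) C(1,3,2)] assms(5) by auto
  then show False using successor_iff_none_between[OF assms(1) su_in[OF assms(1)]] ne assms(4) by auto
qed

text \<open>
  Domination in one coordinate.  If \<open>p\<close> is not in \<open>Z\<close>, then \<open>y i\<close> is strictly above \<open>p\<close>, so it is also above all
  points of the arc \<open>(c, a]\<close> that are close enough to \<open>p\<close>, on either side.  If \<open>p\<close> is in \<open>Z\<close>, it is isolated.
\<close>

lemma eventually_dominates_near:
  assumes p: "p \<in> closure Z" and c: "c \<in> Z" and a: "a \<in> Z"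
    and x: "\<And>i. x i \<in> Z" "\<And>i. cyc_between c (x i) (su a)" "x \<longlonglongrightarrow> p"
    and y: "\<And>i. y i \<in> Z" "converges_from_above y p"
  shows "\<forall>\<^sub>F i in sequentially. \<exists>\<epsilon>>0. \<forall>z\<in>Z. cyc_between c z (su a) \<longrightarrow> dist z p < \<epsilon> \<longrightarrow> cyc_le [z, y i, a]"
proof -
  note pC = closure_in_circle[OF p]
  show ?thesis
  proof (cases "p \<in> Z")
    case True
    have "y \<longlonglongrightarrow> p" using y(2) by (simp add: converges_from_above_def)
    obtain \<epsilon> where "0 < \<epsilon>" and e: "\<forall>z\<in>Z. dist p z < \<epsilon> \<longrightarrow> z = p"
      using adm True unfolding admissible_def discrete_def isolated_in_dist_Ex_iff by blast
    have "\<forall>\<^sub>F i in sequentially. y i = p" by (rule eventually_eq_limit) fact+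
    then show ?thesis
    proof eventually_elim
      case (elim i)
      have "cyc_le [z, y i, a]" if "z \<in> Z" "dist z p < \<epsilon>" for z
        using e that elim in_circle[OF True] by (auto simp: dist_commute)
      then show ?case using \<open>0 < \<epsilon>\<close> by blast
    qed
  next
    case False
    let ?t = "ccw_angle p"
    have saZ: "su a \<in> Z" using a by simp
    note C = in_circle[OF c] in_circle[OF a] in_circle[OF saZ] in_circle[OF x(1)]
    have pos: "0 < ?t z" if "z \<in> Z" for z using ccw_angle_pos[OF pC in_circle[OF that]] False that by auto
    define \<delta> where "\<delta> = min (min (min (?t c) (?t a)) (?t (su a))) (min (2 * pi - ?t c) (min (2 * pi - ?t a) (2 * pi - ?t (su a))))"
    have "0 < \<delta>" using pos c a saZ by (simp add: \<delta>_def)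
    have dl: "\<delta> \<le> ?t c" "\<delta> \<le> ?t a" "\<delta> \<le> ?t (su a)" "?t c \<le> 2 * pi - \<delta>" "?t a \<le> 2 * pi - \<delta>" "?t (su a) \<le> 2 * pi - \<delta>"
      by (auto simp: \<delta>_def)
    from eventually_sequentially_ex[OF converges_near[OF C(4) pC x(3) \<open>0 < \<delta>\<close>]]
    obtain n where n: "?t (x n) < \<delta> \<or> 2 * pi - \<delta> < ?t (x n)" by blast
    have ac: "?t (su a) < ?t c"
      using x(2)[of n] n dl unfolding cyc_between_base[OF pC C(1) C(4) C(3)] by linarith
    have aa: "?t a < ?t (su a)"
      using n dl by (intro below_predecessor[OF a pC False x(1)[of n]]) linarith
    have "\<forall>\<^sub>F i in sequentially. ?t (y i) < ?t a"
      using y(2) pos[OF a] unfolding converges_from_above_iff[OF in_circle[OF y(1)] pC] by blast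
    then show ?thesis
    proof eventually_elim
      case (elim i)
      have ypos: "0 < ?t (y i)" using pos y(1) by blast
      define d where "d = min (?t (y i)) (2 * pi - ?t c)"
      have "0 < d" using ypos by (simp add: d_def)
      then obtain \<epsilon> where "0 < \<epsilon>" and near:
        "\<And>z. z \<in> circle \<Longrightarrow> dist z p < \<epsilon> \<Longrightarrow> ?t z < d \<or> 2 * pi - d < ?t z"
        using ccw_angle_near[OF pC] by metis
      have "cyc_le [z, y i, a]" if z: "z \<in> Z" "dist z p < \<epsilon>" for z
      proof -
        note zC = in_circle[OF z(1)]
        have "?t z < ?t (y i) \<or> ?t c < ?t z" using near[OF zC z(2)] by (auto simp: d_def)
        then show ?thesis
          using ccw_angle_rebase[OF pC zC in_circle[OF y(1)], of i] ccw_angle_rebase[OF pC zC C(2)]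
            zC elim ac aa by auto
      qed
      then show ?case using \<open>0 < \<epsilon>\<close> by blast
    qed
  qed
qed

text \<open>
  Passing to a subsequence puts the sequence into one of the four quadrants at \<open>(p, q)\<close>.  Three of them are
  covered by PC1 and by PC2, with the roles of \<open>p\<close> and \<open>q\<close> exchanged if necessary; in the fourth one there
  is nothing to do.
\<close>

lemma PC_above:
  assumes D: "D \<subseteq> diagonals Z" and pc: "PC1 Z D" "PC2 Z D"
    and pq: "p \<in> closure Z" "q \<in> closure Z" "p \<noteq> q"
    and x: "\<And>i. {x0 i, x1 i} \<in> D" "x0 \<longlonglongrightarrow> p" "x1 \<longlonglongrightarrow> q"
  shows "\<exists>y0 y1. (\<forall>i. {y0 i, y1 i} \<in> D) \<and> converges_from_above y0 p \<and> converges_from_above y1 q"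
proof -
  have xZ: "x0 i \<in> Z" "x1 i \<in> Z" for i using x(1) D diagonal_pair_iff by blast+
  note xC = in_circle[OF xZ(1)] in_circle[OF xZ(2)]
  note C = closure_in_circle[OF pq(1)] closure_in_circle[OF pq(2)]
  \<comment> \<open>the quadrant in which the \<open>i\<close>-th element lies; one quadrant occurs infinitely often\<close>
  define f where "f i = (ccw_angle p (x0 i) < pi, ccw_angle q (x1 i) < pi)" for i
  have "\<exists>b. infinite {i. f i = b}"
  proof (rule ccontr)
    assume "\<not> ?thesis"
    then have "finite (\<Union>b. {i. f i = b})" by (intro finite_UN_I) auto
    moreover have "(\<Union>b. {i. f i = b}) = (UNIV :: nat set)" by auto
    ultimately show False by simp
  qed
  then obtain b0 b1 where "infinite {i. f i = (b0, b1)}" by (metis surj_pair)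
  then obtain r :: "nat \<Rightarrow> nat" where r: "strict_mono r" "\<And>n. f (r n) = (b0, b1)"
    using infinite_enumerate[of "{i. f i = (b0, b1)}"] by auto
  define z0 z1 where "z0 = x0 \<circ> r" and "z1 = x1 \<circ> r"
  have lim: "z0 \<longlonglongrightarrow> p" "z1 \<longlonglongrightarrow> q"
    using x r(1) by (auto simp: z0_def z1_def intro: LIMSEQ_subseq_LIMSEQ)
  have zD: "{z0 i, z1 i} \<in> D" for i using x(1) by (simp add: z0_def z1_def)
  have zC: "z0 i \<in> circle" "z1 i \<in> circle" for i using xC by (auto simp: z0_def z1_def)
  have side: "(ccw_angle p (z0 i) < pi) = b0" "(ccw_angle q (z1 i) < pi) = b1" for i
    using r(2)[of i] by (auto simp: z0_def z1_def f_def)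
  note zp = converges_from_below_or_above[OF zC(1) C(1) lim(1), unfolded side]
  note zq = converges_from_below_or_above[OF zC(2) C(2) lim(2), unfolded side]
  show ?thesis
  proof (cases b0)
    case b0: True
    show ?thesis
    proof (cases b1)
      case True
      then show ?thesis using zD zp(1) zq(1) b0 by blast
    next
      case False
      have "{z1 i, z0 i} \<in> D" for i using zD by (simp add: insert_commute)
      then have "\<exists>x0 x1. (\<forall>i. {x0 i, x1 i} \<in> D) \<and> converges_from_below x0 q \<and> converges_from_above x1 p"
        using zp(1) zq(2) b0 False by blast
      from pc(2)[unfolded PC2_def, rule_format, OF pq(2,1) pq(3)[symmetric] this]
      obtain y1 y0 where "\<forall>i. {y1 i, y0 i} \<in> D" "converges_from_above y1 q" "converges_from_above y0 p" by blast
      moreover from this have "\<forall>i. {y0 i, y1 i} \<in> D" by (simp add: insert_commute)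
      ultimately show ?thesis by blast
    qed
  next
    case b0: False
    show ?thesis
    proof (cases b1)
      case True
      then have "\<exists>x0 x1. (\<forall>i. {x0 i, x1 i} \<in> D) \<and> converges_from_below x0 p \<and> converges_from_above x1 q"
        using zD zp(2) zq(1) b0 by blast
      then show ?thesis by (rule pc(2)[unfolded PC2_def, rule_format, OF pq])
    next
      case False
      then have "\<exists>x0 x1. (\<forall>i. {x0 i, x1 i} \<in> D) \<and> converges_from_below x0 p \<and> converges_from_below x1 q"
        using zD zp(2) zq(2) b0 by blast
      then show ?thesis by (rule pc(1)[unfolded PC1_def, rule_format, OF pq])
    qed
  qed
qed

text \<open>
  Either no element of the rectangle is near \<open>(p, q)\<close>, or these elements accumulate at \<open>(p, q)\<close>, and then a
  single element close to \<open>(p, q)\<close> in the upper right quadrant dominates all of those nearby.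
\<close>

lemma PC_imp_locally_dominated:
  assumes D: "D \<subseteq> diagonals Z" and pc: "PC1 Z D" "PC2 Z D"
    and ab: "a \<in> Z" "b \<in> Z" and pq: "p \<in> closure Z" "q \<in> closure Z"
  shows "\<exists>\<epsilon>>0. \<exists>F. finite F \<and> F \<subseteq> D \<and> (\<forall>x0 x1. {x0, x1} \<in> D \<longrightarrow> hom_position Z x0 x1 a b \<longrightarrow>
     dist x0 p < \<epsilon> \<longrightarrow> dist x1 q < \<epsilon> \<longrightarrow>
     (\<exists>s0 s1. {s0, s1} \<in> F \<and> cyc_le [x0, s0, a] \<and> cyc_le [x1, s1, b]))"
proof (rule ccontr)
  assume n: "\<not> ?thesis"
  note C = closure_in_circle[OF pq(1)] closure_in_circle[OF pq(2)]
  \<comment> \<open>as not even the empty set dominates locally, elements of the rectangle accumulate at \<open>(p, q)\<close>\<close>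
  have "\<forall>n. \<exists>x0 x1. {x0, x1} \<in> D \<and> hom_position Z x0 x1 a b \<and>
     dist x0 p < inverse (real (Suc n)) \<and> dist x1 q < inverse (real (Suc n))"
  proof
    fix n :: nat
    have "0 < inverse (real (Suc n))" by simp
    then show "\<exists>x0 x1. {x0, x1} \<in> D \<and> hom_position Z x0 x1 a b \<and>
       dist x0 p < inverse (real (Suc n)) \<and> dist x1 q < inverse (real (Suc n))"
      using n by (meson empty_subsetI finite.emptyI)
  qed
  then obtain x0 x1 where x: "\<And>n. {x0 n, x1 n} \<in> D" "\<And>n. hom_position Z (x0 n) (x1 n) a b"
     and xd: "\<And>n. dist (x0 n) p < inverse (real (Suc n))" "\<And>n. dist (x1 n) q < inverse (real (Suc n))"
    by metis
  have lim: "x0 \<longlonglongrightarrow> p" "x1 \<longlonglongrightarrow> q"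
  proof -
    have "(\<lambda>n. dist (x0 n) p) \<longlonglongrightarrow> 0" "(\<lambda>n. dist (x1 n) q) \<longlonglongrightarrow> 0"
      by (rule tendsto_sandwich[OF _ _ tendsto_const LIMSEQ_inverse_real_of_nat];
          use xd in \<open>auto intro!: always_eventually less_imp_le\<close>)+
    then show "x0 \<longlonglongrightarrow> p" "x1 \<longlonglongrightarrow> q" by (auto simp: tendsto_dist_iff[of _ p] tendsto_dist_iff[of _ q])
  qed
  have xZ: "x0 i \<in> Z" "x1 i \<in> Z" for i using x(1) D diagonal_pair_iff by blast+
  note xC = in_circle[OF xZ(1)] in_circle[OF xZ(2)]
  note sC = in_circle[OF su_in[OF ab(1)]] in_circle[OF su_in[OF ab(2)]]
  have pos: "cyc_between x (su a) y \<and> cyc_between y (su b) x" "cyc_between (su b) x (su a)" "cyc_between (su a) y (su b)"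
    if "x \<in> Z" "y \<in> Z" "hom_position Z x y a b" for x y
  proof -
    note xyC = in_circle[OF that(1)] in_circle[OF that(2)]
    show 1: "cyc_between x (su a) y \<and> cyc_between y (su b) x"
      using that hom_position_iff[OF that(1,2) ab] cyc_less_4[OF xyC(1) sC(1) xyC(2) sC(2)] by blast
    show "cyc_between (su b) x (su a)" "cyc_between (su a) y (su b)"
      using 1 cyc_between_base[OF C(1)] xyC sC by (simp_all) linarith+
  qed
  \<comment> \<open>two points close to \<open>p\<close> cannot be separated, on both sides, by \<open>su a\<close> and \<open>su b\<close>\<close>
  have "p \<noteq> q"
  proof
    assume "p = q"
    show False
    proof (cases "p \<in> Z")
      case True
      have "\<forall>\<^sub>F i in sequentially. x0 i = p \<and> x1 i = p"
        using eventually_eq_limit[OF xZ(1) True lim(1)] eventually_eq_limit[OF xZ(2) True] lim(2) \<open>p = q\<close>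
        by (auto intro: eventually_conj)
      from eventually_sequentially_ex[OF this] obtain i where "x0 i = p" "x1 i = p" by blast
      then have "{p, p} \<in> diagonals Z" using x(1)[of i] D by auto
      then show False using diagonal_pair_iff by blast
    next
      case False
      let ?t = "ccw_angle p"
      have tpos: "0 < ?t z" if "z \<in> Z" for z using ccw_angle_pos[OF C(1) in_circle[OF that]] False that by auto
      define \<delta> where "\<delta> = min (min (?t (su a)) (?t (su b))) (min (2 * pi - ?t (su a)) (2 * pi - ?t (su b)))"
      have "0 < \<delta>" using tpos ab by (simp add: \<delta>_def)
      have dl: "\<delta> \<le> ?t (su a)" "\<delta> \<le> ?t (su b)" "?t (su a) \<le> 2 * pi - \<delta>" "?t (su b) \<le> 2 * pi - \<delta>"
        by (auto simp: \<delta>_def)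
      have "\<forall>\<^sub>F i in sequentially. (?t (x0 i) < \<delta> \<or> 2 * pi - \<delta> < ?t (x0 i)) \<and> (?t (x1 i) < \<delta> \<or> 2 * pi - \<delta> < ?t (x1 i))"
        using converges_near[OF xC(1) C(1) lim(1) \<open>0 < \<delta>\<close>] converges_near[OF xC(2) C(1) _ \<open>0 < \<delta>\<close>] lim(2) \<open>p = q\<close>
        by (auto intro: eventually_conj)
      from eventually_sequentially_ex[OF this] obtain i where
        i: "?t (x0 i) < \<delta> \<or> 2 * pi - \<delta> < ?t (x0 i)" "?t (x1 i) < \<delta> \<or> 2 * pi - \<delta> < ?t (x1 i)" by blast
      from pos(1)[OF xZ x(2), of i, unfolded cyc_between_base[OF C(1) xC(1) sC(1) xC(2)] cyc_between_base[OF C(1) xC(2) sC(2) xC(1)]]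
      show False using i dl by argo
    qed
  qed
  obtain y0 y1 where y: "\<And>i. {y0 i, y1 i} \<in> D" "converges_from_above y0 p" "converges_from_above y1 q"
    using PC_above[OF D pc pq \<open>p \<noteq> q\<close> x(1) lim] by blast
  have yZ: "y0 i \<in> Z" "y1 i \<in> Z" for i using y(1) D diagonal_pair_iff by blast+
  have "\<forall>\<^sub>F i in sequentially. (\<exists>\<epsilon>>0. \<forall>z\<in>Z. cyc_between (su b) z (su a) \<longrightarrow> dist z p < \<epsilon> \<longrightarrow> cyc_le [z, y0 i, a]) \<and>
     (\<exists>\<epsilon>>0. \<forall>z\<in>Z. cyc_between (su a) z (su b) \<longrightarrow> dist z q < \<epsilon> \<longrightarrow> cyc_le [z, y1 i, b])"
    using eventually_dominates_near[OF pq(1) su_in[OF ab(2)] ab(1) xZ(1) pos(2)[OF xZ x(2)] lim(1) yZ(1) y(2)]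
      eventually_dominates_near[OF pq(2) su_in[OF ab(1)] ab(2) xZ(2) pos(3)[OF xZ x(2)] lim(2) yZ(2) y(3)]
    by (rule eventually_conj)
  from eventually_sequentially_ex[OF this] obtain i \<epsilon>0 \<epsilon>1 where
    e: "0 < \<epsilon>0" "\<forall>z\<in>Z. cyc_between (su b) z (su a) \<longrightarrow> dist z p < \<epsilon>0 \<longrightarrow> cyc_le [z, y0 i, a]"
      "0 < \<epsilon>1" "\<forall>z\<in>Z. cyc_between (su a) z (su b) \<longrightarrow> dist z q < \<epsilon>1 \<longrightarrow> cyc_le [z, y1 i, b]"
    by blast
  have m1: "0 < min \<epsilon>0 \<epsilon>1" using e by simp
  have m2: "finite {{y0 i, y1 i}}" "{{y0 i, y1 i}} \<subseteq> D" using y(1) by auto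
  have m3: "\<exists>s0 s1. {s0, s1} \<in> {{y0 i, y1 i}} \<and> cyc_le [z0, s0, a] \<and> cyc_le [z1, s1, b]"
    if "{z0, z1} \<in> D" "hom_position Z z0 z1 a b" "dist z0 p < min \<epsilon>0 \<epsilon>1" "dist z1 q < min \<epsilon>0 \<epsilon>1" for z0 z1
  proof -
    have "z0 \<in> Z" "z1 \<in> Z" using that(1) D diagonal_pair_iff by blast+
    then have "cyc_le [z0, y0 i, a]" "cyc_le [z1, y1 i, b]" using e that pos(2,3)[of z0 z1] by auto
    then show ?thesis by blast
  qed
  show False
    by (rule n[THEN notE], intro exI[of _ "min \<epsilon>0 \<epsilon>1"] exI[of _ "{{y0 i, y1 i}}"] conjI allI impI)
      (rule m1 m2 m3; assumption)+
qed

text \<open>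
  Finitely many of the neighbourhoods from the local statement cover the compact product of the closures.
\<close>

lemma PC_imp_finitely_dominated:
  assumes D: "D \<subseteq> diagonals Z" and pc: "PC1 Z D" "PC2 Z D"
  shows "finitely_dominated D"
  unfolding finitely_dominated_def
proof (intro allI impI)
  fix a b assume "{a, b} \<in> diagonals Z"
  then have ab: "a \<in> Z" "b \<in> Z" using diagonal_pair_iff by auto
  let ?dom = "\<lambda>F x0 x1. \<exists>s0 s1. {s0, s1} \<in> F \<and> cyc_le [x0, s0, a] \<and> cyc_le [x1, s1, b]"
  have "\<forall>pq. \<exists>\<epsilon> F. pq \<in> closure Z \<times> closure Z \<longrightarrow> 0 < \<epsilon> \<and> finite F \<and> F \<subseteq> D \<and>
     (\<forall>x0 x1. {x0, x1} \<in> D \<longrightarrow> hom_position Z x0 x1 a b \<longrightarrow> dist x0 (fst pq) < \<epsilon> \<longrightarrow> dist x1 (snd pq) < \<epsilon> \<longrightarrow> ?dom F x0 x1)"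
    using PC_imp_locally_dominated[OF D pc ab] by (metis mem_Times_iff)
  then obtain \<epsilon> F where eF: "\<And>pq. pq \<in> closure Z \<times> closure Z \<Longrightarrow> 0 < \<epsilon> pq \<and> finite (F pq) \<and> F pq \<subseteq> D \<and>
     (\<forall>x0 x1. {x0, x1} \<in> D \<longrightarrow> hom_position Z x0 x1 a b \<longrightarrow> dist x0 (fst pq) < \<epsilon> pq \<longrightarrow> dist x1 (snd pq) < \<epsilon> pq \<longrightarrow> ?dom (F pq) x0 x1)"
    by metis
  define N where "N pq = ball (fst pq) (\<epsilon> pq) \<times> ball (snd pq) (\<epsilon> pq)" for pq :: "complex \<times> complex"
  have "closure Z \<subseteq> circle" using closure_in_circle by blast
  then have "bounded (closure Z)" using bounded_subset compact_imp_bounded[OF compact_sphere] by blast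
  then have "compact (closure Z)" by (simp add: compact_eq_bounded_closed)
  then have "compact (closure Z \<times> closure Z)" by (intro compact_Times)
  moreover have "\<And>pq. pq \<in> closure Z \<times> closure Z \<Longrightarrow> open (N pq)" by (simp add: N_def open_Times)
  moreover have "closure Z \<times> closure Z \<subseteq> (\<Union>pq\<in>closure Z \<times> closure Z. N pq)"
  proof
    fix pq assume "pq \<in> closure Z \<times> closure Z"
    moreover from this have "pq \<in> N pq" using eF[of pq] by (cases pq) (auto simp: N_def)
    ultimately show "pq \<in> (\<Union>pq\<in>closure Z \<times> closure Z. N pq)" by blast
  qed
  ultimately obtain P where P: "P \<subseteq> closure Z \<times> closure Z" "finite P" "closure Z \<times> closure Z \<subseteq> (\<Union>pq\<in>P. N pq)"
    using compactE_image[of "closure Z \<times> closure Z" "closure Z \<times> closure Z" N] by metis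
  have "finite (\<Union>(F ` P))" "\<Union>(F ` P) \<subseteq> D" using P eF by blast+
  moreover have "?dom (\<Union>(F ` P)) x0 x1" if x: "{x0, x1} \<in> D" "hom_position Z x0 x1 a b" for x0 x1
  proof -
    have "x0 \<in> Z" "x1 \<in> Z" using x(1) D diagonal_pair_iff by blast+
    then have "(x0, x1) \<in> closure Z \<times> closure Z" using closure_subset by blast
    then obtain pq where pq: "pq \<in> P" "(x0, x1) \<in> N pq" using P by blast
    then have "dist x0 (fst pq) < \<epsilon> pq" "dist x1 (snd pq) < \<epsilon> pq" by (auto simp: N_def dist_commute)
    then have "?dom (F pq) x0 x1" using eF[of pq] pq P(1) x by blast
    then show ?thesis using pq(1) by blast
  qed
  ultimately show "\<exists>F. finite F \<and> F \<subseteq> D \<and> (\<forall>x0 x1. {x0, x1} \<in> D \<longrightarrow> hom_position Z x0 x1 a b \<longrightarrow> ?dom F x0 x1)"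
    by blast
qed

end

section \<open>Local endomorphism rings and the radical\<close>

context linear_category
begin

abbreviation mor :: "'o \<Rightarrow> 'o \<Rightarrow> 'm set" where "mor A B \<equiv> carrier (Hom C A B)"
abbreviation cmp :: "'m \<Rightarrow> 'm \<Rightarrow> 'm" (infixl "\<star>" 75) where "g \<star> f \<equiv> g \<cdot>\<^bsub>C\<^esub> f"
abbreviation zr :: "'o \<Rightarrow> 'o \<Rightarrow> 'm" where "zr A B \<equiv> \<zero>\<^bsub>Hom C A B\<^esub>"

lemma Hom_abelian_group:
  assumes "A \<in> Ob C" "B \<in> Ob C" shows "abelian_group (Hom C A B)"
  using Hom_module[OF assms] by (simp add: module_def)

lemmas Hom_abelian_monoid = abelian_group.axioms(1)[OF Hom_abelian_group]

lemma zr_closed [simp]: "A \<in> Ob C \<Longrightarrow> B \<in> Ob C \<Longrightarrow> zr A B \<in> mor A B"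
  using abelian_monoid.zero_closed[OF Hom_abelian_monoid] .

lemma cmp_closed [simp]:
  "\<lbrakk>f \<in> mor A B; g \<in> mor B D; A \<in> Ob C; B \<in> Ob C; D \<in> Ob C\<rbrakk> \<Longrightarrow> g \<star> f \<in> mor A D"
  by (rule Comp_closed)

lemma zero_smult:
  assumes "A \<in> Ob C" "B \<in> Ob C" "f \<in> mor A B"
  shows "\<zero>\<^bsub>K\<^esub> \<odot>\<^bsub>Hom C A B\<^esub> f = zr A B"
  using module.smult_l_null[OF Hom_module[OF assms(1,2)] assms(3)] .

lemma ground_zero_closed: "\<zero>\<^bsub>K\<^esub> \<in> carrier K"
proof -
  interpret field K by (rule ground_field)
  show ?thesis by simp
qed

lemma cmp_zr [simp]:
  assumes "A \<in> Ob C" "B \<in> Ob C" "D \<in> Ob C"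
  shows "g \<in> mor B D \<Longrightarrow> g \<star> zr A B = zr A D" "f \<in> mor A B \<Longrightarrow> zr B D \<star> f = zr A D"
proof -
  show "g \<star> zr A B = zr A D" if "g \<in> mor B D"
    using Comp_smult_right[OF assms ground_zero_closed zr_closed[OF assms(1,2)] that] that
      cmp_closed[OF zr_closed that assms(1-3)] zero_smult[of A D "g \<star> zr A B"] zero_smult[of A B "zr A B"] assms
    by simp
  show "zr B D \<star> f = zr A D" if "f \<in> mor A B"
    using Comp_smult_left[OF assms ground_zero_closed that zr_closed[OF assms(2,3)]] that
      cmp_closed[OF that zr_closed assms(1-3)] zero_smult[of A D "zr B D \<star> f"] zero_smult[of B D "zr B D"] assms
    by simp
qed

lemma cmp_minus:
  assumes "A \<in> Ob C" "B \<in> Ob C" "D \<in> Ob C" "f \<in> mor A B" "g \<in> mor B D"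
  shows "g \<star> (\<ominus>\<^bsub>Hom C A B\<^esub> f) = \<ominus>\<^bsub>Hom C A D\<^esub> (g \<star> f)"
    "(\<ominus>\<^bsub>Hom C B D\<^esub> g) \<star> f = \<ominus>\<^bsub>Hom C A D\<^esub> (g \<star> f)"
proof -
  interpret AB: abelian_group "Hom C A B" by (rule Hom_abelian_group) fact+
  interpret BD: abelian_group "Hom C B D" by (rule Hom_abelian_group) fact+
  interpret AD: abelian_group "Hom C A D" by (rule Hom_abelian_group) fact+
  note c = cmp_closed[OF assms(4,5,1-3)]
    cmp_closed[OF AB.a_inv_closed[OF assms(4)] assms(5,1-3)] cmp_closed[OF assms(4) BD.a_inv_closed[OF assms(5)] assms(1-3)]
  have "g \<star> (\<ominus>\<^bsub>Hom C A B\<^esub> f) \<oplus>\<^bsub>Hom C A D\<^esub> g \<star> f = zr A D"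
    using Comp_add_right[of A B D "\<ominus>\<^bsub>Hom C A B\<^esub> f" f g] assms by (simp add: AB.l_neg)
  from AD.minus_equality[OF this c(1,2)]
  show "g \<star> (\<ominus>\<^bsub>Hom C A B\<^esub> f) = \<ominus>\<^bsub>Hom C A D\<^esub> (g \<star> f)" by simp
  have "(\<ominus>\<^bsub>Hom C B D\<^esub> g) \<star> f \<oplus>\<^bsub>Hom C A D\<^esub> g \<star> f = zr A D"
    using Comp_add_left[of A B D f "\<ominus>\<^bsub>Hom C B D\<^esub> g" g] assms by (simp add: BD.l_neg)
  from AD.minus_equality[OF this c(1,3)]
  show "(\<ominus>\<^bsub>Hom C B D\<^esub> g) \<star> f = \<ominus>\<^bsub>Hom C A D\<^esub> (g \<star> f)" by simp
qed

lemma finsum_mor_closed: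
  assumes "A \<in> Ob C" "B \<in> Ob C" "\<And>i. i \<in> I \<Longrightarrow> f i \<in> mor A B"
  shows "(\<Oplus>\<^bsub>Hom C A B\<^esub>i\<in>I. f i) \<in> mor A B"
  by (rule abelian_monoid.finsum_closed[OF Hom_abelian_monoid[OF assms(1,2)]]) (use assms(3) in auto)

lemma cmp_finsum_right:
  assumes "A \<in> Ob C" "B \<in> Ob C" "D \<in> Ob C" "finite I" "\<And>i. i \<in> I \<Longrightarrow> f i \<in> mor A B" "g \<in> mor B D"
  shows "g \<star> (\<Oplus>\<^bsub>Hom C A B\<^esub>i\<in>I. f i) = (\<Oplus>\<^bsub>Hom C A D\<^esub>i\<in>I. g \<star> f i)"
  using assms(4,5)
proof (induction I)
  case empty
  then show ?case using assms by (simp add: abelian_monoid.finsum_empty[OF Hom_abelian_monoid])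
next
  case (insert i I)
  interpret AB: abelian_group "Hom C A B" by (rule Hom_abelian_group) fact+
  interpret AD: abelian_group "Hom C A D" by (rule Hom_abelian_group) fact+
  have cl: "g \<star> f x \<in> mor A D" if "x \<in> insert i I" for x
    using cmp_closed[OF insert.prems assms(6) assms(1-3)] that by blast
  have "(\<Oplus>\<^bsub>Hom C A B\<^esub>i\<in>insert i I. f i) = f i \<oplus>\<^bsub>Hom C A B\<^esub> (\<Oplus>\<^bsub>Hom C A B\<^esub>i\<in>I. f i)"
    using insert by (intro AB.finsum_insert) auto
  moreover have "(\<Oplus>\<^bsub>Hom C A D\<^esub>i\<in>insert i I. g \<star> f i) = g \<star> f i \<oplus>\<^bsub>Hom C A D\<^esub> (\<Oplus>\<^bsub>Hom C A D\<^esub>i\<in>I. g \<star> f i)"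
    using insert.hyps cl by (intro AD.finsum_insert) auto
  ultimately show ?case
    using Comp_add_right[of A B D "f i" "\<Oplus>\<^bsub>Hom C A B\<^esub>i\<in>I. f i" g] insert assms
    by (simp add: finsum_mor_closed)
qed

lemma cmp_finsum_left:
  assumes "A \<in> Ob C" "B \<in> Ob C" "D \<in> Ob C" "finite I" "\<And>i. i \<in> I \<Longrightarrow> g i \<in> mor B D" "f \<in> mor A B"
  shows "(\<Oplus>\<^bsub>Hom C B D\<^esub>i\<in>I. g i) \<star> f = (\<Oplus>\<^bsub>Hom C A D\<^esub>i\<in>I. g i \<star> f)"
  using assms(4,5)
proof (induction I)
  case empty
  then show ?case using assms by (simp add: abelian_monoid.finsum_empty[OF Hom_abelian_monoid])
next
  case (insert i I)
  interpret BD: abelian_group "Hom C B D" by (rule Hom_abelian_group) fact+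
  interpret AD: abelian_group "Hom C A D" by (rule Hom_abelian_group) fact+
  have cl: "g x \<star> f \<in> mor A D" if "x \<in> insert i I" for x
    using cmp_closed[OF assms(6) insert.prems assms(1-3)] that by blast
  have "(\<Oplus>\<^bsub>Hom C B D\<^esub>i\<in>insert i I. g i) = g i \<oplus>\<^bsub>Hom C B D\<^esub> (\<Oplus>\<^bsub>Hom C B D\<^esub>i\<in>I. g i)"
    using insert by (intro BD.finsum_insert) auto
  moreover have "(\<Oplus>\<^bsub>Hom C A D\<^esub>i\<in>insert i I. g i \<star> f) = g i \<star> f \<oplus>\<^bsub>Hom C A D\<^esub> (\<Oplus>\<^bsub>Hom C A D\<^esub>i\<in>I. g i \<star> f)"
    using insert.hyps cl by (intro AD.finsum_insert) auto
  ultimately show ?case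
    using Comp_add_left[of A B D f "g i" "\<Oplus>\<^bsub>Hom C B D\<^esub>i\<in>I. g i"] insert assms
    by (simp add: finsum_mor_closed)
qed

lemma finsum_cong_mor:
  assumes "A \<in> Ob C" "B \<in> Ob C" "\<And>i. i \<in> I \<Longrightarrow> g i \<in> mor A B" "\<And>i. i \<in> I \<Longrightarrow> f i = g i"
  shows "(\<Oplus>\<^bsub>Hom C A B\<^esub>i\<in>I. f i) = (\<Oplus>\<^bsub>Hom C A B\<^esub>i\<in>I. g i)"
  using assms by (intro abelian_monoid.finsum_cong'[OF Hom_abelian_monoid]) auto

lemma finsum_zr:
  assumes "A \<in> Ob C" "B \<in> Ob C" "\<And>i. i \<in> I \<Longrightarrow> f i = zr A B"
  shows "(\<Oplus>\<^bsub>Hom C A B\<^esub>i\<in>I. f i) = zr A B"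
proof -
  interpret AB: abelian_group "Hom C A B" by (rule Hom_abelian_group) fact+
  have "(\<Oplus>\<^bsub>Hom C A B\<^esub>i\<in>I. f i) = (\<Oplus>\<^bsub>Hom C A B\<^esub>i\<in>I. zr A B)"
    by (rule finsum_cong_mor) (use assms in auto)
  then show ?thesis by (simp add: AB.finsum_zero)
qed

lemma isomorphism_Id: "A \<in> Ob C \<Longrightarrow> isomorphism C A A (Id C A)"
  unfolding isomorphism_def using Id_closed Id_Comp by (auto intro!: bexI[of _ "Id C A"])

lemma isomorphic_sym: "isomorphic C A B \<Longrightarrow> isomorphic C B A"
  unfolding isomorphic_def isomorphism_def by blast

lemma isomorphic_refl: "A \<in> Ob C \<Longrightarrow> isomorphic C A A"
  unfolding isomorphic_def using isomorphism_Id by blast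

lemma isomorphismE:
  assumes "isomorphism C A B f"
  obtains f' where "f \<in> mor A B" "f' \<in> mor B A" "f' \<star> f = Id C A" "f \<star> f' = Id C B"
  using assms unfolding isomorphism_def by blast

lemma local_idempotent:
  assumes A: "local_endomorphism_ring C A" and e: "e \<in> mor A A" "e \<star> e = e"
  shows "e = Id C A \<or> e = zr A A"
proof -
  have AO: "A \<in> Ob C" using A by (simp add: local_endomorphism_ring_def)
  interpret AA: abelian_group "Hom C A A" by (rule Hom_abelian_group[OF AO AO])
  note Ic = Id_closed[OF AO]
  have idem_iso: "u = Id C A" if u: "u \<in> mor A A" "u \<star> u = u" "isomorphism C A A u" for u
  proof -
    obtain u' where u': "u' \<in> mor A A" "u' \<star> u = Id C A" using isomorphismE[OF u(3)] by metis
    have "u = (u' \<star> u) \<star> u" using u u' Id_Comp[OF AO AO u(1)] by simp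
    also have "\<dots> = u' \<star> (u \<star> u)" by (rule Comp_assoc[OF AO AO AO AO u(1) u(1) u'(1)])
    also have "\<dots> = Id C A" using u(2) u'(2) by simp
    finally show ?thesis .
  qed
  define d where "d = Id C A \<oplus>\<^bsub>Hom C A A\<^esub> (\<ominus>\<^bsub>Hom C A A\<^esub> e)"
  have d: "d \<in> mor A A" using e Ic by (simp add: d_def)
  have ed: "e \<star> d = zr A A"
    using Comp_add_right[OF AO AO AO Ic _ e(1), of "\<ominus>\<^bsub>Hom C A A\<^esub> e"] cmp_minus[OF AO AO AO e(1) e(1)] e AO
    by (simp add: d_def Comp_Id AA.r_neg)
  have dd: "d \<star> d = d"
  proof -
    have "d \<star> d = Id C A \<star> d \<oplus>\<^bsub>Hom C A A\<^esub> (\<ominus>\<^bsub>Hom C A A\<^esub> e) \<star> d"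
      using Comp_add_left[OF AO AO AO d Ic, of "\<ominus>\<^bsub>Hom C A A\<^esub> e"] e by (simp add: d_def)
    also have "\<dots> = d \<oplus>\<^bsub>Hom C A A\<^esub> (\<ominus>\<^bsub>Hom C A A\<^esub> (e \<star> d))"
      using cmp_minus[OF AO AO AO d e(1)] d AO by (simp add: Id_Comp)
    finally show ?thesis using ed d by simp
  qed
  have sum: "e \<oplus>\<^bsub>Hom C A A\<^esub> d = Id C A"
    unfolding d_def using e Ic by (metis AA.a_comm AA.a_inv_closed AA.add.m_assoc AA.l_neg AA.r_zero)
  have "isomorphism C A A e \<or> isomorphism C A A d"
    using A e d sum isomorphism_Id[OF AO] unfolding local_endomorphism_ring_def by metis
  then show ?thesis
  proof
    assume "isomorphism C A A d"
    then have "d = Id C A" using idem_iso d dd by blast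
    then have "e = zr A A" using ed e AO by (simp add: Comp_Id)
    then show ?thesis by blast
  qed (use idem_iso e in blast)
qed

text \<open>
  The inverse of \<open>g \<star> f\<close> turns \<open>f\<close> into a split monomorphism, and the idempotent of \<open>B\<close> it defines is not zero
  because \<open>A\<close> is not, so it is the identity.
\<close>

lemma local_split:
  assumes B: "local_endomorphism_ring C B" and A: "A \<in> Ob C" "Id C A \<noteq> zr A A"
    and f: "f \<in> mor A B" and g: "g \<in> mor B A" and gf: "isomorphism C A A (g \<star> f)"
  shows "isomorphism C A B f"
proof -
  have BO: "B \<in> Ob C" using B by (simp add: local_endomorphism_ring_def)
  obtain u where u: "u \<in> mor A A" "u \<star> (g \<star> f) = Id C A" using isomorphismE[OF gf] by metis
  define h where "h = u \<star> g"
  have h: "h \<in> mor B A" using u g A BO by (simp add: h_def)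
  have hf: "h \<star> f = Id C A" using u f g A BO by (simp add: h_def Comp_assoc[of A B A A])
  define e where "e = f \<star> h"
  have e: "e \<in> mor B B" using f h A BO by (simp add: e_def)
  have he: "h \<star> e = h"
    using f h A BO hf by (simp add: e_def Comp_assoc[of B A B A, symmetric] Id_Comp)
  have "e \<star> e = e"
  proof -
    have "e \<star> e = f \<star> (h \<star> e)" using f h e A BO Comp_assoc[of B B A B e h f] by (simp add: e_def)
    then show ?thesis using he by (simp add: e_def)
  qed
  then have "e = Id C B \<or> e = zr B B" using local_idempotent[OF B e] by blast
  moreover have "e \<noteq> zr B B"
  proof
    assume "e = zr B B"
    then have "h = zr B A" using he h A BO by simp
    then have "Id C A = zr A A" using hf f A BO by simp
    then show False using A by blast
  qed
  ultimately show ?thesis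
    unfolding isomorphism_def using f h hf by (auto simp: e_def)
qed

lemma local_nonzero: "local_endomorphism_ring C A \<Longrightarrow> A \<in> Ob C \<and> Id C A \<noteq> zr A A"
  by (simp add: local_endomorphism_ring_def)

lemma zr_not_iso:
  assumes "A \<in> Ob C" "Id C A \<noteq> zr A A" shows "\<not> isomorphism C A A (zr A A)"
proof
  assume "isomorphism C A A (zr A A)"
  then obtain u where "u \<in> mor A A" "u \<star> zr A A = Id C A" using isomorphismE by metis
  then show False using assms by simp
qed

lemma local_sum_iso:
  assumes A: "local_endomorphism_ring C A" and I: "finite I" "\<And>i. i \<in> I \<Longrightarrow> h i \<in> mor A A"
    and sum: "(\<Oplus>\<^bsub>Hom C A A\<^esub>i\<in>I. h i) = Id C A"
  shows "\<exists>i\<in>I. isomorphism C A A (h i)"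
proof (rule ccontr)
  assume n: "\<not> ?thesis"
  have AO: "A \<in> Ob C" "Id C A \<noteq> zr A A" using local_nonzero[OF A] by auto
  interpret AA: abelian_group "Hom C A A" by (rule Hom_abelian_group[OF AO(1) AO(1)])
  have "\<not> isomorphism C A A (\<Oplus>\<^bsub>Hom C A A\<^esub>i\<in>J. h i)" if "finite J" "J \<subseteq> I" for J
    using that
  proof (induction J)
    case empty then show ?case using zr_not_iso[OF AO] by simp
  next
    case (insert j J)
    have "(\<Oplus>\<^bsub>Hom C A A\<^esub>i\<in>insert j J. h i) = h j \<oplus>\<^bsub>Hom C A A\<^esub> (\<Oplus>\<^bsub>Hom C A A\<^esub>i\<in>J. h i)"
      using insert I(2) by (intro AA.finsum_insert) auto
    moreover have "(\<Oplus>\<^bsub>Hom C A A\<^esub>i\<in>J. h i) \<in> mor A A" using insert I(2) by (intro finsum_mor_closed AO) auto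
    moreover have "h j \<in> mor A A" "\<not> isomorphism C A A (h j)" using insert I(2) n by auto
    ultimately show ?case using A insert unfolding local_endomorphism_ring_def by auto
  qed
  then show False using I(1) sum isomorphism_Id[OF AO(1)] by fastforce
qed

text \<open>
  The Jacobson radical of the category.  Asking for left inverses only keeps the closure properties purely
  equational, and left inverses are what minimality of an approximation is about.
\<close>

definition rad :: "'o \<Rightarrow> 'o \<Rightarrow> 'm set" where
  "rad A B = {f \<in> mor A B. \<forall>g\<in>mor B A. \<exists>l\<in>mor A A.
     l \<star> (Id C A \<oplus>\<^bsub>Hom C A A\<^esub> (\<ominus>\<^bsub>Hom C A A\<^esub> (g \<star> f))) = Id C A}"

lemma cmp_one_minus:
  assumes "A \<in> Ob C" "l \<in> mor A A" "f \<in> mor A A"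
  shows "l \<star> (Id C A \<oplus>\<^bsub>Hom C A A\<^esub> (\<ominus>\<^bsub>Hom C A A\<^esub> f)) = l \<oplus>\<^bsub>Hom C A A\<^esub> (\<ominus>\<^bsub>Hom C A A\<^esub> (l \<star> f))"
proof -
  interpret AA: abelian_group "Hom C A A" by (rule Hom_abelian_group) fact+
  show ?thesis
    using Comp_add_right[of A A A "Id C A" "\<ominus>\<^bsub>Hom C A A\<^esub> f" l] assms cmp_minus[of A A A f l]
    by (simp add: Id_closed Comp_Id)
qed

text \<open>
  If \<open>l (1 - g f) = 1\<close>, then \<open>l (1 - g (f + f')) = 1 - (l g) f'\<close>, which has a left inverse again.
\<close>

lemma rad_add:
  assumes "A \<in> Ob C" "B \<in> Ob C" "f \<in> rad A B" "f' \<in> rad A B"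
  shows "f \<oplus>\<^bsub>Hom C A B\<^esub> f' \<in> rad A B"
proof -
  interpret AB: abelian_group "Hom C A B" by (rule Hom_abelian_group) fact+
  interpret AA: abelian_group "Hom C A A" by (rule Hom_abelian_group) fact+
  note O = assms(1,2)
  have f: "f \<in> mor A B" "f' \<in> mor A B" using assms by (auto simp: rad_def)
  have "\<exists>l\<in>mor A A. l \<star> (Id C A \<oplus>\<^bsub>Hom C A A\<^esub> (\<ominus>\<^bsub>Hom C A A\<^esub> (g \<star> (f \<oplus>\<^bsub>Hom C A B\<^esub> f')))) = Id C A"
    if g: "g \<in> mor B A" for g
  proof -
    obtain l where l: "l \<in> mor A A" "l \<star> (Id C A \<oplus>\<^bsub>Hom C A A\<^esub> (\<ominus>\<^bsub>Hom C A A\<^esub> (g \<star> f))) = Id C A"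
      using assms(3) g unfolding rad_def by blast
    have lg: "l \<star> g \<in> mor B A" using l g O by simp
    obtain l' where l': "l' \<in> mor A A" "l' \<star> (Id C A \<oplus>\<^bsub>Hom C A A\<^esub> (\<ominus>\<^bsub>Hom C A A\<^esub> ((l \<star> g) \<star> f'))) = Id C A"
      using assms(4) lg unfolding rad_def by blast
    have gf: "g \<star> f \<in> mor A A" "g \<star> f' \<in> mor A A" using g f O by auto
    let ?s = "Id C A \<oplus>\<^bsub>Hom C A A\<^esub> (\<ominus>\<^bsub>Hom C A A\<^esub> (g \<star> (f \<oplus>\<^bsub>Hom C A B\<^esub> f')))"
    have "?s = (Id C A \<oplus>\<^bsub>Hom C A A\<^esub> (\<ominus>\<^bsub>Hom C A A\<^esub> (g \<star> f))) \<oplus>\<^bsub>Hom C A A\<^esub> (\<ominus>\<^bsub>Hom C A A\<^esub> (g \<star> f'))"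
      using Comp_add_right[of A B A f f' g] f g gf O Id_closed[of A] by (simp add: AA.minus_add AA.a_assoc)
    then have "l \<star> ?s = l \<star> (Id C A \<oplus>\<^bsub>Hom C A A\<^esub> (\<ominus>\<^bsub>Hom C A A\<^esub> (g \<star> f))) \<oplus>\<^bsub>Hom C A A\<^esub> l \<star> (\<ominus>\<^bsub>Hom C A A\<^esub> (g \<star> f'))"
      using Comp_add_right[of A A A _ "\<ominus>\<^bsub>Hom C A A\<^esub> (g \<star> f')" l] gf l O Id_closed[of A] by simp
    also have "\<dots> = Id C A \<oplus>\<^bsub>Hom C A A\<^esub> (\<ominus>\<^bsub>Hom C A A\<^esub> ((l \<star> g) \<star> f'))"
      using l cmp_minus[of A A A "g \<star> f'" l] gf O Comp_assoc[of A B A A f' g l] f g by simp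
    finally have ls: "l \<star> ?s = \<dots>" .
    have s: "?s \<in> mor A A"
      using cmp_closed[OF AB.a_closed[OF f] g O(1,2,1)] O Id_closed[of A] by simp
    have "(l' \<star> l) \<star> ?s = l' \<star> (l \<star> ?s)" using Comp_assoc[OF O(1) O(1) O(1) O(1) s l(1) l'(1)] .
    then have "(l' \<star> l) \<star> ?s = Id C A" using l'(2) ls by simp
    then show ?thesis using l l' O by (intro bexI[of _ "l' \<star> l"]) auto
  qed
  then show ?thesis using f by (simp add: rad_def)
qed

lemma rad_cmp_left:
  assumes O: "A \<in> Ob C" "B \<in> Ob C" "D \<in> Ob C" and f: "f \<in> rad A B" and h: "h \<in> mor B D"
  shows "h \<star> f \<in> rad A D"
proof -
  have fm: "f \<in> mor A B" using f by (simp add: rad_def)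
  have "\<exists>l\<in>mor A A. l \<star> (Id C A \<oplus>\<^bsub>Hom C A A\<^esub> (\<ominus>\<^bsub>Hom C A A\<^esub> (g \<star> (h \<star> f)))) = Id C A"
    if g: "g \<in> mor D A" for g
  proof -
    have "g \<star> h \<in> mor B A" "g \<star> (h \<star> f) = (g \<star> h) \<star> f"
      using g h O Comp_assoc[of A B D A f h g] fm by auto
    then show ?thesis using f unfolding rad_def by auto
  qed
  then show ?thesis using fm h O by (simp add: rad_def)
qed

text \<open>
  With \<open>b = g f\<close>: if \<open>c (1 - h b) = 1\<close>, then \<open>(1 + b c h) (1 - b h) = 1\<close>.
\<close>

lemma rad_cmp_right:
  assumes O: "A \<in> Ob C" "B \<in> Ob C" "D \<in> Ob C" and f: "f \<in> rad A B" and h: "h \<in> mor D A"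
  shows "f \<star> h \<in> rad D B"
proof -
  have fm: "f \<in> mor A B" using f by (simp add: rad_def)
  have "\<exists>l\<in>mor D D. l \<star> (Id C D \<oplus>\<^bsub>Hom C D D\<^esub> (\<ominus>\<^bsub>Hom C D D\<^esub> (g \<star> (f \<star> h)))) = Id C D"
    if g: "g \<in> mor B D" for g
  proof -
    interpret DD: abelian_group "Hom C D D" by (rule Hom_abelian_group) fact+
    interpret AA: abelian_group "Hom C A A" by (rule Hom_abelian_group) fact+
    define b where "b = g \<star> f"
    have b: "b \<in> mor A D" using g fm O by (simp add: b_def)
    have bh: "b \<star> h = g \<star> (f \<star> h)" "b \<star> h \<in> mor D D"
      using Comp_assoc[of D A B D h f g] cmp_closed[OF h b O(3,1,3)] g fm h O by (auto simp: b_def)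
    have hb: "h \<star> b = (h \<star> g) \<star> f" "h \<star> b \<in> mor A A"
      using Comp_assoc[of A B D A f g h] cmp_closed[OF b h O(1,3,1)] g fm h O by (auto simp: b_def)
    have "h \<star> g \<in> mor B A" using g h O by simp
    then obtain c where c: "c \<in> mor A A" "c \<star> (Id C A \<oplus>\<^bsub>Hom C A A\<^esub> (\<ominus>\<^bsub>Hom C A A\<^esub> (h \<star> b))) = Id C A"
      using f unfolding rad_def hb(1) by blast
    have c1: "c \<oplus>\<^bsub>Hom C A A\<^esub> (\<ominus>\<^bsub>Hom C A A\<^esub> (c \<star> (h \<star> b))) = Id C A"
      using cmp_one_minus[OF O(1) c(1) hb(2)] c(2) by simp
    define m where "m = b \<star> (c \<star> h)"
    have ch: "c \<star> h \<in> mor D A" using c h O by simp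
    have m: "m \<in> mor D D" using b ch O by (simp add: m_def)
    have mbh: "m \<oplus>\<^bsub>Hom C D D\<^esub> (\<ominus>\<^bsub>Hom C D D\<^esub> (m \<star> (b \<star> h))) = b \<star> h"
    proof -
      have "(c \<star> h) \<star> (b \<star> h) = (c \<star> (h \<star> b)) \<star> h"
        using Comp_assoc[of D D A A "b \<star> h" h c] Comp_assoc[of D A D A h b h] Comp_assoc[of D A A A h "h \<star> b" c] b c h bh hb O
        by simp
      moreover have "Id C A \<star> h = c \<star> h \<oplus>\<^bsub>Hom C D A\<^esub> (\<ominus>\<^bsub>Hom C D A\<^esub> ((c \<star> (h \<star> b)) \<star> h))"
        using Comp_add_left[of D A A h c "\<ominus>\<^bsub>Hom C A A\<^esub> (c \<star> (h \<star> b))"] cmp_minus(2)[of D A A h "c \<star> (h \<star> b)"] c1 c hb h O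
        by simp
      ultimately have "h = c \<star> h \<oplus>\<^bsub>Hom C D A\<^esub> (\<ominus>\<^bsub>Hom C D A\<^esub> ((c \<star> h) \<star> (b \<star> h)))"
        using h O by (simp add: Id_Comp)
      moreover have "b \<star> (c \<star> h \<oplus>\<^bsub>Hom C D A\<^esub> (\<ominus>\<^bsub>Hom C D A\<^esub> ((c \<star> h) \<star> (b \<star> h))))
          = m \<oplus>\<^bsub>Hom C D D\<^esub> (\<ominus>\<^bsub>Hom C D D\<^esub> (b \<star> ((c \<star> h) \<star> (b \<star> h))))"
        using Comp_add_right[of D A D "c \<star> h" "\<ominus>\<^bsub>Hom C D A\<^esub> ((c \<star> h) \<star> (b \<star> h))" b]
          cmp_minus(1)[of D A D "(c \<star> h) \<star> (b \<star> h)" b] ch bh b O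
          abelian_group.a_inv_closed[OF Hom_abelian_group[OF O(3,1)], of "(c \<star> h) \<star> (b \<star> h)"]
        by (simp add: m_def)
      moreover have "m \<star> (b \<star> h) = b \<star> ((c \<star> h) \<star> (b \<star> h))"
        using Comp_assoc[of D D A D "b \<star> h" "c \<star> h" b] b ch bh O by (simp add: m_def)
      ultimately show ?thesis by metis
    qed
    let ?l = "Id C D \<oplus>\<^bsub>Hom C D D\<^esub> m"
    have I: "Id C D \<in> mor D D" using Id_closed O by blast
    have "?l \<star> (Id C D \<oplus>\<^bsub>Hom C D D\<^esub> (\<ominus>\<^bsub>Hom C D D\<^esub> (b \<star> h)))
      = ?l \<oplus>\<^bsub>Hom C D D\<^esub> (\<ominus>\<^bsub>Hom C D D\<^esub> (?l \<star> (b \<star> h)))"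
      using cmp_one_minus[OF O(3) _ bh(2), of ?l] I m by simp
    also have "?l \<star> (b \<star> h) = b \<star> h \<oplus>\<^bsub>Hom C D D\<^esub> m \<star> (b \<star> h)"
      using Comp_add_left[of D D D "b \<star> h" "Id C D" m] I m bh O by (simp add: Id_Comp)
    also have "?l \<oplus>\<^bsub>Hom C D D\<^esub> (\<ominus>\<^bsub>Hom C D D\<^esub> (b \<star> h \<oplus>\<^bsub>Hom C D D\<^esub> m \<star> (b \<star> h)))
      = Id C D \<oplus>\<^bsub>Hom C D D\<^esub> ((m \<oplus>\<^bsub>Hom C D D\<^esub> (\<ominus>\<^bsub>Hom C D D\<^esub> (m \<star> (b \<star> h)))) \<oplus>\<^bsub>Hom C D D\<^esub> (\<ominus>\<^bsub>Hom C D D\<^esub> (b \<star> h)))"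
      using I m bh O by (simp add: DD.minus_add DD.a_ac)
    also have "\<dots> = Id C D" unfolding mbh using I bh by (simp add: DD.r_neg)
    finally show ?thesis using I m unfolding bh(1) by (intro bexI[of _ ?l]) auto
  qed
  then show ?thesis using fm h O by (simp add: rad_def)
qed

lemma rad_zr: 
  assumes "A \<in> Ob C" "B \<in> Ob C" shows "zr A B \<in> rad A B"
proof -
  interpret AA: abelian_group "Hom C A A" by (rule Hom_abelian_group) fact+
  show ?thesis using assms Id_closed[of A] by (auto simp: rad_def Id_Comp intro!: bexI[of _ "Id C A"])
qed

lemma rad_finsum:
  assumes O: "A \<in> Ob C" "B \<in> Ob C" and "finite I" "\<And>i. i \<in> I \<Longrightarrow> f i \<in> rad A B"
  shows "(\<Oplus>\<^bsub>Hom C A B\<^esub>i\<in>I. f i) \<in> rad A B"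
  using assms(3,4)
proof (induction I)
  case empty
  interpret AB: abelian_group "Hom C A B" by (rule Hom_abelian_group) fact+
  show ?case using rad_zr O by simp
next
  case (insert i I)
  interpret AB: abelian_group "Hom C A B" by (rule Hom_abelian_group) fact+
  have "(\<Oplus>\<^bsub>Hom C A B\<^esub>i\<in>insert i I. f i) = f i \<oplus>\<^bsub>Hom C A B\<^esub> (\<Oplus>\<^bsub>Hom C A B\<^esub>i\<in>I. f i)"
    using insert by (intro AB.finsum_insert) (auto simp: rad_def)
  then show ?case using rad_add[OF O] insert by auto
qed

lemma nonisomorphism_in_rad:
  assumes A: "local_endomorphism_ring C A" and B: "local_endomorphism_ring C B"
    and f: "f \<in> mor A B" "\<not> isomorphism C A B f"
  shows "f \<in> rad A B"
proof -
  have AO: "A \<in> Ob C" "Id C A \<noteq> zr A A" and BO: "B \<in> Ob C" using local_nonzero A B by auto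
  interpret AA: abelian_group "Hom C A A" by (rule Hom_abelian_group) fact+
  have "\<exists>l\<in>mor A A. l \<star> (Id C A \<oplus>\<^bsub>Hom C A A\<^esub> (\<ominus>\<^bsub>Hom C A A\<^esub> (g \<star> f))) = Id C A" if g: "g \<in> mor B A" for g
  proof -
    have gf: "g \<star> f \<in> mor A A" using f g AO BO by simp
    let ?d = "Id C A \<oplus>\<^bsub>Hom C A A\<^esub> (\<ominus>\<^bsub>Hom C A A\<^esub> (g \<star> f))"
    have "\<not> isomorphism C A A (g \<star> f)" using local_split[OF B AO f(1) g] f(2) by blast
    moreover have "g \<star> f \<oplus>\<^bsub>Hom C A A\<^esub> ?d = Id C A"
      using gf Id_closed[OF AO(1)] by (metis AA.a_comm AA.a_inv_closed AA.add.m_assoc AA.l_neg AA.r_zero)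
    moreover have "?d \<in> mor A A" using gf Id_closed[OF AO(1)] by simp
    ultimately have "isomorphism C A A ?d"
      using A gf isomorphism_Id[OF AO(1)] unfolding local_endomorphism_ring_def by metis
    then show ?thesis using isomorphismE by metis
  qed
  then show ?thesis using f by (simp add: rad_def)
qed

end

section \<open>Biproducts and additive closures\<close>

context linear_category
begin

text \<open>
  Biproducts over arbitrary finite index sets instead of lists, so that single summands can be removed.
\<close>

definition biprod :: "'i set \<Rightarrow> ('i \<Rightarrow> 'o) \<Rightarrow> 'o \<Rightarrow> ('i \<Rightarrow> 'm) \<Rightarrow> ('i \<Rightarrow> 'm) \<Rightarrow> bool" where
  "biprod I A D \<iota> \<pi> \<longleftrightarrow> finite I \<and> D \<in> Ob C \<and>
     (\<forall>i\<in>I. A i \<in> Ob C \<and> \<iota> i \<in> mor (A i) D \<and> \<pi> i \<in> mor D (A i)) \<and>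
     (\<forall>i\<in>I. \<forall>j\<in>I. \<pi> i \<star> \<iota> j = (if i = j then Id C (A i) else zr (A j) (A i))) \<and>
     (\<Oplus>\<^bsub>Hom C D D\<^esub>i\<in>I. \<iota> i \<star> \<pi> i) = Id C D"

lemma biprodD:
  assumes "biprod I A D \<iota> \<pi>"
  shows "finite I" "D \<in> Ob C" "\<And>i. i \<in> I \<Longrightarrow> A i \<in> Ob C" "\<And>i. i \<in> I \<Longrightarrow> \<iota> i \<in> mor (A i) D"
    "\<And>i. i \<in> I \<Longrightarrow> \<pi> i \<in> mor D (A i)" "\<And>i. i \<in> I \<Longrightarrow> \<pi> i \<star> \<iota> i = Id C (A i)"
    "\<And>i j. i \<in> I \<Longrightarrow> j \<in> I \<Longrightarrow> i \<noteq> j \<Longrightarrow> \<pi> i \<star> \<iota> j = zr (A j) (A i)"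
    "(\<Oplus>\<^bsub>Hom C D D\<^esub>i\<in>I. \<iota> i \<star> \<pi> i) = Id C D"
  using assms by (auto simp: biprod_def)

lemma direct_sum_biprod:
  assumes "direct_sum C As D"
  obtains \<iota> \<pi> where "biprod {..<length As} ((!) As) D \<iota> \<pi>"
proof -
  obtain \<iota> \<pi> where "\<forall>j < length As. \<iota> j \<in> mor (As ! j) D \<and> \<pi> j \<in> mor D (As ! j)"
    "\<forall>j < length As. \<forall>l < length As. \<pi> j \<star> \<iota> l = (if j = l then Id C (As ! j) else zr (As ! l) (As ! j))"
    "(\<Oplus>\<^bsub>Hom C D D\<^esub>j \<in> {..<length As}. \<iota> j \<star> \<pi> j) = Id C D" "set As \<subseteq> Ob C" "D \<in> Ob C"
    using assms unfolding direct_sum_def by blast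
  then have "biprod {..<length As} ((!) As) D \<iota> \<pi>" by (auto simp: biprod_def)
  then show ?thesis by (rule that)
qed

lemma biprod_exists:
  assumes "has_finite_direct_sums C" "finite I" "\<And>i. i \<in> I \<Longrightarrow> A i \<in> Ob C"
  obtains D \<iota> \<pi> As where "biprod I A D \<iota> \<pi>" "direct_sum C As D" "set As = A ` I"
proof -
  obtain js where js: "set js = I" "distinct js" using finite_distinct_list[OF assms(2)] by blast
  let ?n = "length js"
  obtain D where D: "direct_sum C (map A js) D"
    using assms(1,3) js unfolding has_finite_direct_sums_def by (metis image_subset_iff set_map)
  obtain \<iota> \<pi> where b: "biprod {..<length (map A js)} ((!) (map A js)) D \<iota> \<pi>"
    using direct_sum_biprod[OF D] by metis
  define k where "k i = (THE j. j < ?n \<and> js ! j = i)" for i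
  have k: "k (js ! j) = j" if "j < ?n" for j
    unfolding k_def using that js(2) by (auto simp: nth_eq_iff_index_eq intro!: the_equality)
  have ki: "k i < ?n" "js ! k i = i" if "i \<in> I" for i
    using that k js(1) by (metis in_set_conv_nth)+
  interpret DD: abelian_group "Hom C D D" using Hom_abelian_group biprodD(2)[OF b] by blast
  have img: "(!) js ` {..<?n} = I" using js(1) by (auto simp: set_conv_nth)
  have comp: "\<iota> j \<star> \<pi> j \<in> mor D D" if "j < ?n" for j
    using cmp_closed[OF biprodD(5)[OF b] biprodD(4)[OF b] biprodD(2)[OF b] biprodD(3)[OF b] biprodD(2)[OF b]] that
    by simp
  have "(\<Oplus>\<^bsub>Hom C D D\<^esub>i\<in>(!) js ` {..<?n}. \<iota> (k i) \<star> \<pi> (k i)) = (\<Oplus>\<^bsub>Hom C D D\<^esub>j\<in>{..<?n}. \<iota> (k (js ! j)) \<star> \<pi> (k (js ! j)))"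
    using js(2) k comp by (intro DD.finsum_reindex) (auto simp: inj_on_def nth_eq_iff_index_eq)
  also have "\<dots> = (\<Oplus>\<^bsub>Hom C D D\<^esub>j\<in>{..<?n}. \<iota> j \<star> \<pi> j)"
    by (rule finsum_cong_mor) (use k comp biprodD(2)[OF b] in auto)
  finally have sum: "(\<Oplus>\<^bsub>Hom C D D\<^esub>i\<in>I. \<iota> (k i) \<star> \<pi> (k i)) = Id C D"
    using biprodD(8)[OF b] img by simp
  have kinj: "k i = k j \<longleftrightarrow> i = j" if "i \<in> I" "j \<in> I" for i j using ki that by metis
  have "biprod I A D (\<lambda>i. \<iota> (k i)) (\<lambda>i. \<pi> (k i))"
    unfolding biprod_def
  proof (intro conjI ballI)
    show "finite I" "D \<in> Ob C" using assms biprodD(2)[OF b] by auto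
    show "(\<Oplus>\<^bsub>Hom C D D\<^esub>i\<in>I. \<iota> (k i) \<star> \<pi> (k i)) = Id C D" by (rule sum)
    fix i assume i: "i \<in> I"
    show "A i \<in> Ob C" "\<iota> (k i) \<in> mor (A i) D" "\<pi> (k i) \<in> mor D (A i)"
      using biprodD(3-5)[OF b, of "k i"] ki[OF i] by auto
    fix j assume j: "j \<in> I"
    show "\<pi> (k i) \<star> \<iota> (k j) = (if i = j then Id C (A i) else zr (A j) (A i))"
      using biprodD(6)[OF b, of "k i"] biprodD(7)[OF b, of "k i" "k j"] ki[OF i] ki[OF j] kinj[OF i j] by auto
  qed
  then show ?thesis using that[OF _ D] js by simp
qed

lemma biprod_expand:
  assumes b: "biprod I A D \<iota> \<pi>" and O: "T \<in> Ob C" "U \<in> Ob C" and r: "r \<in> mor T D" and s: "s \<in> mor D U"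
  shows "s \<star> r = (\<Oplus>\<^bsub>Hom C T U\<^esub>i\<in>I. (s \<star> \<iota> i) \<star> (\<pi> i \<star> r))"
proof -
  note d = biprodD[OF b]
  have ip: "\<iota> i \<star> \<pi> i \<in> mor D D" if "i \<in> I" for i
    using cmp_closed[OF d(5)[OF that] d(4)[OF that] d(2) d(3)[OF that] d(2)] .
  have sip: "s \<star> (\<iota> i \<star> \<pi> i) \<in> mor D U" if "i \<in> I" for i
    using cmp_closed[OF ip[OF that] s d(2) d(2) O(2)] .
  have "s = s \<star> Id C D" using s d(2) O by (simp add: Comp_Id)
  also have "\<dots> = (\<Oplus>\<^bsub>Hom C D U\<^esub>i\<in>I. s \<star> (\<iota> i \<star> \<pi> i))"
    unfolding d(8)[symmetric] by (rule cmp_finsum_right[OF d(2) d(2) O(2) d(1) ip s])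
  finally have "s \<star> r = (\<Oplus>\<^bsub>Hom C D U\<^esub>i\<in>I. s \<star> (\<iota> i \<star> \<pi> i)) \<star> r" by simp
  also have "\<dots> = (\<Oplus>\<^bsub>Hom C T U\<^esub>i\<in>I. (s \<star> (\<iota> i \<star> \<pi> i)) \<star> r)"
    by (rule cmp_finsum_left[OF O(1) d(2) O(2) d(1) sip r])
  also have "\<dots> = (\<Oplus>\<^bsub>Hom C T U\<^esub>i\<in>I. (s \<star> \<iota> i) \<star> (\<pi> i \<star> r))"
  proof (rule finsum_cong_mor[OF O])
    fix i assume i: "i \<in> I"
    have si: "s \<star> \<iota> i \<in> mor (A i) U" using cmp_closed[OF d(4)[OF i] s d(3)[OF i] d(2) O(2)] .
    have pr: "\<pi> i \<star> r \<in> mor T (A i)" using cmp_closed[OF r d(5)[OF i] O(1) d(2) d(3)[OF i]] .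
    show "(s \<star> \<iota> i) \<star> (\<pi> i \<star> r) \<in> mor T U" using cmp_closed[OF pr si O(1) d(3)[OF i] O(2)] .
    have "s \<star> (\<iota> i \<star> \<pi> i) = (s \<star> \<iota> i) \<star> \<pi> i"
      by (rule Comp_assoc[OF d(2) d(3)[OF i] d(2) O(2) d(5)[OF i] d(4)[OF i] s, symmetric])
    then show "(s \<star> (\<iota> i \<star> \<pi> i)) \<star> r = (s \<star> \<iota> i) \<star> (\<pi> i \<star> r)"
      using Comp_assoc[OF O(1) d(2) d(3)[OF i] O(2) r d(5)[OF i] si] by simp
  qed
  finally show ?thesis .
qed

lemma biprod_expand_left:
  assumes b: "biprod I A D \<iota> \<pi>" and "U \<in> Ob C" "s \<in> mor D U"
  shows "s = (\<Oplus>\<^bsub>Hom C D U\<^esub>i\<in>I. (s \<star> \<iota> i) \<star> \<pi> i)"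
proof -
  note d = biprodD[OF b]
  have "s = s \<star> Id C D" using assms d(2) by (simp add: Comp_Id)
  also have "\<dots> = (\<Oplus>\<^bsub>Hom C D U\<^esub>i\<in>I. (s \<star> \<iota> i) \<star> (\<pi> i \<star> Id C D))"
    by (rule biprod_expand[OF b d(2) assms(2) Id_closed[OF d(2)] assms(3)])
  also have "\<dots> = (\<Oplus>\<^bsub>Hom C D U\<^esub>i\<in>I. (s \<star> \<iota> i) \<star> \<pi> i)"
  proof (rule finsum_cong_mor[OF d(2) assms(2)])
    fix i assume i: "i \<in> I"
    have "s \<star> \<iota> i \<in> mor (A i) U" using cmp_closed[OF d(4)[OF i] assms(3) d(3)[OF i] d(2) assms(2)] .
    then show "(s \<star> \<iota> i) \<star> \<pi> i \<in> mor D U" using cmp_closed[OF d(5)[OF i] _ d(2) d(3)[OF i] assms(2)] by blast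
    show "(s \<star> \<iota> i) \<star> (\<pi> i \<star> Id C D) = (s \<star> \<iota> i) \<star> \<pi> i"
      using Comp_Id[OF d(2) d(3)[OF i] d(5)[OF i]] by simp
  qed
  finally show ?thesis .
qed

lemma biprod_expand_right:
  assumes b: "biprod I A D \<iota> \<pi>" and "T \<in> Ob C" "r \<in> mor T D"
  shows "r = (\<Oplus>\<^bsub>Hom C T D\<^esub>i\<in>I. \<iota> i \<star> (\<pi> i \<star> r))"
proof -
  note d = biprodD[OF b]
  have "r = Id C D \<star> r" using assms d(2) by (simp add: Id_Comp)
  also have "\<dots> = (\<Oplus>\<^bsub>Hom C T D\<^esub>i\<in>I. (Id C D \<star> \<iota> i) \<star> (\<pi> i \<star> r))"
    by (rule biprod_expand[OF b assms(2) d(2) assms(3) Id_closed[OF d(2)]])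
  also have "\<dots> = (\<Oplus>\<^bsub>Hom C T D\<^esub>i\<in>I. \<iota> i \<star> (\<pi> i \<star> r))"
  proof (rule finsum_cong_mor[OF assms(2) d(2)])
    fix i assume i: "i \<in> I"
    have "\<pi> i \<star> r \<in> mor T (A i)" using cmp_closed[OF assms(3) d(5)[OF i] assms(2) d(2) d(3)[OF i]] .
    then show "\<iota> i \<star> (\<pi> i \<star> r) \<in> mor T D" using cmp_closed[OF _ d(4)[OF i] assms(2) d(3)[OF i] d(2)] by blast
    show "(Id C D \<star> \<iota> i) \<star> (\<pi> i \<star> r) = \<iota> i \<star> (\<pi> i \<star> r)"
      using Id_Comp[OF d(3)[OF i] d(2) d(4)[OF i]] by simp
  qed
  finally show ?thesis .
qed

lemma biprod_mor_zero:
  assumes b: "biprod I A D \<iota> \<pi>" and U: "U \<in> Ob C"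
  shows "(\<And>i. i \<in> I \<Longrightarrow> mor (A i) U = {zr (A i) U}) \<Longrightarrow> mor D U = {zr D U}"
    "(\<And>i. i \<in> I \<Longrightarrow> mor U (A i) = {zr U (A i)}) \<Longrightarrow> mor U D = {zr U D}"
proof -
  note d = biprodD[OF b]
  show "mor D U = {zr D U}" if z: "\<And>i. i \<in> I \<Longrightarrow> mor (A i) U = {zr (A i) U}"
  proof -
    have "s = zr D U" if s: "s \<in> mor D U" for s
    proof -
      have "(s \<star> \<iota> i) \<star> \<pi> i = zr D U" if i: "i \<in> I" for i
      proof -
        have "s \<star> \<iota> i \<in> mor (A i) U" using cmp_closed[OF d(4)[OF i] s d(3)[OF i] d(2) U] .
        then have "s \<star> \<iota> i = zr (A i) U" using z[OF i] by blast
        then show ?thesis using cmp_zr(2)[OF d(2) d(3)[OF i] U d(5)[OF i]] by simp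
      qed
      then have "(\<Oplus>\<^bsub>Hom C D U\<^esub>i\<in>I. (s \<star> \<iota> i) \<star> \<pi> i) = zr D U" by (rule finsum_zr[OF d(2) U])
      then show ?thesis using biprod_expand_left[OF b U s] by simp
    qed
    then show ?thesis using zr_closed[OF d(2) U] by blast
  qed
  show "mor U D = {zr U D}" if z: "\<And>i. i \<in> I \<Longrightarrow> mor U (A i) = {zr U (A i)}"
  proof -
    have "s = zr U D" if s: "s \<in> mor U D" for s
    proof -
      have "\<iota> i \<star> (\<pi> i \<star> s) = zr U D" if i: "i \<in> I" for i
      proof -
        have "\<pi> i \<star> s \<in> mor U (A i)" using cmp_closed[OF s d(5)[OF i] U d(2) d(3)[OF i]] .
        then have "\<pi> i \<star> s = zr U (A i)" using z[OF i] by blast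
        then show ?thesis using cmp_zr(1)[OF U d(3)[OF i] d(2) d(4)[OF i]] by simp
      qed
      then have "(\<Oplus>\<^bsub>Hom C U D\<^esub>i\<in>I. \<iota> i \<star> (\<pi> i \<star> s)) = zr U D" by (rule finsum_zr[OF U d(2)])
      then show ?thesis using biprod_expand_right[OF b U s] by simp
    qed
    then show ?thesis using zr_closed[OF U d(2)] by blast
  qed
qed

lemma finsum_single:
  assumes "T \<in> Ob C" "U \<in> Ob C" "finite I" "j \<in> I" "g j \<in> mor T U" "\<And>i. i \<in> I \<Longrightarrow> i \<noteq> j \<Longrightarrow> g i = zr T U"
  shows "(\<Oplus>\<^bsub>Hom C T U\<^esub>i\<in>I. g i) = g j"
proof -
  interpret TU: abelian_group "Hom C T U" by (rule Hom_abelian_group) fact+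
  have gm: "g i \<in> mor T U" if "i \<in> I" for i using assms that by (cases "i = j") auto
  have "(\<Oplus>\<^bsub>Hom C T U\<^esub>i\<in>insert j (I - {j}). g i) = g j \<oplus>\<^bsub>Hom C T U\<^esub> (\<Oplus>\<^bsub>Hom C T U\<^esub>i\<in>I - {j}. g i)"
    using assms gm by (intro TU.finsum_insert) auto
  moreover have "(\<Oplus>\<^bsub>Hom C T U\<^esub>i\<in>I - {j}. g i) = zr T U"
    using assms by (intro finsum_zr) auto
  ultimately show ?thesis using assms by (simp add: insert_absorb)
qed

lemma biprod_out:
  assumes b: "biprod I A D \<iota> \<pi>" and t: "t \<in> Ob C" and f: "\<And>i. i \<in> I \<Longrightarrow> f i \<in> mor (A i) t"
  shows "(\<Oplus>\<^bsub>Hom C D t\<^esub>i\<in>I. f i \<star> \<pi> i) \<in> mor D t"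
    "j \<in> I \<Longrightarrow> (\<Oplus>\<^bsub>Hom C D t\<^esub>i\<in>I. f i \<star> \<pi> i) \<star> \<iota> j = f j"
proof -
  note d = biprodD[OF b]
  have fp: "f i \<star> \<pi> i \<in> mor D t" if "i \<in> I" for i
    using cmp_closed[OF d(5)[OF that] f[OF that] d(2) d(3)[OF that] t] .
  show "(\<Oplus>\<^bsub>Hom C D t\<^esub>i\<in>I. f i \<star> \<pi> i) \<in> mor D t" by (rule finsum_mor_closed[OF d(2) t fp])
  assume j: "j \<in> I"
  have "(\<Oplus>\<^bsub>Hom C D t\<^esub>i\<in>I. f i \<star> \<pi> i) \<star> \<iota> j = (\<Oplus>\<^bsub>Hom C (A j) t\<^esub>i\<in>I. (f i \<star> \<pi> i) \<star> \<iota> j)"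
    by (rule cmp_finsum_left[OF d(3)[OF j] d(2) t d(1) fp d(4)[OF j]])
  also have "\<dots> = (f j \<star> \<pi> j) \<star> \<iota> j"
  proof (rule finsum_single[OF d(3)[OF j] t d(1) j])
    show "(f j \<star> \<pi> j) \<star> \<iota> j \<in> mor (A j) t" using cmp_closed[OF d(4)[OF j] fp[OF j] d(3)[OF j] d(2) t] .
    fix i assume i: "i \<in> I" "i \<noteq> j"
    have "(f i \<star> \<pi> i) \<star> \<iota> j = f i \<star> (\<pi> i \<star> \<iota> j)"
      by (rule Comp_assoc[OF d(3)[OF j] d(2) d(3)[OF i(1)] t d(4)[OF j] d(5)[OF i(1)] f[OF i(1)]])
    then show "(f i \<star> \<pi> i) \<star> \<iota> j = zr (A j) t"
      using d(7)[OF i(1) j i(2)] cmp_zr(1)[OF d(3)[OF j] d(3)[OF i(1)] t f[OF i(1)]] by simp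
  qed
  also have "\<dots> = f j \<star> (\<pi> j \<star> \<iota> j)"
    by (rule Comp_assoc[OF d(3)[OF j] d(2) d(3)[OF j] t d(4)[OF j] d(5)[OF j] f[OF j]])
  also have "\<dots> = f j" using d(6)[OF j] Comp_Id[OF d(3)[OF j] t f[OF j]] by simp
  finally show "(\<Oplus>\<^bsub>Hom C D t\<^esub>i\<in>I. f i \<star> \<pi> i) \<star> \<iota> j = f j" .
qed

lemma biprod_factor:
  assumes b: "biprod I A D \<iota> \<pi>" and O: "t \<in> Ob C" "T \<in> Ob C" and F: "F \<in> mor D t"
    and c: "\<And>i. i \<in> I \<Longrightarrow> c i \<in> mor T (A i)"
  shows "(\<Oplus>\<^bsub>Hom C T D\<^esub>i\<in>I. \<iota> i \<star> c i) \<in> mor T D"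
    "F \<star> (\<Oplus>\<^bsub>Hom C T D\<^esub>i\<in>I. \<iota> i \<star> c i) = (\<Oplus>\<^bsub>Hom C T t\<^esub>i\<in>I. (F \<star> \<iota> i) \<star> c i)"
proof -
  note d = biprodD[OF b]
  have ic: "\<iota> i \<star> c i \<in> mor T D" if "i \<in> I" for i
    using cmp_closed[OF c[OF that] d(4)[OF that] O(2) d(3)[OF that] d(2)] .
  show "(\<Oplus>\<^bsub>Hom C T D\<^esub>i\<in>I. \<iota> i \<star> c i) \<in> mor T D" by (rule finsum_mor_closed[OF O(2) d(2) ic])
  have "F \<star> (\<Oplus>\<^bsub>Hom C T D\<^esub>i\<in>I. \<iota> i \<star> c i) = (\<Oplus>\<^bsub>Hom C T t\<^esub>i\<in>I. F \<star> (\<iota> i \<star> c i))"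
    by (rule cmp_finsum_right[OF O(2) d(2) O(1) d(1) ic F])
  also have "\<dots> = (\<Oplus>\<^bsub>Hom C T t\<^esub>i\<in>I. (F \<star> \<iota> i) \<star> c i)"
  proof (rule finsum_cong_mor[OF O(2,1)])
    fix i assume i: "i \<in> I"
    have "F \<star> \<iota> i \<in> mor (A i) t" using cmp_closed[OF d(4)[OF i] F d(3)[OF i] d(2) O(1)] .
    then show "(F \<star> \<iota> i) \<star> c i \<in> mor T t" using cmp_closed[OF c[OF i] _ O(2) d(3)[OF i] O(1)] by blast
    show "F \<star> (\<iota> i \<star> c i) = (F \<star> \<iota> i) \<star> c i"
      by (rule Comp_assoc[OF O(2) d(3)[OF i] d(2) O(1) c[OF i] d(4)[OF i] F, symmetric])
  qed
  finally show "F \<star> (\<Oplus>\<^bsub>Hom C T D\<^esub>i\<in>I. \<iota> i \<star> c i) = (\<Oplus>\<^bsub>Hom C T t\<^esub>i\<in>I. (F \<star> \<iota> i) \<star> c i)" .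
qed

lemma biprod_transport:
  assumes b: "biprod I A D \<iota> \<pi>" and iso: "\<And>i. i \<in> I \<Longrightarrow> isomorphic C (A i) (B i)"
  obtains \<iota>' \<pi>' where "biprod I B D \<iota>' \<pi>'"
proof -
  note d = biprodD[OF b]
  have BO: "B i \<in> Ob C" if "i \<in> I" for i using iso[OF that] by (simp add: isomorphic_def)
  have "\<forall>i. \<exists>p q. i \<in> I \<longrightarrow> p \<in> mor (A i) (B i) \<and> q \<in> mor (B i) (A i) \<and> q \<star> p = Id C (A i) \<and> p \<star> q = Id C (B i)"
    using iso unfolding isomorphic_def isomorphism_def by blast
  then obtain p q where pq: "\<And>i. i \<in> I \<Longrightarrow> p i \<in> mor (A i) (B i)" "\<And>i. i \<in> I \<Longrightarrow> q i \<in> mor (B i) (A i)"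
    "\<And>i. i \<in> I \<Longrightarrow> q i \<star> p i = Id C (A i)" "\<And>i. i \<in> I \<Longrightarrow> p i \<star> q i = Id C (B i)"
    by metis
  have c1: "\<iota> i \<star> q i \<in> mor (B i) D" if i: "i \<in> I" for i
    using cmp_closed[OF pq(2)[OF i] d(4)[OF i] BO[OF i] d(3)[OF i] d(2)] .
  have c2: "p i \<star> \<pi> i \<in> mor D (B i)" if i: "i \<in> I" for i
    using cmp_closed[OF d(5)[OF i] pq(1)[OF i] d(2) d(3)[OF i] BO[OF i]] .
  have orth: "(p i \<star> \<pi> i) \<star> (\<iota> j \<star> q j) = p i \<star> ((\<pi> i \<star> \<iota> j) \<star> q j)" if i: "i \<in> I" "j \<in> I" for i j
  proof -
    have "(p i \<star> \<pi> i) \<star> (\<iota> j \<star> q j) = p i \<star> (\<pi> i \<star> (\<iota> j \<star> q j))"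
      by (rule Comp_assoc[OF BO[OF i(2)] d(2) d(3)[OF i(1)] BO[OF i(1)] c1[OF i(2)] d(5)[OF i(1)] pq(1)[OF i(1)]])
    also have "\<pi> i \<star> (\<iota> j \<star> q j) = (\<pi> i \<star> \<iota> j) \<star> q j"
      by (rule Comp_assoc[OF BO[OF i(2)] d(3)[OF i(2)] d(2) d(3)[OF i(1)] pq(2)[OF i(2)] d(4)[OF i(2)] d(5)[OF i(1)], symmetric])
    finally show ?thesis .
  qed
  have ip: "(\<iota> i \<star> q i) \<star> (p i \<star> \<pi> i) = \<iota> i \<star> \<pi> i" if i: "i \<in> I" for i
  proof -
    have "(\<iota> i \<star> q i) \<star> (p i \<star> \<pi> i) = \<iota> i \<star> (q i \<star> (p i \<star> \<pi> i))"
      by (rule Comp_assoc[OF d(2) BO[OF i] d(3)[OF i] d(2) c2[OF i] pq(2)[OF i] d(4)[OF i]])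
    also have "q i \<star> (p i \<star> \<pi> i) = (q i \<star> p i) \<star> \<pi> i"
      by (rule Comp_assoc[OF d(2) d(3)[OF i] BO[OF i] d(3)[OF i] d(5)[OF i] pq(1)[OF i] pq(2)[OF i], symmetric])
    finally show ?thesis using pq(3)[OF i] Id_Comp[OF d(2) d(3)[OF i] d(5)[OF i]] by simp
  qed
  have "biprod I B D (\<lambda>i. \<iota> i \<star> q i) (\<lambda>i. p i \<star> \<pi> i)"
    unfolding biprod_def
  proof (intro conjI ballI)
    show "finite I" "D \<in> Ob C" by (rule d)+
    have "(\<Oplus>\<^bsub>Hom C D D\<^esub>i\<in>I. (\<iota> i \<star> q i) \<star> (p i \<star> \<pi> i)) = (\<Oplus>\<^bsub>Hom C D D\<^esub>i\<in>I. \<iota> i \<star> \<pi> i)"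
      by (rule finsum_cong_mor[OF d(2) d(2)]) (use ip cmp_closed[OF d(5) d(4) d(2) d(3) d(2)] in auto)
    then show "(\<Oplus>\<^bsub>Hom C D D\<^esub>i\<in>I. (\<iota> i \<star> q i) \<star> (p i \<star> \<pi> i)) = Id C D" using d(8) by simp
    fix i assume i: "i \<in> I"
    show "B i \<in> Ob C" "\<iota> i \<star> q i \<in> mor (B i) D" "p i \<star> \<pi> i \<in> mor D (B i)" using BO c1 c2 i by auto
    fix j assume j: "j \<in> I"
    show "(p i \<star> \<pi> i) \<star> (\<iota> j \<star> q j) = (if i = j then Id C (B i) else zr (B j) (B i))"
      unfolding orth[OF i j]
      using d(6)[OF i] d(7)[OF i j] Id_Comp[OF BO[OF i] d(3)[OF i] pq(2)[OF i]] pq(4)[OF i]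
        cmp_zr(2)[OF BO[OF j] d(3)[OF j] d(3)[OF i] pq(2)[OF j]] cmp_zr(1)[OF BO[OF j] d(3)[OF i] BO[OF i] pq(1)[OF i]]
      by auto
  qed
  then show ?thesis by (rule that)
qed

text \<open>
  The projection to a direct summand is an idempotent endomorphism, hence \<open>0\<close> or the identity.
\<close>

lemma local_indecomposable:
  assumes A: "local_endomorphism_ring C A" shows "indecomposable C A"
proof -
  have AO: "A \<in> Ob C" "Id C A \<noteq> zr A A" using local_nonzero[OF A] by auto
  have "zero_object C B \<or> zero_object C D" if ds: "direct_sum C [B, D] A" for B D
  proof -
    obtain \<iota> \<pi> where b: "biprod {..<length [B, D]} ((!) [B, D]) A \<iota> \<pi>" using direct_sum_biprod[OF ds] by metis
    note d = biprodD[OF b]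
    have BO: "B \<in> Ob C" and DO: "D \<in> Ob C" using d(3)[of 0] d(3)[of 1] by auto
    have m: "\<iota> 0 \<in> mor B A" "\<pi> 0 \<in> mor A B" "\<iota> 1 \<in> mor D A" "\<pi> 1 \<in> mor A D" "\<pi> 0 \<star> \<iota> 0 = Id C B"
      "\<pi> 1 \<star> \<iota> 1 = Id C D" "\<pi> 0 \<star> \<iota> 1 = zr D B"
      using d(4)[of 0] d(5)[of 0] d(4)[of 1] d(5)[of 1] d(6)[of 0] d(6)[of 1] d(7)[of 0 1] by auto
    define e where "e = \<iota> 0 \<star> \<pi> 0"
    have e: "e \<in> mor A A" using m BO AO by (simp add: e_def)
    have pe: "\<pi> 0 \<star> e = \<pi> 0"
      using Comp_assoc[OF AO(1) BO AO(1) BO m(2) m(1) m(2)] m(5) Id_Comp[OF AO(1) BO m(2)] by (simp add: e_def)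
    have "e \<star> e = \<iota> 0 \<star> (\<pi> 0 \<star> e)"
      using Comp_assoc[OF AO(1) AO(1) BO AO(1) e m(2) m(1)] by (simp add: e_def)
    then have "e \<star> e = e" using pe by (simp add: e_def)
    then consider "e = Id C A" | "e = zr A A" using local_idempotent[OF A e] by blast
    then show ?thesis
    proof cases
      case 1
      have "\<iota> 1 = e \<star> \<iota> 1" using 1 Id_Comp[OF DO AO(1) m(3)] by simp
      also have "\<dots> = \<iota> 0 \<star> (\<pi> 0 \<star> \<iota> 1)" unfolding e_def by (rule Comp_assoc[OF DO AO(1) BO AO(1) m(3) m(2) m(1)])
      also have "\<dots> = zr D A" using m(7) cmp_zr(1)[OF DO BO AO(1) m(1)] by simp
      finally have "Id C D = zr D D" using m(6) cmp_zr(1)[OF DO AO(1) DO m(4)] by simp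
      then show ?thesis using DO by (simp add: zero_object_def)
    next
      case 2
      then have "\<pi> 0 = zr A B" using pe cmp_zr(1)[OF AO(1) AO(1) BO m(2)] by simp
      then have "Id C B = zr B B" using m(5) cmp_zr(2)[OF BO AO(1) BO m(1)] by simp
      then show ?thesis using BO by (simp add: zero_object_def)
    qed
  qed
  then show ?thesis using AO unfolding indecomposable_def zero_object_def by blast
qed

lemma zero_object_exists:
  assumes "has_finite_direct_sums C" obtains P where "zero_object C P"
proof -
  obtain P where ds: "direct_sum C [] P" using assms unfolding has_finite_direct_sums_def by force
  obtain \<iota> \<pi> where b: "biprod {..<length ([] :: 'o list)} ((!) []) P \<iota> \<pi>" using direct_sum_biprod[OF ds] by metis
  note d = biprodD[OF b]
  interpret PP: abelian_group "Hom C P P" by (rule Hom_abelian_group) (rule d)+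
  have "zero_object C P" using d(2,8) by (simp add: zero_object_def lessThan_0)
  then show ?thesis by (rule that)
qed

lemma add_closureI:
  assumes "has_finite_direct_sums C" "direct_sum C As A" "set As \<subseteq> S"
  shows "A \<in> add_closure C S"
proof -
  obtain Z where Z: "zero_object C Z" using zero_object_exists[OF assms(1)] by metis
  have AO: "A \<in> Ob C" using assms(2) by (simp add: direct_sum_def)
  have ZO: "Z \<in> Ob C" using Z by (simp add: zero_object_def)
  interpret AA: abelian_group "Hom C A A" by (rule Hom_abelian_group[OF AO AO])
  define \<iota> where "\<iota> j = (if j = (0::nat) then Id C A else zr Z A)" for j
  define \<pi> where "\<pi> j = (if j = (0::nat) then Id C A else zr A Z)" for j
  note Ic = Id_closed[OF AO]
  have "{..<length [A, Z]} = {0, 1}" by auto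
  then have "(\<Oplus>\<^bsub>Hom C A A\<^esub>j \<in> {..<length [A, Z]}. \<iota> j \<star> \<pi> j) = Id C A"
    using Ic Id_Comp[OF AO AO Ic] cmp_zr(1)[OF AO ZO AO, of "zr Z A"] ZO AO
    by (simp add: AA.finsum_insert \<iota>_def \<pi>_def)
  moreover have "\<pi> j \<star> \<iota> l = (if j = l then Id C ([A, Z] ! j) else zr ([A, Z] ! l) ([A, Z] ! j))"
    if "j < 2" "l < 2" for j l
  proof -
    have "j = 0 \<or> j = 1" "l = 0 \<or> l = 1" using that by auto
    moreover have "zr A Z \<star> zr Z A = Id C Z" using Z cmp_zr(1)[OF ZO AO ZO, of "zr A Z"] AO ZO by (simp add: zero_object_def)
    ultimately show ?thesis
      using Id_Comp[OF AO AO Ic] Id_Comp[OF ZO AO zr_closed[OF ZO AO]] Comp_Id[OF AO ZO zr_closed[OF AO ZO]]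
      by (auto simp: \<iota>_def \<pi>_def)
  qed
  moreover have "\<forall>j < length [A, Z]. \<iota> j \<in> mor ([A, Z] ! j) A \<and> \<pi> j \<in> mor A ([A, Z] ! j)"
    using Ic AO ZO by (auto simp: \<iota>_def \<pi>_def nth_Cons')
  ultimately have "direct_sum C [A, Z] A"
    unfolding direct_sum_def using AO ZO by (intro conjI exI[of _ \<iota>] exI[of _ \<pi>]) auto
  then have "direct_summand C A A" unfolding direct_summand_def by blast
  then show ?thesis unfolding add_closure_def using isomorphic_refl[OF AO] assms by blast
qed

lemma direct_sum_single:
  assumes "A \<in> Ob C" shows "direct_sum C [A] A"
proof -
  interpret AA: abelian_group "Hom C A A" by (rule Hom_abelian_group[OF assms assms])
  have "{..<length [A]} = {0}" by auto
  then show ?thesis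
    unfolding direct_sum_def using assms Id_closed[OF assms] Id_Comp[OF assms assms Id_closed[OF assms]]
    by (intro conjI exI[of _ "\<lambda>_. Id C A"]) (auto simp: AA.finsum_insert)
qed

text \<open>
  Instead of the chain of isomorphism, summand and direct sum, only the resulting decomposition of the
  identity into morphisms that factor through objects of \<open>S\<close> is kept.
\<close>

lemma add_closureE:
  assumes "A \<in> add_closure C S"
  obtains n :: nat and B \<alpha> \<beta> where "A \<in> Ob C"
    "\<forall>j<n. B j \<in> S \<and> B j \<in> Ob C \<and> \<alpha> j \<in> mor A (B j) \<and> \<beta> j \<in> mor (B j) A"
    "(\<Oplus>\<^bsub>Hom C A A\<^esub>j\<in>{..<n}. \<beta> j \<star> \<alpha> j) = Id C A"
proof -
  obtain A' As D where h: "isomorphic C A A'" "direct_summand C A' D" "set As \<subseteq> S" "direct_sum C As D"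
    using assms unfolding add_closure_def by blast
  obtain B where "direct_sum C [A', B] D" using h(2) unfolding direct_summand_def by blast
  then obtain \<iota>' \<pi>' where b': "biprod {..<length [A', B]} ((!) [A', B]) D \<iota>' \<pi>'" using direct_sum_biprod by metis
  have i: "\<iota>' 0 \<in> mor A' D" "\<pi>' 0 \<in> mor D A'" "\<pi>' 0 \<star> \<iota>' 0 = Id C A'"
    using biprodD(4)[OF b', of 0] biprodD(5)[OF b', of 0] biprodD(6)[OF b', of 0] by auto
  have O: "A \<in> Ob C" "A' \<in> Ob C" "D \<in> Ob C" using h(1) biprodD(2)[OF b'] by (auto simp: isomorphic_def)
  obtain a a' where a: "a \<in> mor A A'" "a' \<in> mor A' A" "a' \<star> a = Id C A"
    using h(1) unfolding isomorphic_def isomorphism_def by blast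
  define r where "r = \<iota>' 0 \<star> a"
  define s where "s = a' \<star> \<pi>' 0"
  have r: "r \<in> mor A D" and s: "s \<in> mor D A" using a i O by (auto simp: r_def s_def)
  have "s \<star> r = a' \<star> (\<pi>' 0 \<star> r)" unfolding s_def by (rule Comp_assoc[OF O(1) O(3) O(2) O(1) r i(2) a(2)])
  also have "\<pi>' 0 \<star> r = (\<pi>' 0 \<star> \<iota>' 0) \<star> a"
    unfolding r_def by (rule Comp_assoc[OF O(1,2,3,2) a(1) i(1) i(2), symmetric])
  finally have sr: "s \<star> r = Id C A" using i(3) a Id_Comp[OF O(1,2) a(1)] by simp
  obtain \<iota> \<pi> where b: "biprod {..<length As} ((!) As) D \<iota> \<pi>" using direct_sum_biprod[OF h(4)] by metis
  note d = biprodD[OF b]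
  have "As ! j \<in> S" "As ! j \<in> Ob C" "\<pi> j \<star> r \<in> mor A (As ! j)" "s \<star> \<iota> j \<in> mor (As ! j) A"
    if "j < length As" for j
    using that h(3) d(3)[of j] cmp_closed[OF r d(5) O(1) O(3) d(3), of j] cmp_closed[OF d(4) s d(3) O(3) O(1), of j]
    by auto
  moreover have "(\<Oplus>\<^bsub>Hom C A A\<^esub>j\<in>{..<length As}. (s \<star> \<iota> j) \<star> (\<pi> j \<star> r)) = Id C A"
    using biprod_expand[OF b O(1) O(1) r s] sr by simp
  ultimately show ?thesis
    using that[of "length As" "(!) As" "\<lambda>j. \<pi> j \<star> r" "\<lambda>j. s \<star> \<iota> j"] O(1) by simp
qed

end

section \<open>Minimal approximations and the lemma of Wakamatsu\<close>

context linear_category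
begin

lemma finsum_minus:
  assumes "T \<in> Ob C" "U \<in> Ob C" "finite I" "\<And>i. i \<in> I \<Longrightarrow> g i \<in> mor T U"
  shows "(\<Oplus>\<^bsub>Hom C T U\<^esub>i\<in>I. \<ominus>\<^bsub>Hom C T U\<^esub> g i) = \<ominus>\<^bsub>Hom C T U\<^esub> (\<Oplus>\<^bsub>Hom C T U\<^esub>i\<in>I. g i)"
proof -
  interpret TU: abelian_group "Hom C T U" by (rule Hom_abelian_group) fact+
  have "(\<Oplus>\<^bsub>Hom C T U\<^esub>i\<in>I. \<ominus>\<^bsub>Hom C T U\<^esub> g i) \<oplus>\<^bsub>Hom C T U\<^esub> (\<Oplus>\<^bsub>Hom C T U\<^esub>i\<in>I. g i)
      = (\<Oplus>\<^bsub>Hom C T U\<^esub>i\<in>I. (\<ominus>\<^bsub>Hom C T U\<^esub> g i) \<oplus>\<^bsub>Hom C T U\<^esub> g i)"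
    using assms(4) by (intro TU.finsum_addf[symmetric]) auto
  also have "\<dots> = zr T U" using assms by (intro finsum_zr) (auto simp: TU.l_neg)
  finally show ?thesis
    using TU.minus_equality finsum_mor_closed[OF assms(1,2), of I g]
      finsum_mor_closed[OF assms(1,2), of I "\<lambda>i. \<ominus>\<^bsub>Hom C T U\<^esub> g i"] assms(4) by simp
qed

text \<open>
  The morphism from the direct sum of the \<open>A i\<close> to \<open>t\<close> with components \<open>f i\<close> is a right
  \<open>S\<close>-approximation, expressed before a direct sum is chosen.
\<close>

definition approximates :: "'o set \<Rightarrow> 'o \<Rightarrow> ('i \<Rightarrow> 'o) \<Rightarrow> ('i \<Rightarrow> 'm) \<Rightarrow> 'i set \<Rightarrow> bool" where
  "approximates S t A f I \<longleftrightarrow> (\<forall>B\<in>S. \<forall>g\<in>mor B t. \<exists>c. (\<forall>i\<in>I. c i \<in> mor B (A i)) \<and>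
     g = (\<Oplus>\<^bsub>Hom C B t\<^esub>i\<in>I. f i \<star> c i))"

lemma approximates_remove:
  assumes ap: "approximates S t A f I" and t: "t \<in> Ob C" and S: "S \<subseteq> Ob C" and fin: "finite I"
    and A: "\<And>i. i \<in> I \<Longrightarrow> A i \<in> Ob C" and f: "\<And>i. i \<in> I \<Longrightarrow> f i \<in> mor (A i) t"
    and j: "j \<in> I" and u: "\<And>i. i \<in> I - {j} \<Longrightarrow> u i \<in> mor (A j) (A i)"
    and fj: "f j = (\<Oplus>\<^bsub>Hom C (A j) t\<^esub>i\<in>I - {j}. f i \<star> u i)"
  shows "approximates S t A f (I - {j})"
  unfolding approximates_def
proof (intro ballI)
  fix B g assume B: "B \<in> S" and g: "g \<in> mor B t"
  have BO: "B \<in> Ob C" using B S by blast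
  interpret Bt: abelian_group "Hom C B t" by (rule Hom_abelian_group[OF BO t])
  let ?J = "I - {j}"
  obtain c where c: "\<And>i. i \<in> I \<Longrightarrow> c i \<in> mor B (A i)" "g = (\<Oplus>\<^bsub>Hom C B t\<^esub>i\<in>I. f i \<star> c i)"
    using ap B g unfolding approximates_def by metis
  have fc: "f i \<star> c i \<in> mor B t" if "i \<in> I" for i
    using cmp_closed[OF c(1)[OF that] f[OF that] BO A[OF that] t] .
  have "g = (\<Oplus>\<^bsub>Hom C B t\<^esub>i\<in>insert j ?J. f i \<star> c i)" using c(2) j by (simp add: insert_absorb)
  also have "\<dots> = f j \<star> c j \<oplus>\<^bsub>Hom C B t\<^esub> (\<Oplus>\<^bsub>Hom C B t\<^esub>i\<in>?J. f i \<star> c i)"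
    using fin fc j by (intro Bt.finsum_insert) auto
  also have "f j \<star> c j = (\<Oplus>\<^bsub>Hom C B t\<^esub>i\<in>?J. f i \<star> (u i \<star> c j))"
  proof -
    have fu: "f i \<star> u i \<in> mor (A j) t" if "i \<in> ?J" for i
      using cmp_closed[OF u[OF that] f A[OF j] A t] that by blast
    have "f j \<star> c j = (\<Oplus>\<^bsub>Hom C B t\<^esub>i\<in>?J. (f i \<star> u i) \<star> c j)"
      unfolding fj by (rule cmp_finsum_left[OF BO A[OF j] t _ fu c(1)[OF j]]) (use fin in auto)
    also have "\<dots> = (\<Oplus>\<^bsub>Hom C B t\<^esub>i\<in>?J. f i \<star> (u i \<star> c j))"
    proof (rule finsum_cong_mor[OF BO t])
      fix i assume i: "i \<in> ?J"
      then have iI: "i \<in> I" by blast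
      have "u i \<star> c j \<in> mor B (A i)" using cmp_closed[OF c(1)[OF j] u[OF i] BO A[OF j] A[OF iI]] .
      then show "f i \<star> (u i \<star> c j) \<in> mor B t" using cmp_closed[OF _ f[OF iI] BO A[OF iI] t] by blast
      show "(f i \<star> u i) \<star> c j = f i \<star> (u i \<star> c j)"
        by (rule Comp_assoc[OF BO A[OF j] A[OF iI] t c(1)[OF j] u[OF i] f[OF iI]])
    qed
    finally show ?thesis .
  qed
  also have "(\<Oplus>\<^bsub>Hom C B t\<^esub>i\<in>?J. f i \<star> (u i \<star> c j)) \<oplus>\<^bsub>Hom C B t\<^esub> (\<Oplus>\<^bsub>Hom C B t\<^esub>i\<in>?J. f i \<star> c i)
      = (\<Oplus>\<^bsub>Hom C B t\<^esub>i\<in>?J. f i \<star> (u i \<star> c j) \<oplus>\<^bsub>Hom C B t\<^esub> f i \<star> c i)"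
  proof (rule Bt.finsum_addf[symmetric])
    show "(\<lambda>i. f i \<star> (u i \<star> c j)) \<in> ?J \<rightarrow> mor B t"
      using cmp_closed[OF cmp_closed[OF c(1)[OF j] u BO A[OF j] A] f BO A t] by auto
    show "(\<lambda>i. f i \<star> c i) \<in> ?J \<rightarrow> mor B t" using fc by auto
  qed
  also have "\<dots> = (\<Oplus>\<^bsub>Hom C B t\<^esub>i\<in>?J. f i \<star> (u i \<star> c j \<oplus>\<^bsub>Hom C B (A i)\<^esub> c i))"
  proof (rule finsum_cong_mor[OF BO t])
    fix i assume i: "i \<in> ?J"
    then have iI: "i \<in> I" by blast
    interpret BA: abelian_group "Hom C B (A i)" by (rule Hom_abelian_group[OF BO A[OF iI]])
    have uc: "u i \<star> c j \<in> mor B (A i)" using cmp_closed[OF c(1)[OF j] u[OF i] BO A[OF j] A[OF iI]] .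
    show "f i \<star> (u i \<star> c j \<oplus>\<^bsub>Hom C B (A i)\<^esub> c i) \<in> mor B t"
      using cmp_closed[OF BA.a_closed[OF uc c(1)[OF iI]] f[OF iI] BO A[OF iI] t] .
    show "f i \<star> (u i \<star> c j) \<oplus>\<^bsub>Hom C B t\<^esub> f i \<star> c i = f i \<star> (u i \<star> c j \<oplus>\<^bsub>Hom C B (A i)\<^esub> c i)"
      by (rule Comp_add_right[OF BO A[OF iI] t uc c(1)[OF iI] f[OF iI], symmetric])
  qed
  finally have "g = (\<Oplus>\<^bsub>Hom C B t\<^esub>i\<in>?J. f i \<star> (u i \<star> c j \<oplus>\<^bsub>Hom C B (A i)\<^esub> c i))" .
  moreover have "u i \<star> c j \<oplus>\<^bsub>Hom C B (A i)\<^esub> c i \<in> mor B (A i)" if i: "i \<in> ?J" for i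
  proof -
    have iI: "i \<in> I" using i by blast
    interpret BA: abelian_group "Hom C B (A i)" by (rule Hom_abelian_group[OF BO A[OF iI]])
    show ?thesis
      using BA.a_closed[OF cmp_closed[OF c(1)[OF j] u[OF i] BO A[OF j] A[OF iI]] c(1)[OF iI]] .
  qed
  ultimately show "\<exists>c. (\<forall>i\<in>?J. c i \<in> mor B (A i)) \<and> g = (\<Oplus>\<^bsub>Hom C B t\<^esub>i\<in>?J. f i \<star> c i)"
    by (intro exI[of _ "\<lambda>i. u i \<star> c j \<oplus>\<^bsub>Hom C B (A i)\<^esub> c i"]) auto
qed

lemma biprod_rad:
  assumes b: "biprod I A D \<iota> \<pi>" and \<psi>: "\<psi> \<in> mor D D"
    and r: "\<And>i j. i \<in> I \<Longrightarrow> j \<in> I \<Longrightarrow> \<pi> i \<star> (\<psi> \<star> \<iota> j) \<in> rad (A j) (A i)"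
  shows "\<psi> \<in> rad D D"
proof -
  note d = biprodD[OF b]
  have psi_i: "\<psi> \<star> \<iota> j \<in> rad (A j) D" if j: "j \<in> I" for j
  proof -
    have m: "\<psi> \<star> \<iota> j \<in> mor (A j) D" using cmp_closed[OF d(4)[OF j] \<psi> d(3)[OF j] d(2) d(2)] .
    have "(\<Oplus>\<^bsub>Hom C (A j) D\<^esub>i\<in>I. \<iota> i \<star> (\<pi> i \<star> (\<psi> \<star> \<iota> j))) \<in> rad (A j) D"
      by (rule rad_finsum[OF d(3)[OF j] d(2) d(1)])
        (rule rad_cmp_left[OF d(3)[OF j] d(3) d(2) r[OF _ j] d(4)])
    then show ?thesis using biprod_expand_right[OF b d(3)[OF j] m] by simp
  qed
  have "(\<Oplus>\<^bsub>Hom C D D\<^esub>j\<in>I. (\<psi> \<star> \<iota> j) \<star> \<pi> j) \<in> rad D D"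
    by (rule rad_finsum[OF d(2) d(2) d(1)]) (rule rad_cmp_right[OF d(3) d(2) d(2) psi_i d(5)])
  then show ?thesis using biprod_expand_left[OF b d(2) \<psi>] by simp
qed

text \<open>
  Take an approximating subfamily with the least number of members.  If \<open>F \<phi> = F\<close>, then \<open>\<psi> = 1 - \<phi>\<close> is
  killed by \<open>F\<close>.  An invertible matrix entry of \<open>\<psi>\<close> would express one \<open>f i\<close> through the others, which is
  impossible; so all entries, hence \<open>\<psi>\<close> itself, lie in the radical, and \<open>\<phi> = 1 - \<psi>\<close> has a left inverse.
\<close>

lemma minimal_approximation:
  assumes sums: "has_finite_direct_sums C" and t: "t \<in> Ob C" and S: "S \<subseteq> Ob C" and fin: "finite I"
    and loc: "\<And>i. i \<in> I \<Longrightarrow> local_endomorphism_ring C (A i)" and f: "\<And>i. i \<in> I \<Longrightarrow> f i \<in> mor (A i) t"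
    and ap: "approximates S t A f I"
  obtains D F As where "direct_sum C As D" "set As \<subseteq> A ` I" "D \<in> Ob C" "F \<in> mor D t"
    "\<forall>B\<in>S. \<forall>g\<in>mor B t. \<exists>c\<in>mor B D. g = F \<star> c"
    "\<forall>\<phi>\<in>mor D D. F \<star> \<phi> = F \<longrightarrow> (\<exists>l\<in>mor D D. l \<star> \<phi> = Id C D)"
proof -
  have "\<exists>J. J \<subseteq> I \<and> approximates S t A f J \<and> (\<forall>J'. J' \<subseteq> I \<and> approximates S t A f J' \<longrightarrow> card J \<le> card J')"
    using ex_has_least_nat[of "\<lambda>J. J \<subseteq> I \<and> approximates S t A f J" I card] ap by blast
  then obtain J where J: "J \<subseteq> I" "approximates S t A f J"
    and least: "\<And>J'. J' \<subseteq> I \<Longrightarrow> approximates S t A f J' \<Longrightarrow> card J \<le> card J'" by blast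
  have finJ: "finite J" using J fin finite_subset by blast
  have AO: "A i \<in> Ob C" if "i \<in> J" for i using local_nonzero[OF loc] J that by blast
  have fJ: "f i \<in> mor (A i) t" if "i \<in> J" for i using f J that by blast
  obtain D \<iota> \<pi> As where b: "biprod J A D \<iota> \<pi>" and ds: "direct_sum C As D" and As: "set As = A ` J"
    by (rule biprod_exists[of J A, OF sums finJ AO])
  note d = biprodD[OF b]
  define F where "F = (\<Oplus>\<^bsub>Hom C D t\<^esub>i\<in>J. f i \<star> \<pi> i)"
  have F: "F \<in> mor D t" unfolding F_def by (rule biprod_out(1)[OF b t fJ])
  have Fi: "F \<star> \<iota> j = f j" if "j \<in> J" for j unfolding F_def by (rule biprod_out(2)[OF b t fJ that])
  show ?thesis
  proof (rule that[OF ds _ d(2) F])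
    show "set As \<subseteq> A ` I" using As J by blast
    show "\<forall>B\<in>S. \<forall>g\<in>mor B t. \<exists>c\<in>mor B D. g = F \<star> c"
    proof (intro ballI)
      fix B g assume B: "B \<in> S" and g: "g \<in> mor B t"
      have BO: "B \<in> Ob C" using B S by blast
      obtain c where c: "\<And>i. i \<in> J \<Longrightarrow> c i \<in> mor B (A i)" "g = (\<Oplus>\<^bsub>Hom C B t\<^esub>i\<in>J. f i \<star> c i)"
        using J(2) B g unfolding approximates_def by metis
      have "F \<star> (\<Oplus>\<^bsub>Hom C B D\<^esub>i\<in>J. \<iota> i \<star> c i) = (\<Oplus>\<^bsub>Hom C B t\<^esub>i\<in>J. (F \<star> \<iota> i) \<star> c i)"
        by (rule biprod_factor(2)[OF b t BO F c(1)])
      also have "\<dots> = g"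
        unfolding c(2) by (rule finsum_cong_mor[OF BO t]) (use cmp_closed[OF c(1) fJ BO AO t] Fi in auto)
      finally show "\<exists>c\<in>mor B D. g = F \<star> c" using biprod_factor(1)[OF b t BO F c(1)] by metis
    qed
    show "\<forall>\<phi>\<in>mor D D. F \<star> \<phi> = F \<longrightarrow> (\<exists>l\<in>mor D D. l \<star> \<phi> = Id C D)"
    proof (intro ballI impI)
      fix \<phi> assume \<phi>: "\<phi> \<in> mor D D" and Fphi: "F \<star> \<phi> = F"
      interpret DD: abelian_group "Hom C D D" by (rule Hom_abelian_group[OF d(2) d(2)])
      interpret Dt: abelian_group "Hom C D t" by (rule Hom_abelian_group[OF d(2) t])
      define \<psi> where "\<psi> = Id C D \<oplus>\<^bsub>Hom C D D\<^esub> (\<ominus>\<^bsub>Hom C D D\<^esub> \<phi>)"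
      note Ic = Id_closed[OF d(2)]
      have \<psi>: "\<psi> \<in> mor D D" using \<phi> Ic by (simp add: \<psi>_def)
      have Fpsi: "F \<star> \<psi> = zr D t"
        using Comp_add_right[OF d(2) d(2) t Ic DD.a_inv_closed[OF \<phi>] F] cmp_minus(1)[OF d(2) d(2) t \<phi> F] Fphi
          Comp_Id[OF d(2) t F] F by (simp add: \<psi>_def Dt.r_neg)
      have "\<pi> i \<star> (\<psi> \<star> \<iota> j) \<in> rad (A j) (A i)" if i: "i \<in> J" and j: "j \<in> J" for i j
      proof (rule nonisomorphism_in_rad)
        show "local_endomorphism_ring C (A j)" "local_endomorphism_ring C (A i)" using loc J i j by auto
        have pj: "\<psi> \<star> \<iota> j \<in> mor (A j) D" using cmp_closed[OF d(4)[OF j] \<psi> d(3)[OF j] d(2) d(2)] .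
        have m: "\<pi> k \<star> (\<psi> \<star> \<iota> j) \<in> mor (A j) (A k)" if "k \<in> J" for k
          using cmp_closed[OF pj d(5)[OF that] AO[OF j] d(2) AO[OF that]] .
        then show "\<pi> i \<star> (\<psi> \<star> \<iota> j) \<in> mor (A j) (A i)" using i by blast
        show "\<not> isomorphism C (A j) (A i) (\<pi> i \<star> (\<psi> \<star> \<iota> j))"
        proof
          assume "isomorphism C (A j) (A i) (\<pi> i \<star> (\<psi> \<star> \<iota> j))"
          then obtain \<theta> where \<theta>: "\<theta> \<in> mor (A i) (A j)" "(\<pi> i \<star> (\<psi> \<star> \<iota> j)) \<star> \<theta> = Id C (A i)"
            using isomorphismE by metis
          interpret At: abelian_group "Hom C (A i) t" by (rule Hom_abelian_group[OF AO[OF i] t])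
          \<comment> \<open>a column of \<open>\<psi>\<close>, normalised so that its entry at \<open>i\<close> is the identity\<close>
          define w where "w k = \<pi> k \<star> ((\<psi> \<star> \<iota> j) \<star> \<theta>)" for k
          have pc: "(\<psi> \<star> \<iota> j) \<star> \<theta> \<in> mor (A i) D" using cmp_closed[OF \<theta>(1) pj AO[OF i] AO[OF j] d(2)] .
          have w: "w k \<in> mor (A i) (A k)" if "k \<in> J" for k
            unfolding w_def using cmp_closed[OF pc d(5)[OF that] AO[OF i] d(2) AO[OF that]] .
          have wi: "w i = Id C (A i)"
            unfolding w_def using Comp_assoc[OF AO[OF i] AO[OF j] d(2) AO[OF i] \<theta>(1) pj d(5)[OF i]] \<theta>(2) by simp
          have fw: "f k \<star> w k \<in> mor (A i) t" if "k \<in> J" for k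
            using cmp_closed[OF w[OF that] fJ[OF that] AO[OF i] AO[OF that] t] .
          have "F \<star> ((\<psi> \<star> \<iota> j) \<star> \<theta>) = (F \<star> (\<psi> \<star> \<iota> j)) \<star> \<theta>"
            by (rule Comp_assoc[OF AO[OF i] AO[OF j] d(2) t \<theta>(1) pj F, symmetric])
          also have "F \<star> (\<psi> \<star> \<iota> j) = (F \<star> \<psi>) \<star> \<iota> j"
            by (rule Comp_assoc[OF AO[OF j] d(2) d(2) t d(4)[OF j] \<psi> F, symmetric])
          also have "\<dots> \<star> \<theta> = zr (A i) t"
            using Fpsi cmp_zr(2)[OF AO[OF j] d(2) t d(4)[OF j]] cmp_zr(2)[OF AO[OF i] AO[OF j] t \<theta>(1)] by simp
          finally have z: "F \<star> ((\<psi> \<star> \<iota> j) \<star> \<theta>) = zr (A i) t" .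
          have "F \<star> ((\<psi> \<star> \<iota> j) \<star> \<theta>) = (\<Oplus>\<^bsub>Hom C (A i) t\<^esub>k\<in>J. (F \<star> \<iota> k) \<star> w k)"
            unfolding w_def by (rule biprod_expand[OF b AO[OF i] t pc F])
          also have "\<dots> = (\<Oplus>\<^bsub>Hom C (A i) t\<^esub>k\<in>J. f k \<star> w k)"
            by (rule finsum_cong_mor[OF AO[OF i] t]) (use fw Fi in auto)
          also have "\<dots> = (\<Oplus>\<^bsub>Hom C (A i) t\<^esub>k\<in>insert i (J - {i}). f k \<star> w k)"
            using i by (simp add: insert_absorb)
          also have "\<dots> = f i \<star> w i \<oplus>\<^bsub>Hom C (A i) t\<^esub> (\<Oplus>\<^bsub>Hom C (A i) t\<^esub>k\<in>J - {i}. f k \<star> w k)"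
            using finJ fw i by (intro At.finsum_insert) auto
          finally have sum0: "f i \<oplus>\<^bsub>Hom C (A i) t\<^esub> (\<Oplus>\<^bsub>Hom C (A i) t\<^esub>k\<in>J - {i}. f k \<star> w k) = zr (A i) t"
            using z wi Comp_Id[OF AO[OF i] t fJ[OF i]] by simp
          have "(\<Oplus>\<^bsub>Hom C (A i) t\<^esub>k\<in>J - {i}. f k \<star> w k) \<in> mor (A i) t"
            by (rule finsum_mor_closed[OF AO[OF i] t]) (use fw in auto)
          with sum0 have "f i = \<ominus>\<^bsub>Hom C (A i) t\<^esub> (\<Oplus>\<^bsub>Hom C (A i) t\<^esub>k\<in>J - {i}. f k \<star> w k)"
            using At.minus_equality[OF sum0] fJ[OF i] by simp
          also have "\<dots> = (\<Oplus>\<^bsub>Hom C (A i) t\<^esub>k\<in>J - {i}. \<ominus>\<^bsub>Hom C (A i) t\<^esub> (f k \<star> w k))"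
            by (rule finsum_minus[OF AO[OF i] t, symmetric]) (use finJ fw in auto)
          also have "\<dots> = (\<Oplus>\<^bsub>Hom C (A i) t\<^esub>k\<in>J - {i}. f k \<star> (\<ominus>\<^bsub>Hom C (A i) (A k)\<^esub> w k))"
          proof (rule finsum_cong_mor[OF AO[OF i] t])
            fix k assume "k \<in> J - {i}"
            then have k: "k \<in> J" by blast
            show 1: "\<ominus>\<^bsub>Hom C (A i) t\<^esub> (f k \<star> w k) = f k \<star> (\<ominus>\<^bsub>Hom C (A i) (A k)\<^esub> w k)"
              by (rule cmp_minus(1)[OF AO[OF i] AO[OF k] t w[OF k] fJ[OF k], symmetric])
            show "f k \<star> (\<ominus>\<^bsub>Hom C (A i) (A k)\<^esub> w k) \<in> mor (A i) t"
              unfolding 1[symmetric] using fw[OF k] by simp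
          qed
          finally have "approximates S t A f (J - {i})"
            using abelian_group.a_inv_closed[OF Hom_abelian_group[OF AO[OF i] AO] w]
            by (intro approximates_remove[OF J(2) t S finJ AO fJ i, of "\<lambda>k. \<ominus>\<^bsub>Hom C (A i) (A k)\<^esub> w k"]) auto
          then have "card J \<le> card (J - {i})" using least J(1) by blast
          then show False using i finJ by (metis card_Diff1_less not_le)
        qed
      qed
      then have "\<psi> \<in> rad D D" by (rule biprod_rad[OF b \<psi>])
      then obtain l where l: "l \<in> mor D D" "l \<star> (Id C D \<oplus>\<^bsub>Hom C D D\<^esub> (\<ominus>\<^bsub>Hom C D D\<^esub> (Id C D \<star> \<psi>))) = Id C D"
        using Ic unfolding rad_def by blast
      have "Id C D \<oplus>\<^bsub>Hom C D D\<^esub> (\<ominus>\<^bsub>Hom C D D\<^esub> (Id C D \<star> \<psi>)) = \<phi>"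
        unfolding Id_Comp[OF d(2) d(2) \<psi>] unfolding \<psi>_def using \<phi> Ic
        by (simp add: DD.minus_add DD.a_assoc[symmetric] DD.r_neg)
      then show "\<exists>l\<in>mor D D. l \<star> \<phi> = Id C D" using l by auto
    qed
  qed
qed

end

context linear_triangulated_category
begin

abbreviation \<Sigma>o :: "'o \<Rightarrow> 'o" where "\<Sigma>o \<equiv> Susp C"
abbreviation \<Sigma>m :: "'m \<Rightarrow> 'm" where "\<Sigma>m \<equiv> SuspM C"

lemma Susp_mor:
  assumes "A \<in> Ob C" "B \<in> Ob C"
  shows "f \<in> mor A B \<Longrightarrow> \<Sigma>m f \<in> mor (\<Sigma>o A) (\<Sigma>o B)"
    "h \<in> mor (\<Sigma>o A) (\<Sigma>o B) \<Longrightarrow> \<exists>f\<in>mor A B. \<Sigma>m f = h"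
    "f \<in> mor A B \<Longrightarrow> f' \<in> mor A B \<Longrightarrow> \<Sigma>m f = \<Sigma>m f' \<Longrightarrow> f = f'"
    "f \<in> mor A B \<Longrightarrow> f' \<in> mor A B \<Longrightarrow> \<Sigma>m (f \<oplus>\<^bsub>Hom C A B\<^esub> f') = \<Sigma>m f \<oplus>\<^bsub>Hom C (\<Sigma>o A) (\<Sigma>o B)\<^esub> \<Sigma>m f'"
proof -
  interpret AB: abelian_group "Hom C A B" by (rule Hom_abelian_group[OF assms])
  have bij: "bij_betw (restrict \<Sigma>m (mor A B)) (mor A B) (mor (\<Sigma>o A) (\<Sigma>o B))"
    and add: "\<forall>x\<in>mor A B. \<forall>y\<in>mor A B. restrict \<Sigma>m (mor A B) (x \<oplus>\<^bsub>Hom C A B\<^esub> y) =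
       restrict \<Sigma>m (mor A B) x \<oplus>\<^bsub>Hom C (\<Sigma>o A) (\<Sigma>o B)\<^esub> restrict \<Sigma>m (mor A B) y"
    using Susp_linear_iso[OF assms] by (auto simp: linear_isos_def linear_maps_def)
  have bij': "bij_betw \<Sigma>m (mor A B) (mor (\<Sigma>o A) (\<Sigma>o B))"
    using bij by (rule bij_betw_cong[THEN iffD1, rotated]) auto
  show "\<Sigma>m f \<in> mor (\<Sigma>o A) (\<Sigma>o B)" if "f \<in> mor A B" using bij' that by (auto simp: bij_betw_def)
  show "\<exists>f\<in>mor A B. \<Sigma>m f = h" if "h \<in> mor (\<Sigma>o A) (\<Sigma>o B)"
    using that unfolding bij_betw_imp_surj_on[OF bij', symmetric] by blast
  show "f = f'" if "f \<in> mor A B" "f' \<in> mor A B" "\<Sigma>m f = \<Sigma>m f'" using bij' that by (auto simp: bij_betw_def inj_on_def)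
  show "\<Sigma>m (f \<oplus>\<^bsub>Hom C A B\<^esub> f') = \<Sigma>m f \<oplus>\<^bsub>Hom C (\<Sigma>o A) (\<Sigma>o B)\<^esub> \<Sigma>m f'" if "f \<in> mor A B" "f' \<in> mor A B"
    using add that by auto
qed

lemma Susp_zr:
  assumes "A \<in> Ob C" "B \<in> Ob C" shows "\<Sigma>m (zr A B) = zr (\<Sigma>o A) (\<Sigma>o B)"
proof -
  interpret AB: abelian_group "Hom C A B" by (rule Hom_abelian_group[OF assms])
  interpret SAB: abelian_group "Hom C (\<Sigma>o A) (\<Sigma>o B)" by (rule Hom_abelian_group[OF Susp_closed Susp_closed]) fact+
  have z: "\<Sigma>m (zr A B) \<in> mor (\<Sigma>o A) (\<Sigma>o B)" using Susp_mor(1)[OF assms] by simp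
  have "\<Sigma>m (zr A B) \<oplus>\<^bsub>Hom C (\<Sigma>o A) (\<Sigma>o B)\<^esub> \<Sigma>m (zr A B) = \<Sigma>m (zr A B)"
    using Susp_mor(4)[OF assms AB.zero_closed AB.zero_closed] by simp
  then show ?thesis using SAB.add.l_cancel_one'[OF z z] by simp
qed

lemma zero_object_Susp: assumes "zero_object C P" shows "zero_object C (\<Sigma>o P)"
proof -
  have P: "P \<in> Ob C" "Id C P = zr P P" using assms by (auto simp: zero_object_def)
  then show ?thesis using Susp_Id[OF P(1)] Susp_zr[OF P(1) P(1)] Susp_closed by (simp add: zero_object_def)
qed

lemma TriD:
  assumes "(A, B, P, f, g, h) \<in> Tri C"
  shows "A \<in> Ob C" "B \<in> Ob C" "P \<in> Ob C" "f \<in> mor A B" "g \<in> mor B P" "h \<in> mor P (\<Sigma>o A)"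
  using assms Tri_candidate by (auto simp: candidate_triangles_def)

lemma Tri_rotated:
  assumes "(A, B, P, f, g, h) \<in> Tri C"
  shows "(B, P, \<Sigma>o A, g, h, \<ominus>\<^bsub>Hom C (\<Sigma>o A) (\<Sigma>o B)\<^esub> \<Sigma>m f) \<in> Tri C"
  using assms Tri_rotate Tri_candidate by blast

lemma Tri_cmp_zero:
  assumes T: "(A, B, P, f, g, h) \<in> Tri C"
  shows "g \<star> f = zr A P"
proof -
  note t = TriD[OF T]
  obtain N where N: "zero_object C N" using zero_object_exists[OF finite_direct_sums] by metis
  have NO: "N \<in> Ob C" using N by (simp add: zero_object_def)
  obtain c where c: "c \<in> mor N P" "c \<star> zr A N = g \<star> f"
    using Tri_fill[OF Tri_Id[OF t(1) N] T Id_closed[OF t(1)] t(4)] by auto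
  then show ?thesis using cmp_zr(1)[OF t(1) NO t(3)] by simp
qed

text \<open>
  Compare the rotated triangle \<open>U \<rightarrow> 0 \<rightarrow> \<Sigma>U\<close> with the rotation of the given one; the morphism
  \<open>\<Sigma>U \<rightarrow> \<Sigma>A\<close> that completes \<open>s\<close> is a suspension, as \<open>\<Sigma>\<close> is full and faithful.
\<close>

lemma Tri_exact_left:
  assumes T: "(A, B, P, f, g, h) \<in> Tri C" and U: "U \<in> Ob C" "s \<in> mor U B" "g \<star> s = zr U P"
  shows "\<exists>r\<in>mor U A. s = f \<star> r"
proof -
  note t = TriD[OF T]
  obtain N where N: "zero_object C N" using zero_object_exists[OF finite_direct_sums] by metis
  have NO: "N \<in> Ob C" using N by (simp add: zero_object_def)
  have SU: "\<Sigma>o U \<in> Ob C" and SA: "\<Sigma>o A \<in> Ob C" and SB: "\<Sigma>o B \<in> Ob C" using Susp_closed U t by auto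
  interpret SUU: abelian_group "Hom C (\<Sigma>o U) (\<Sigma>o U)" by (rule Hom_abelian_group[OF SU SU])
  have r1: "(U, N, \<Sigma>o U, zr U N, zr N (\<Sigma>o U), \<ominus>\<^bsub>Hom C (\<Sigma>o U) (\<Sigma>o U)\<^esub> \<Sigma>m (Id C U)) \<in> Tri C"
    by (rule Tri_rotated[OF Tri_Id[OF U(1) N]])
  have "zr N P \<star> zr U N = g \<star> s" using U(3) cmp_zr(1)[OF U(1) NO t(3), of "zr N P"] NO t by simp
  then obtain c where c: "c \<in> mor (\<Sigma>o U) (\<Sigma>o A)"
    "\<Sigma>m s \<star> (\<ominus>\<^bsub>Hom C (\<Sigma>o U) (\<Sigma>o U)\<^esub> \<Sigma>m (Id C U)) = (\<ominus>\<^bsub>Hom C (\<Sigma>o A) (\<Sigma>o B)\<^esub> \<Sigma>m f) \<star> c"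
    using Tri_fill[OF r1 Tri_rotated[OF T] U(2) zr_closed[OF NO t(3)]] by auto
  have Ss: "\<Sigma>m s \<in> mor (\<Sigma>o U) (\<Sigma>o B)" and Sf: "\<Sigma>m f \<in> mor (\<Sigma>o A) (\<Sigma>o B)" using Susp_mor(1) U t by auto
  interpret SUB: abelian_group "Hom C (\<Sigma>o U) (\<Sigma>o B)" by (rule Hom_abelian_group[OF SU SB])
  have "\<ominus>\<^bsub>Hom C (\<Sigma>o U) (\<Sigma>o B)\<^esub> \<Sigma>m s = \<ominus>\<^bsub>Hom C (\<Sigma>o U) (\<Sigma>o B)\<^esub> (\<Sigma>m f \<star> c)"
    using c(2) cmp_minus(1)[OF SU SU SB Id_closed[OF SU] Ss] cmp_minus(2)[OF SU SA SB c(1) Sf]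
      Susp_Id[OF U(1)] Comp_Id[OF SU SB Ss] by simp
  then have eq: "\<Sigma>m s = \<Sigma>m f \<star> c"
    using Ss cmp_closed[OF c(1) Sf SU SA SB] by (metis SUB.minus_minus)
  obtain r where r: "r \<in> mor U A" "\<Sigma>m r = c" using Susp_mor(2)[OF U(1) t(1) c(1)] by blast
  have "\<Sigma>m s = \<Sigma>m (f \<star> r)" using eq r Susp_Comp[OF U(1) t(1) t(2) r(1) t(4)] by simp
  then have "s = f \<star> r" using Susp_mor(3)[OF U(1) t(2) U(2) cmp_closed[OF r(1) t(4) U(1) t(1,2)]] by blast
  then show ?thesis using r by blast
qed

text \<open>
  Compare the given triangle with \<open>0 \<rightarrow> U \<rightarrow> U\<close>.
\<close>

lemma Tri_exact_right:
  assumes T: "(A, B, P, f, g, h) \<in> Tri C" and U: "U \<in> Ob C" "s \<in> mor B U" "s \<star> f = zr A U"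
  shows "\<exists>r\<in>mor P U. s = r \<star> g"
proof -
  note t = TriD[OF T]
  obtain N where N: "zero_object C N" using zero_object_exists[OF finite_direct_sums] by metis
  have NO: "N \<in> Ob C" using N by (simp add: zero_object_def)
  have SN: "\<Sigma>o N \<in> Ob C" and SU: "\<Sigma>o U \<in> Ob C" using Susp_closed NO U by auto
  interpret NSU: abelian_group "Hom C (\<Sigma>o N) (\<Sigma>o U)" by (rule Hom_abelian_group[OF SN SU])
  have "\<ominus>\<^bsub>Hom C (\<Sigma>o N) (\<Sigma>o U)\<^esub> \<Sigma>m (zr N U) = zr (\<Sigma>o N) (\<Sigma>o U)"
    using Susp_zr[OF NO U(1)] by simp
  then have "(U, U, \<Sigma>o N, Id C U, zr U (\<Sigma>o N), \<ominus>\<^bsub>Hom C (\<Sigma>o N) (\<Sigma>o U)\<^esub> \<Sigma>m (zr N U)) \<in> Tri C"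
    using Tri_Id[OF U(1) zero_object_Susp[OF N]] by simp
  then have T2: "(N, U, U, zr N U, Id C U, zr U (\<Sigma>o N)) \<in> Tri C"
    using Tri_rotate[of N U U "zr N U" "Id C U" "zr U (\<Sigma>o N)"] NO U SN Id_closed
    by (simp add: candidate_triangles_def)
  have "s \<star> f = zr N U \<star> zr A N" using U(3) cmp_zr(2)[OF t(1) NO U(1), of "zr A N"] t NO by simp
  then obtain c where c: "c \<in> mor P U" "c \<star> g = Id C U \<star> s"
    using Tri_fill[OF T T2 zr_closed[OF t(1) NO] U(2)] by auto
  then show ?thesis using Id_Comp[OF t(2) U(1) U(2)] by metis
qed

text \<open>
  Let \<open>m = h k\<close> and let \<open>e\<close> be the extension of \<open>B\<close> by \<open>A\<close> classified by \<open>m\<close>, with \<open>u : A \<rightarrow> e\<close>.  As \<open>m\<close> factors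
  through \<open>h\<close>, the morphism \<open>f\<close> extends along \<open>u\<close> to some \<open>b : e \<rightarrow> t\<close>.  The hypothesis \<open>ext\<close> lets \<open>b\<close> factor
  through \<open>f\<close>, say \<open>b = f r\<close>; it is available for \<open>e\<close> because \<open>e\<close> has no morphisms to objects that
  receive none from \<open>A\<close> and \<open>B\<close>.  Now \<open>f (r u) = f\<close>, so by minimality \<open>u\<close> is a split monomorphism and
  \<open>m = 0\<close>.  Then \<open>k\<close> comes from a morphism \<open>B \<rightarrow> t\<close>, which factors through \<open>f\<close>, and so \<open>k = 0\<close>.
\<close>

lemma wakamatsu:
  assumes T: "(A, t, P, f, g, h) \<in> Tri C"
    and min: "\<And>\<phi>. \<phi> \<in> mor A A \<Longrightarrow> f \<star> \<phi> = f \<Longrightarrow> \<exists>l\<in>mor A A. l \<star> \<phi> = Id C A"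
    and B: "B \<in> Ob C" and k: "k \<in> mor B P"
    and apB: "\<And>s. s \<in> mor B t \<Longrightarrow> \<exists>r\<in>mor B A. s = f \<star> r"
    and ext: "\<And>e b. e \<in> Ob C \<Longrightarrow>
       (\<And>v. v \<in> Ob C \<Longrightarrow> mor A v = {zr A v} \<Longrightarrow> mor B v = {zr B v} \<Longrightarrow> mor e v = {zr e v}) \<Longrightarrow>
       b \<in> mor e t \<Longrightarrow> \<exists>r\<in>mor e A. b = f \<star> r"
  shows "k = zr B P"
proof -
  note t = TriD[OF T]
  have SA: "\<Sigma>o A \<in> Ob C" and St: "\<Sigma>o t \<in> Ob C" and SB: "\<Sigma>o B \<in> Ob C" using Susp_closed t B by auto
  define m where "m = h \<star> k"
  have m: "m \<in> mor B (\<Sigma>o A)" unfolding m_def using cmp_closed[OF k t(6) B t(3) SA] .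
  obtain W i0 j0 where W: "(B, \<Sigma>o A, W, m, i0, j0) \<in> Tri C" using Tri_cone[OF B SA m] by blast
  note w = TriD[OF W]
  obtain e where e: "e \<in> Ob C" "isomorphic C (\<Sigma>o e) W" using Susp_ess_surj[OF w(3)] by blast
  have Se: "\<Sigma>o e \<in> Ob C" using Susp_closed e by blast
  obtain \<omega>' where om: "isomorphism C W (\<Sigma>o e) \<omega>'"
    using isomorphic_sym[OF e(2)] unfolding isomorphic_def by blast
  obtain \<omega> where \<omega>: "\<omega>' \<in> mor W (\<Sigma>o e)" "\<omega> \<in> mor (\<Sigma>o e) W" "\<omega> \<star> \<omega>' = Id C W" "\<omega>' \<star> \<omega> = Id C (\<Sigma>o e)"
    using isomorphismE[OF om] by metis
  define i where "i = \<omega>' \<star> i0"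
  define j where "j = j0 \<star> \<omega>"
  have i: "i \<in> mor (\<Sigma>o A) (\<Sigma>o e)" unfolding i_def using cmp_closed[OF w(5) \<omega>(1) SA w(3) Se] .
  have j: "j \<in> mor (\<Sigma>o e) (\<Sigma>o B)" unfolding j_def using cmp_closed[OF \<omega>(2) w(6) Se w(3) SB] .
  have E: "(B, \<Sigma>o A, \<Sigma>o e, m, i, j) \<in> Tri C"
  proof (rule Tri_iso_closed[OF W _ isomorphism_Id[OF B] isomorphism_Id[OF SA] om])
    show "(B, \<Sigma>o A, \<Sigma>o e, m, i, j) \<in> candidate_triangles C"
      using B SA Se m i j by (simp add: candidate_triangles_def)
    show "Id C (\<Sigma>o A) \<star> m = m \<star> Id C B" using Id_Comp[OF B SA m] Comp_Id[OF B SA m] by simp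
    show "\<omega>' \<star> i0 = i \<star> Id C (\<Sigma>o A)" using Comp_Id[OF SA Se i] by (simp add: i_def)
    have "j \<star> \<omega>' = j0 \<star> (\<omega> \<star> \<omega>')"
      unfolding j_def by (rule Comp_assoc[OF w(3) Se w(3) SB \<omega>(1) \<omega>(2) w(6)])
    then show "\<Sigma>m (Id C B) \<star> j0 = j \<star> \<omega>'"
      using \<omega>(3) Susp_Id[OF B] Id_Comp[OF w(3) SB w(6)] Comp_Id[OF w(3) SB w(6)] by simp
  qed
  have extv: "mor e v = {zr e v}" if v: "v \<in> Ob C" "mor A v = {zr A v}" "mor B v = {zr B v}" for v
  proof -
    have Sv: "\<Sigma>o v \<in> Ob C" using Susp_closed v by blast
    have "s = zr e v" if s: "s \<in> mor e v" for s
    proof -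
      have Ss: "\<Sigma>m s \<in> mor (\<Sigma>o e) (\<Sigma>o v)" using Susp_mor(1)[OF e(1) v(1) s] .
      have zA: "q = zr (\<Sigma>o A) (\<Sigma>o v)" if "q \<in> mor (\<Sigma>o A) (\<Sigma>o v)" for q
        using Susp_mor(2)[OF t(1) v(1) that] v(2) Susp_zr[OF t(1) v(1)] by auto
      have zB: "q = zr (\<Sigma>o B) (\<Sigma>o v)" if "q \<in> mor (\<Sigma>o B) (\<Sigma>o v)" for q
        using Susp_mor(2)[OF B v(1) that] v(3) Susp_zr[OF B v(1)] by auto
      have "\<Sigma>m s \<star> i = zr (\<Sigma>o A) (\<Sigma>o v)" using zA cmp_closed[OF i Ss SA Se Sv] by blast
      then obtain r where r: "r \<in> mor (\<Sigma>o B) (\<Sigma>o v)" "\<Sigma>m s = r \<star> j"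
        using Tri_exact_right[OF Tri_rotated[OF E] Sv Ss] by blast
      then have "\<Sigma>m s = zr (\<Sigma>o e) (\<Sigma>o v)" using zB[OF r(1)] cmp_zr(2)[OF Se SB Sv j] by simp
      then have "\<Sigma>m s = \<Sigma>m (zr e v)" using Susp_zr[OF e(1) v(1)] by simp
      then show ?thesis using Susp_mor(3)[OF e(1) v(1) s] e v by simp
    qed
    then show ?thesis using zr_closed[OF e(1) v(1)] by blast
  qed
  \<comment> \<open>\<open>k\<close> and the identity of \<open>\<Sigma>A\<close> extend to a morphism of triangles, whose third component is \<open>\<Sigma>b\<close>\<close>
  have R: "(P, \<Sigma>o A, \<Sigma>o t, h, \<ominus>\<^bsub>Hom C (\<Sigma>o A) (\<Sigma>o t)\<^esub> \<Sigma>m f, \<ominus>\<^bsub>Hom C (\<Sigma>o t) (\<Sigma>o P)\<^esub> \<Sigma>m g) \<in> Tri C"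
    by (rule Tri_rotated[OF Tri_rotated[OF T]])
  have "Id C (\<Sigma>o A) \<star> m = h \<star> k" using Id_Comp[OF B SA m] by (simp add: m_def)
  then obtain c where c: "c \<in> mor (\<Sigma>o e) (\<Sigma>o t)" "c \<star> i = (\<ominus>\<^bsub>Hom C (\<Sigma>o A) (\<Sigma>o t)\<^esub> \<Sigma>m f) \<star> Id C (\<Sigma>o A)"
    using Tri_fill[OF E R k Id_closed[OF SA]] by blast
  have Sf: "\<Sigma>m f \<in> mor (\<Sigma>o A) (\<Sigma>o t)" using Susp_mor(1)[OF t(1,2,4)] .
  interpret SAt: abelian_group "Hom C (\<Sigma>o A) (\<Sigma>o t)" by (rule Hom_abelian_group[OF SA St])
  interpret SAe: abelian_group "Hom C (\<Sigma>o A) (\<Sigma>o e)" by (rule Hom_abelian_group[OF SA Se])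
  have ci: "c \<star> i = \<ominus>\<^bsub>Hom C (\<Sigma>o A) (\<Sigma>o t)\<^esub> \<Sigma>m f" using c(2) Comp_Id[OF SA St SAt.a_inv_closed[OF Sf]] by simp
  obtain b where b: "b \<in> mor e t" "\<Sigma>m b = c" using Susp_mor(2)[OF e(1) t(2) c(1)] by blast
  obtain u where u: "u \<in> mor A e" "\<Sigma>m u = \<ominus>\<^bsub>Hom C (\<Sigma>o A) (\<Sigma>o e)\<^esub> i"
    using Susp_mor(2)[OF t(1) e(1) SAe.a_inv_closed[OF i]] by blast
  have "\<Sigma>m (b \<star> u) = \<Sigma>m f"
    using Susp_Comp[OF t(1) e(1) t(2) u(1) b(1)] u b cmp_minus(1)[OF SA Se St i c(1)] ci Sf by simp
  then have bu: "b \<star> u = f"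
    using Susp_mor(3)[OF t(1,2) cmp_closed[OF u(1) b(1) t(1) e(1) t(2)] t(4)] by blast
  obtain r where r: "r \<in> mor e A" "b = f \<star> r" using ext[OF e(1) extv b(1)] by blast
  have ru: "r \<star> u \<in> mor A A" using cmp_closed[OF u(1) r(1) t(1) e(1) t(1)] .
  have "f \<star> (r \<star> u) = f"
    using Comp_assoc[OF t(1) e(1) t(1) t(2) u(1) r(1) t(4)] bu r(2) by simp
  then obtain l where l: "l \<in> mor A A" "l \<star> (r \<star> u) = Id C A" using min ru by blast
  have lr: "l \<star> r \<in> mor e A" using cmp_closed[OF r(1) l(1) e(1) t(1) t(1)] .
  have lru: "(l \<star> r) \<star> u = Id C A" using Comp_assoc[OF t(1) e(1) t(1) t(1) u(1) r(1) l(1)] l(2) by simp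
  have Su: "\<Sigma>m u \<in> mor (\<Sigma>o A) (\<Sigma>o e)" and Slr: "\<Sigma>m (l \<star> r) \<in> mor (\<Sigma>o e) (\<Sigma>o A)"
    using Susp_mor(1)[OF t(1) e(1) u(1)] Susp_mor(1)[OF e(1) t(1) lr] .
  have "\<Sigma>m u \<star> m = zr B (\<Sigma>o e)"
  proof -
    interpret Be: abelian_group "Hom C B (\<Sigma>o e)" by (rule Hom_abelian_group[OF B Se])
    show ?thesis using u(2) cmp_minus(2)[OF B SA Se m i] Tri_cmp_zero[OF E] by simp
  qed
  then have "\<Sigma>m (l \<star> r) \<star> (\<Sigma>m u \<star> m) = zr B (\<Sigma>o A)" using cmp_zr(1)[OF B Se SA Slr] by simp
  moreover have "\<Sigma>m (l \<star> r) \<star> (\<Sigma>m u \<star> m) = (\<Sigma>m (l \<star> r) \<star> \<Sigma>m u) \<star> m"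
    by (rule Comp_assoc[OF B SA Se SA m Su Slr, symmetric])
  moreover have "\<Sigma>m (l \<star> r) \<star> \<Sigma>m u = Id C (\<Sigma>o A)"
    using Susp_Comp[OF t(1) e(1) t(1) u(1) lr] lru Susp_Id[OF t(1)] by simp
  ultimately have "h \<star> k = zr B (\<Sigma>o A)" using Id_Comp[OF B SA m] by (simp add: m_def)
  then obtain s where s: "s \<in> mor B t" "k = g \<star> s" using Tri_exact_left[OF Tri_rotated[OF T] B k] by blast
  obtain s' where s': "s' \<in> mor B A" "s = f \<star> s'" using apB[OF s(1)] by blast
  have "k = (g \<star> f) \<star> s'" using s(2) s'(2) Comp_assoc[OF B t(1) t(2) t(3) s'(1) t(4) t(5)] by simp
  then show ?thesis using Tri_cmp_zero[OF T] cmp_zr(2)[OF B t(1) t(3) s'(1)] by simp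
qed

end

section \<open>Torsion pairs in Igusa--Todorov cluster categories\<close>

context linear_category
begin

lemma one_dimensional_multiple:
  assumes O: "A \<in> Ob C" "B \<in> Ob C" and one: "is_one_dimensional K (Hom C A B)"
    and f: "f \<in> mor A B" "f \<noteq> zr A B" and g: "g \<in> mor A B"
  shows "\<exists>a\<in>carrier K. g = a \<odot>\<^bsub>Hom C A B\<^esub> f"
proof -
  interpret K: field K by (rule ground_field)
  interpret M: module K "Hom C A B" by (rule Hom_module[OF O])
  obtain \<phi> where "\<phi> \<in> linear_isos K (Hom C A B) (ground_module K)" using one unfolding is_one_dimensional_def by blast
  then have bij: "bij_betw \<phi> (mor A B) (carrier K)"
    and lin: "\<And>a x. a \<in> carrier K \<Longrightarrow> x \<in> mor A B \<Longrightarrow> \<phi> (a \<odot>\<^bsub>Hom C A B\<^esub> x) = a \<otimes>\<^bsub>K\<^esub> \<phi> x"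
    by (auto simp: linear_isos_def linear_maps_def ground_module_def)
  have inj: "x = y" if "x \<in> mor A B" "y \<in> mor A B" "\<phi> x = \<phi> y" for x y
    using bij that by (auto simp: bij_betw_def inj_on_def)
  have phiK: "\<phi> x \<in> carrier K" if "x \<in> mor A B" for x using bij that by (auto simp: bij_betw_def)
  have "\<phi> (zr A B) = \<zero>\<^bsub>K\<^esub>"
    using lin[OF K.zero_closed f(1)] M.smult_l_null[OF f(1)] phiK[OF f(1)] by simp
  then have "\<phi> f \<noteq> \<zero>\<^bsub>K\<^esub>" using inj[OF f(1) M.zero_closed] f(2) by auto
  then have unit: "\<phi> f \<in> Units K" using phiK[OF f(1)] by (simp add: K.field_Units)
  define a where "a = \<phi> g \<otimes>\<^bsub>K\<^esub> inv\<^bsub>K\<^esub> (\<phi> f)"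
  have a: "a \<in> carrier K" using unit phiK[OF g] by (simp add: a_def)
  have "\<phi> (a \<odot>\<^bsub>Hom C A B\<^esub> f) = a \<otimes>\<^bsub>K\<^esub> \<phi> f" by (rule lin[OF a f(1)])
  also have "\<dots> = \<phi> g" using unit phiK[OF g] phiK[OF f(1)] by (simp add: a_def K.m_assoc)
  finally have "g = a \<odot>\<^bsub>Hom C A B\<^esub> f" using inj[OF M.smult_closed[OF a f(1)] g] by simp
  then show ?thesis using a by blast
qed

lemma one_dimensional_nonzero:
  assumes O: "A \<in> Ob C" "B \<in> Ob C" and one: "is_one_dimensional K (Hom C A B)"
  obtains f where "f \<in> mor A B" "f \<noteq> zr A B"
proof -
  interpret K: field K by (rule ground_field)
  obtain \<phi> where "\<phi> \<in> linear_isos K (Hom C A B) (ground_module K)" using one unfolding is_one_dimensional_def by blast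
  then have "bij_betw \<phi> (mor A B) (carrier K)" by (auto simp: linear_isos_def ground_module_def)
  then have "\<phi> ` mor A B = carrier K" by (rule bij_betw_imp_surj_on)
  then have "\<zero>\<^bsub>K\<^esub> \<in> \<phi> ` mor A B" "\<one>\<^bsub>K\<^esub> \<in> \<phi> ` mor A B" by simp_all
  then obtain x y where "x \<in> mor A B" "\<phi> x = \<zero>\<^bsub>K\<^esub>" "y \<in> mor A B" "\<phi> y = \<one>\<^bsub>K\<^esub>"
    by (elim imageE) simp
  then have "x \<noteq> zr A B \<or> y \<noteq> zr A B" using K.one_not_zero by auto
  then show ?thesis using that \<open>x \<in> mor A B\<close> \<open>y \<in> mor A B\<close> by blast
qed

lemma local_of_one_dimensional:
  assumes A: "A \<in> Ob C" "Id C A \<noteq> zr A A" and one: "is_one_dimensional K (Hom C A A)"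
  shows "local_endomorphism_ring C A"
proof -
  interpret K: field K by (rule ground_field)
  interpret M: module K "Hom C A A" by (rule Hom_module[OF A(1) A(1)])
  note Ic = Id_closed[OF A(1)]
  have "f = zr A A" if f: "f \<in> mor A A" "\<not> isomorphism C A A f" for f
  proof -
    obtain a where a: "a \<in> carrier K" "f = a \<odot>\<^bsub>Hom C A A\<^esub> Id C A"
      using one_dimensional_multiple[OF A(1) A(1) one Ic A(2) f(1)] by blast
    have "a = \<zero>\<^bsub>K\<^esub>"
    proof (rule ccontr)
      assume "a \<noteq> \<zero>\<^bsub>K\<^esub>"
      then have u: "a \<in> Units K" using a by (simp add: K.field_Units)
      define f' where "f' = inv\<^bsub>K\<^esub> a \<odot>\<^bsub>Hom C A A\<^esub> Id C A"
      have f': "f' \<in> mor A A" using u Ic by (simp add: f'_def)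
      have "f' \<star> f = a \<odot>\<^bsub>Hom C A A\<^esub> (f' \<star> Id C A)"
        unfolding a(2) by (rule Comp_smult_right[OF A(1) A(1) A(1) a(1) Ic f'])
      then have "f' \<star> f = a \<odot>\<^bsub>Hom C A A\<^esub> (inv\<^bsub>K\<^esub> a \<odot>\<^bsub>Hom C A A\<^esub> Id C A)"
        using Comp_Id[OF A(1) A(1) f'] by (simp add: f'_def)
      then have 1: "f' \<star> f = Id C A" using M.smult_assoc1[OF a(1) _ Ic, of "inv\<^bsub>K\<^esub> a"] u Ic by simp
      have "f \<star> f' = inv\<^bsub>K\<^esub> a \<odot>\<^bsub>Hom C A A\<^esub> (f \<star> Id C A)"
        unfolding f'_def by (rule Comp_smult_right[OF A(1) A(1) A(1) _ Ic f(1)]) (use u in simp)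
      then have "f \<star> f' = inv\<^bsub>K\<^esub> a \<odot>\<^bsub>Hom C A A\<^esub> (a \<odot>\<^bsub>Hom C A A\<^esub> Id C A)"
        using Comp_Id[OF A(1) A(1) f(1)] a(2) by simp
      then have 2: "f \<star> f' = Id C A" using M.smult_assoc1[OF _ a(1) Ic, of "inv\<^bsub>K\<^esub> a"] u Ic by simp
      show False using f f' 1 2 unfolding isomorphism_def by blast
    qed
    then show ?thesis using a(2) Ic by simp
  qed
  moreover have "\<not> isomorphism C A A (zr A A)" by (rule zr_not_iso[OF A])
  ultimately show ?thesis using A unfolding local_endomorphism_ring_def by (metis M.zero_closed M.l_zero)
qed

text \<open>
  The morphisms that factor through the family; being closed under sums, they can be recognised summand by
  summand.
\<close>

definition combinations :: "'o \<Rightarrow> 'o \<Rightarrow> ('i \<Rightarrow> 'o) \<Rightarrow> ('i \<Rightarrow> 'm) \<Rightarrow> 'i set \<Rightarrow> 'm set" where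
  "combinations B t A f I = {g. \<exists>c. (\<forall>i\<in>I. c i \<in> mor B (A i)) \<and> g = (\<Oplus>\<^bsub>Hom C B t\<^esub>i\<in>I. f i \<star> c i)}"

lemma combinations_add:
  assumes O: "B \<in> Ob C" "t \<in> Ob C" "\<And>i. i \<in> I \<Longrightarrow> A i \<in> Ob C" "\<And>i. i \<in> I \<Longrightarrow> f i \<in> mor (A i) t"
    and g: "g \<in> combinations B t A f I" "g' \<in> combinations B t A f I"
  shows "g \<oplus>\<^bsub>Hom C B t\<^esub> g' \<in> combinations B t A f I"
proof -
  interpret Bt: abelian_group "Hom C B t" by (rule Hom_abelian_group[OF O(1,2)])
  obtain c where c: "\<And>i. i \<in> I \<Longrightarrow> c i \<in> mor B (A i)" "g = (\<Oplus>\<^bsub>Hom C B t\<^esub>i\<in>I. f i \<star> c i)"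
    using g(1) unfolding combinations_def by blast
  obtain c' where c': "\<And>i. i \<in> I \<Longrightarrow> c' i \<in> mor B (A i)" "g' = (\<Oplus>\<^bsub>Hom C B t\<^esub>i\<in>I. f i \<star> c' i)"
    using g(2) unfolding combinations_def by blast
  define d where "d i = c i \<oplus>\<^bsub>Hom C B (A i)\<^esub> c' i" for i
  have d: "d i \<in> mor B (A i)" if i: "i \<in> I" for i
    unfolding d_def using abelian_monoid.a_closed[OF Hom_abelian_monoid[OF O(1) O(3)[OF i]] c(1)[OF i] c'(1)[OF i]] .
  have fc: "f i \<star> c i \<in> mor B t" "f i \<star> c' i \<in> mor B t" "f i \<star> d i \<in> mor B t" if i: "i \<in> I" for i
    using cmp_closed[OF c(1)[OF i] O(4)[OF i] O(1) O(3)[OF i] O(2)] cmp_closed[OF c'(1)[OF i] O(4)[OF i] O(1) O(3)[OF i] O(2)]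
      cmp_closed[OF d[OF i] O(4)[OF i] O(1) O(3)[OF i] O(2)] by auto
  have "g \<oplus>\<^bsub>Hom C B t\<^esub> g' = (\<Oplus>\<^bsub>Hom C B t\<^esub>i\<in>I. f i \<star> c i \<oplus>\<^bsub>Hom C B t\<^esub> f i \<star> c' i)"
    unfolding c(2) c'(2) using fc by (intro Bt.finsum_addf[symmetric]) auto
  also have "\<dots> = (\<Oplus>\<^bsub>Hom C B t\<^esub>i\<in>I. f i \<star> d i)"
  proof (rule finsum_cong_mor[OF O(1,2)])
    fix i assume i: "i \<in> I"
    show "f i \<star> d i \<in> mor B t" by (rule fc(3)[OF i])
    show "f i \<star> c i \<oplus>\<^bsub>Hom C B t\<^esub> f i \<star> c' i = f i \<star> d i"
      unfolding d_def by (rule Comp_add_right[OF O(1) O(3)[OF i] O(2) c(1)[OF i] c'(1)[OF i] O(4)[OF i], symmetric])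
  qed
  finally show ?thesis unfolding combinations_def using d by blast
qed

lemma combinations_single:
  assumes O: "B \<in> Ob C" "t \<in> Ob C" "\<And>i. i \<in> I \<Longrightarrow> A i \<in> Ob C" "\<And>i. i \<in> I \<Longrightarrow> f i \<in> mor (A i) t" "finite I"
    and j: "j \<in> I" "u \<in> mor B (A j)"
  shows "f j \<star> u \<in> combinations B t A f I"
proof -
  let ?c = "\<lambda>i. if i = j then u else zr B (A i)"
  have "(\<Oplus>\<^bsub>Hom C B t\<^esub>i\<in>I. f i \<star> ?c i) = f j \<star> ?c j"
  proof (rule finsum_single[OF O(1,2,5) j(1)])
    show "f j \<star> ?c j \<in> mor B t" using cmp_closed[OF j(2) O(4)[OF j(1)] O(1) O(3)[OF j(1)] O(2)] by simp
    fix i assume "i \<in> I" "i \<noteq> j"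
    then show "f i \<star> ?c i = zr B t" using cmp_zr(1)[OF O(1) O(3) O(2) O(4)] by simp
  qed
  moreover have "\<forall>i\<in>I. ?c i \<in> mor B (A i)" using j O by auto
  ultimately show ?thesis unfolding combinations_def by (intro CollectI exI[of _ ?c]) simp
qed

lemma combinations_zr:
  assumes O: "B \<in> Ob C" "t \<in> Ob C" "\<And>i. i \<in> I \<Longrightarrow> A i \<in> Ob C" "\<And>i. i \<in> I \<Longrightarrow> f i \<in> mor (A i) t"
  shows "zr B t \<in> combinations B t A f I"
proof -
  have "(\<Oplus>\<^bsub>Hom C B t\<^esub>i\<in>I. f i \<star> zr B (A i)) = zr B t"
    by (rule finsum_zr[OF O(1,2)]) (use cmp_zr(1)[OF O(1) O(3) O(2) O(4)] in simp)
  then show ?thesis unfolding combinations_def using O by (intro CollectI exI[of _ "\<lambda>i. zr B (A i)"]) auto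
qed

lemma combinations_finsum:
  assumes O: "B \<in> Ob C" "t \<in> Ob C" "\<And>i. i \<in> I \<Longrightarrow> A i \<in> Ob C" "\<And>i. i \<in> I \<Longrightarrow> f i \<in> mor (A i) t"
    and J: "finite J" "\<And>j. j \<in> J \<Longrightarrow> g j \<in> combinations B t A f I" "\<And>j. j \<in> J \<Longrightarrow> g j \<in> mor B t"
  shows "(\<Oplus>\<^bsub>Hom C B t\<^esub>j\<in>J. g j) \<in> combinations B t A f I"
  using J
proof (induction J)
  case empty
  interpret Bt: abelian_group "Hom C B t" by (rule Hom_abelian_group[OF O(1,2)])
  show ?case using combinations_zr[where I = I, OF O] by simp
next
  case (insert j J)
  interpret Bt: abelian_group "Hom C B t" by (rule Hom_abelian_group[OF O(1,2)])
  have "(\<Oplus>\<^bsub>Hom C B t\<^esub>j\<in>insert j J. g j) = g j \<oplus>\<^bsub>Hom C B t\<^esub> (\<Oplus>\<^bsub>Hom C B t\<^esub>j\<in>J. g j)"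
    using insert by (intro Bt.finsum_insert) auto
  then show ?case using combinations_add[where I = I and A = A and f = f, OF O] insert by auto
qed

end

locale igusa_todorov_admissible = igusa_todorov_category Z K C E + admissible_set Z
  for Z :: "complex set" and K :: "('k, 'r) ring_scheme" and C :: "('o, 'm, 'k, 'c) tricat_scheme"
    and E :: "complex set \<Rightarrow> 'o"
begin

lemma E_Ob: "P \<in> diagonals Z \<Longrightarrow> E P \<in> Ob C"
  and E_nonzero: "P \<in> diagonals Z \<Longrightarrow> Id C (E P) \<noteq> zr (E P) (E P)"
  using E_indecomposable by (auto simp: indecomposable_def zero_object_def)

lemma mor_E_zero_iff:
  assumes "P \<in> diagonals Z" "Q \<in> diagonals Z"
  shows "mor (E P) (E Q) = {zr (E P) (E Q)} \<longleftrightarrow> \<not> hom_nonzero P Q"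
proof
  show "mor (E P) (E Q) = {zr (E P) (E Q)}" if "\<not> hom_nonzero P Q"
    using Hom_E_zero[OF assms] that unfolding hom_nonzero_def is_zero_space_def by blast
  show "\<not> hom_nonzero P Q" if z: "mor (E P) (E Q) = {zr (E P) (E Q)}"
  proof
    assume "hom_nonzero P Q"
    then have "is_one_dimensional K (Hom C (E P) (E Q))"
      using Hom_E_nonzero[OF assms] unfolding hom_nonzero_def by blast
    then show False using one_dimensional_nonzero[OF E_Ob[OF assms(1)] E_Ob[OF assms(2)]] z by blast
  qed
qed

lemma one_dimensional_of_hom_nonzero:
  assumes "P \<in> diagonals Z" "Q \<in> diagonals Z" "hom_nonzero P Q"
  shows "is_one_dimensional K (Hom C (E P) (E Q))"
  using Hom_E_nonzero[OF assms(1,2)] assms(3) unfolding hom_nonzero_def by blast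

lemma hom_nonzero_of_morphism:
  assumes "P \<in> diagonals Z" "Q \<in> diagonals Z" "f \<in> mor (E P) (E Q)" "f \<noteq> zr (E P) (E Q)"
  shows "hom_nonzero P Q"
  using mor_E_zero_iff[OF assms(1,2)] assms(3,4) by blast

lemma hom_nonzero_refl:
  assumes "P \<in> diagonals Z" shows "hom_nonzero P P"
proof -
  obtain x y where P: "P = {x, y}" "x \<in> Z" "y \<in> Z" using diagonalE[OF assms] by metis
  have b: "cyc_between x (su x) y" if "x \<in> Z" "z \<in> Z" "cyc_between x z y" for x y z
  proof -
    have "z \<noteq> x" using that in_circle by (auto simp: cyc_between_def)
    then have "ccw_angle x (su x) \<le> ccw_angle x z" using successor_props(3)[OF that(1,2)] by blast
    moreover have "0 < ccw_angle x (su x)"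
      using ccw_angle_pos[OF in_circle[OF that(1)] in_circle[OF su_in[OF that(1)]]] successor_props(2)[OF that(1)] by blast
    ultimately show ?thesis using that(3) by (auto simp: cyc_between_def)
  qed
  have "cyc_between x (su x) y" "cyc_between y (su y) x" using assms b P unfolding diagonal_iff_between P(1) by blast+
  then have "cross {x, y} {su x, su y}"
    using cross_iff[OF in_circle[OF P(2)] in_circle[OF su_in[OF P(2)]] in_circle[OF P(3)] in_circle[OF su_in[OF P(3)]]] by blast
  then show ?thesis using hom_nonzero_iff_cross[OF assms assms] P(1) by simp
qed

lemma E_local:
  assumes "P \<in> diagonals Z" shows "local_endomorphism_ring C (E P)"
  by (rule local_of_one_dimensional[OF E_Ob E_nonzero one_dimensional_of_hom_nonzero[OF _ _ hom_nonzero_refl]]) fact+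

text \<open>
  The summands that the Krull--Schmidt property provides have local endomorphism rings, hence are
  indecomposable, hence are isomorphic to objects \<open>E P\<close>.
\<close>

lemma decomposition:
  assumes "A \<in> Ob C"
  obtains n :: nat and P \<iota> \<pi> where "\<forall>j<n. P j \<in> diagonals Z" "biprod {..<n} (\<lambda>j. E (P j)) A \<iota> \<pi>"
proof -
  obtain As where As: "\<forall>B\<in>set As. local_endomorphism_ring C B" "direct_sum C As A"
    using Krull_Schmidt assms unfolding krull_schmidt_def by blast
  obtain \<iota> \<pi> where b: "biprod {..<length As} ((!) As) A \<iota> \<pi>" using direct_sum_biprod[OF As(2)] by metis
  have "\<forall>j. \<exists>P. j < length As \<longrightarrow> P \<in> diagonals Z \<and> isomorphic C (As ! j) (E P)"
    using E_surj local_indecomposable As(1) nth_mem by metis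
  then obtain P where P: "\<And>j. j < length As \<Longrightarrow> P j \<in> diagonals Z" "\<And>j. j < length As \<Longrightarrow> isomorphic C (As ! j) (E (P j))"
    by metis
  obtain \<iota>' \<pi>' where "biprod {..<length As} (\<lambda>j. E (P j)) A \<iota>' \<pi>'"
    by (rule biprod_transport[OF b, of "\<lambda>j. E (P j)"]) (use P(2) in auto)
  then show ?thesis using that P(1) by blast
qed

lemma isomorphic_E:
  assumes "P \<in> diagonals Z" "Q \<in> diagonals Z" "isomorphism C (E P) (E Q) f" shows "P = Q"
  using E_inj[OF assms(1,2)] assms E_Ob unfolding isomorphic_def by blast

lemma hom_position_swap:
  assumes "x0 \<in> Z" "x1 \<in> Z" "a \<in> Z" "b \<in> Z" "hom_position Z x0 x1 b a"
  shows "hom_position Z x1 x0 a b"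
proof -
  note C = in_circle[OF assms(1)] in_circle[OF assms(2)] in_circle[OF su_in[OF assms(3)]] in_circle[OF su_in[OF assms(4)]]
  show ?thesis
    using assms(5) unfolding hom_position_iff[OF assms(1,2,4,3)] hom_position_iff[OF assms(2,1,3,4)]
      cyc_less_4[OF C(1,4,2,3)] cyc_less_4[OF C(2,3,1,4)] by blast
qed

text \<open>
  All morphism spaces involved are at most one-dimensional.  So a morphism that factors through \<open>E S\<close>
  already factors through one fixed nonzero morphism \<open>v S\<close> from \<open>E S\<close>.
\<close>

lemma approximation_of_E:
  assumes D: "D \<subseteq> diagonals Z" and fd: "finitely_dominated D" and T: "T \<in> diagonals Z"
  shows "\<exists>F v. finite F \<and> F \<subseteq> D \<and> (\<forall>S\<in>F. v S \<in> mor (E S) (E T)) \<and>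
     (\<forall>P\<in>D. \<forall>g\<in>mor (E P) (E T). g \<noteq> zr (E P) (E T) \<longrightarrow> (\<exists>S\<in>F. \<exists>c\<in>mor (E P) (E S). g = v S \<star> c))"
proof -
  obtain a b where ab: "T = {a, b}" "a \<in> Z" "b \<in> Z" using diagonalE[OF T] by metis
  have Tab: "{a, b} \<in> diagonals Z" using T ab by simp
  obtain F where F: "finite F" "F \<subseteq> D" and dom: "\<And>x0 x1. {x0, x1} \<in> D \<Longrightarrow> hom_position Z x0 x1 a b \<Longrightarrow>
        \<exists>s0 s1. {s0, s1} \<in> F \<and> cyc_le [x0, s0, a] \<and> cyc_le [x1, s1, b]"
    using fd[unfolded finitely_dominated_def, rule_format, OF Tab] by metis
  \<comment> \<open>a nonzero morphism whenever there is one\<close>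
  define v where "v S = (SOME f. f \<in> mor (E S) (E T) \<and> (hom_nonzero S T \<longrightarrow> f \<noteq> zr (E S) (E T)))" for S
  have v: "v S \<in> mor (E S) (E T) \<and> (hom_nonzero S T \<longrightarrow> v S \<noteq> zr (E S) (E T))" if "S \<in> diagonals Z" for S
  proof -
    have "\<exists>f. f \<in> mor (E S) (E T) \<and> (hom_nonzero S T \<longrightarrow> f \<noteq> zr (E S) (E T))"
      using mor_E_zero_iff[OF that T] zr_closed[OF E_Ob[OF that] E_Ob[OF T]] by blast
    then show ?thesis unfolding v_def by (rule someI_ex)
  qed
  show ?thesis
  proof (intro exI[of _ F] exI[of _ v] conjI ballI impI)
    show "finite F" "F \<subseteq> D" by (rule F)+
    show "v S \<in> mor (E S) (E T)" if "S \<in> F" for S using v that F D by blast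
    fix P g assume P: "P \<in> D" and g: "g \<in> mor (E P) (E T)" "g \<noteq> zr (E P) (E T)"
    have Pd: "P \<in> diagonals Z" using P D by blast
    have "hom_nonzero P T" by (rule hom_nonzero_of_morphism[OF Pd T g])
    then obtain x0 x1 y0 y1 where x: "P = {x0, x1}" "T = {y0, y1}" "hom_position Z x0 x1 y0 y1"
      unfolding hom_nonzero_def by blast
    have xZ: "x0 \<in> Z" "x1 \<in> Z" using Pd x(1) diagonal_pair_iff by auto
    have "\<exists>z0 z1. P = {z0, z1} \<and> hom_position Z z0 z1 a b"
    proof (cases "y0 = a \<and> y1 = b")
      case True then show ?thesis using x by blast
    next
      case False
      then have "y0 = b" "y1 = a" using x(2) ab(1) by (auto simp: doubleton_eq_iff)
      then have "hom_position Z x1 x0 a b" using hom_position_swap[OF xZ ab(2,3)] x(3) by blast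
      then show ?thesis using x(1) by (metis insert_commute)
    qed
    then obtain z0 z1 where z: "P = {z0, z1}" "hom_position Z z0 z1 a b" by blast
    then obtain s0 s1 where s: "{s0, s1} \<in> F" "cyc_le [z0, s0, a]" "cyc_le [z1, s1, b]" using dom P by blast
    let ?S = "{s0, s1}"
    have S: "?S \<in> diagonals Z" using s F D by blast
    have "factors_through C (E {z0, z1}) (E {a, b}) g (E ?S)"
      using factors_E[of z0 z1 a b ?S g] Pd z Tab S g s ab(1) by blast
    then obtain u w where uw: "u \<in> mor (E P) (E ?S)" "w \<in> mor (E ?S) (E T)" "g = w \<star> u"
      unfolding factors_through_def z(1)[symmetric] ab(1)[symmetric] by blast
    have "w \<noteq> zr (E ?S) (E T)"
      using uw g(2) cmp_zr(2)[OF E_Ob[OF Pd] E_Ob[OF S] E_Ob[OF T] uw(1)] by auto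
    then have hS: "hom_nonzero ?S T" using hom_nonzero_of_morphism[OF S T uw(2)] by blast
    obtain \<alpha> where \<alpha>: "\<alpha> \<in> carrier K" "w = \<alpha> \<odot>\<^bsub>Hom C (E ?S) (E T)\<^esub> v ?S"
      using one_dimensional_multiple[OF E_Ob[OF S] E_Ob[OF T] one_dimensional_of_hom_nonzero[OF S T hS] _ _ uw(2)] v[OF S] hS by blast
    have "g = v ?S \<star> (\<alpha> \<odot>\<^bsub>Hom C (E P) (E ?S)\<^esub> u)"
      using Comp_smult_left[OF E_Ob[OF Pd] E_Ob[OF S] E_Ob[OF T] \<alpha>(1) uw(1), of "v ?S"]
        Comp_smult_right[OF E_Ob[OF Pd] E_Ob[OF S] E_Ob[OF T] \<alpha>(1) uw(1), of "v ?S"] v[OF S] uw(3) \<alpha>(2) by simp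
    moreover have "\<alpha> \<odot>\<^bsub>Hom C (E P) (E ?S)\<^esub> u \<in> mor (E P) (E ?S)"
      using module.smult_closed[OF Hom_module[OF E_Ob[OF Pd] E_Ob[OF S]] \<alpha>(1) uw(1)] .
    ultimately show "\<exists>S\<in>F. \<exists>c\<in>mor (E P) (E S). g = v S \<star> c" using s(1) by blast
  qed
qed

text \<open>
  The approximations of the indecomposable summands of \<open>t\<close> are put together; an index consists of a summand
  and a diagonal, since the same diagonal may occur for several summands.
\<close>

lemma approximation_exists:
  assumes D: "D \<subseteq> diagonals Z" and fd: "finitely_dominated D" and t: "t \<in> Ob C"
  obtains I :: "(nat \<times> complex set) set" and f where "finite I" "\<forall>i\<in>I. snd i \<in> D"
    "\<forall>i\<in>I. f i \<in> mor (E (snd i)) t" "approximates (E ` D) t (\<lambda>i. E (snd i)) f I"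
proof -
  obtain n :: nat and T \<iota> \<pi> where T0: "\<forall>j<n. T j \<in> diagonals Z" and b: "biprod {..<n} (\<lambda>j. E (T j)) t \<iota> \<pi>"
    by (rule decomposition[OF t])
  note T = T0[rule_format]
  note d = biprodD[OF b]
  have "\<forall>j. \<exists>F v. j < n \<longrightarrow> finite F \<and> F \<subseteq> D \<and> (\<forall>S\<in>F. v S \<in> mor (E S) (E (T j))) \<and>
     (\<forall>P\<in>D. \<forall>g\<in>mor (E P) (E (T j)). g \<noteq> zr (E P) (E (T j)) \<longrightarrow> (\<exists>S\<in>F. \<exists>c\<in>mor (E P) (E S). g = v S \<star> c))"
  proof
    fix j
    show "\<exists>F v. j < n \<longrightarrow> finite F \<and> F \<subseteq> D \<and> (\<forall>S\<in>F. v S \<in> mor (E S) (E (T j))) \<and>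
     (\<forall>P\<in>D. \<forall>g\<in>mor (E P) (E (T j)). g \<noteq> zr (E P) (E (T j)) \<longrightarrow> (\<exists>S\<in>F. \<exists>c\<in>mor (E P) (E S). g = v S \<star> c))"
    proof (cases "j < n")
      case True
      from approximation_of_E[OF D fd T[OF True]] show ?thesis by (elim exE, intro exI impI)
    qed simp
  qed
  then obtain F v where Fv: "\<And>j. j < n \<Longrightarrow> finite (F j) \<and> F j \<subseteq> D \<and> (\<forall>S\<in>F j. v j S \<in> mor (E S) (E (T j))) \<and>
     (\<forall>P\<in>D. \<forall>g\<in>mor (E P) (E (T j)). g \<noteq> zr (E P) (E (T j)) \<longrightarrow> (\<exists>S\<in>F j. \<exists>c\<in>mor (E P) (E S). g = v j S \<star> c))"
    by metis
  define I where "I = Sigma {..<n} F"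
  define f where "f i = \<iota> (fst i) \<star> v (fst i) (snd i)" for i
  have fin: "finite I" unfolding I_def using Fv by (intro finite_SigmaI) auto
  have ID: "snd i \<in> D" if "i \<in> I" for i
  proof -
    have "fst i < n" "snd i \<in> F (fst i)" using that by (auto simp: I_def)
    then show ?thesis using Fv by blast
  qed
  then have IO: "E (snd i) \<in> Ob C" if "i \<in> I" for i using that D E_Ob by blast
  have f: "f i \<in> mor (E (snd i)) t" if i: "i \<in> I" for i
  proof -
    have j: "fst i \<in> {..<n}" "fst i < n" "snd i \<in> F (fst i)" using i by (auto simp: I_def)
    show ?thesis
      unfolding f_def using cmp_closed[OF _ d(4)[OF j(1)] IO[OF i] d(3)[OF j(1)] t] Fv[OF j(2)] j(3) by blast
  qed
  show ?thesis
  proof (rule that[OF fin, of f])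
    show "\<forall>i\<in>I. snd i \<in> D" "\<forall>i\<in>I. f i \<in> mor (E (snd i)) t" using ID f by blast+
    show "approximates (E ` D) t (\<lambda>i. E (snd i)) f I"
      unfolding approximates_def
    proof (intro ballI)
      fix B g assume "B \<in> E ` D" and g: "g \<in> mor B t"
      then obtain P where P: "P \<in> D" "B = E P" by blast
      have BO: "B \<in> Ob C" using P D E_Ob by blast
      have pg: "\<pi> j \<star> g \<in> mor B (E (T j))" if "j < n" for j
        using cmp_closed[OF g d(5) BO t d(3), of j] that by blast
      have ipg: "\<iota> j \<star> (\<pi> j \<star> g) \<in> mor B t" if "j < n" for j
        using cmp_closed[OF pg[OF that] d(4) BO d(3) t] that by blast
      have "\<iota> j \<star> (\<pi> j \<star> g) \<in> combinations B t (\<lambda>i. E (snd i)) f I" if j: "j < n" for j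
      proof (cases "\<pi> j \<star> g = zr B (E (T j))")
        case True
        then have "\<iota> j \<star> (\<pi> j \<star> g) = zr B t" using cmp_zr(1)[OF BO d(3) t d(4), of j] j by simp
        then show ?thesis using combinations_zr[where A = "\<lambda>i. E (snd i)" and f = f and I = I, OF BO t IO f] by simp
      next
        case False
        then obtain S c where S: "S \<in> F j" "c \<in> mor B (E S)" "\<pi> j \<star> g = v j S \<star> c"
          using Fv[OF j] P pg[OF j] by metis
        have iI: "(j, S) \<in> I" using S j by (simp add: I_def)
        have "\<iota> j \<star> (\<pi> j \<star> g) = f (j, S) \<star> c"
          unfolding S(3) f_def using Comp_assoc[OF BO IO[OF iI] d(3) t, of j c "v j S" "\<iota> j"] S Fv[OF j] d(4)[of j] j by simp
        then show ?thesis using combinations_single[where A = "\<lambda>i. E (snd i)" and f = f and I = I, OF BO t IO f fin iI] S(2) by simp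
      qed
      then have "(\<Oplus>\<^bsub>Hom C B t\<^esub>j\<in>{..<n}. \<iota> j \<star> (\<pi> j \<star> g)) \<in> combinations B t (\<lambda>i. E (snd i)) f I"
        using ipg by (intro combinations_finsum[where A = "\<lambda>i. E (snd i)" and f = f and I = I, OF BO t IO f]) auto
      then have "g \<in> combinations B t (\<lambda>i. E (snd i)) f I" using biprod_expand_right[OF b BO g] by simp
      then show "\<exists>c. (\<forall>i\<in>I. c i \<in> mor B (E (snd i))) \<and> g = (\<Oplus>\<^bsub>Hom C B t\<^esub>i\<in>I. f i \<star> c i)"
        unfolding combinations_def by blast
    qed
  qed
qed

lemma mor_add_closure_zero:
  assumes u: "u \<in> add_closure C S" and v: "v \<in> Ob C" and z: "\<And>B. B \<in> S \<Longrightarrow> mor B v = {zr B v}"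
  shows "mor u v = {zr u v}"
proof -
  obtain n :: nat and B \<alpha> \<beta> where "u \<in> Ob C"
    and all: "\<forall>j<n. B j \<in> S \<and> B j \<in> Ob C \<and> \<alpha> j \<in> mor u (B j) \<and> \<beta> j \<in> mor (B j) u"
    and sum: "(\<Oplus>\<^bsub>Hom C u u\<^esub>j\<in>{..<n}. \<beta> j \<star> \<alpha> j) = Id C u"
    by (rule add_closureE[OF u])
  then have a: "u \<in> Ob C" "\<And>j. j < n \<Longrightarrow> B j \<in> S" "\<And>j. j < n \<Longrightarrow> B j \<in> Ob C"
    "\<And>j. j < n \<Longrightarrow> \<alpha> j \<in> mor u (B j)" "\<And>j. j < n \<Longrightarrow> \<beta> j \<in> mor (B j) u"
    "(\<Oplus>\<^bsub>Hom C u u\<^esub>j\<in>{..<n}. \<beta> j \<star> \<alpha> j) = Id C u" by auto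
  have "s = zr u v" if s: "s \<in> mor u v" for s
  proof -
    have ba: "\<beta> j \<star> \<alpha> j \<in> mor u u" if "j < n" for j
      using cmp_closed[OF a(4)[OF that] a(5)[OF that] a(1) a(3)[OF that] a(1)] .
    have "s = s \<star> (\<Oplus>\<^bsub>Hom C u u\<^esub>j\<in>{..<n}. \<beta> j \<star> \<alpha> j)" using Comp_Id[OF a(1) v s] a(6) by simp
    also have "\<dots> = (\<Oplus>\<^bsub>Hom C u v\<^esub>j\<in>{..<n}. s \<star> (\<beta> j \<star> \<alpha> j))"
      by (rule cmp_finsum_right[OF a(1) a(1) v _ _ s]) (use ba in auto)
    also have "\<dots> = zr u v"
    proof (rule finsum_zr[OF a(1) v])
      fix j assume "j \<in> {..<n}"
      then have j: "j < n" by simp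
      have "s \<star> \<beta> j \<in> mor (B j) v" using cmp_closed[OF a(5)[OF j] s a(3)[OF j] a(1) v] .
      then have "s \<star> \<beta> j = zr (B j) v" using z[OF a(2)[OF j]] by blast
      then show "s \<star> (\<beta> j \<star> \<alpha> j) = zr u v"
        using Comp_assoc[OF a(1) a(3)[OF j] a(1) v a(4)[OF j] a(5)[OF j] s, symmetric]
          cmp_zr(2)[OF a(1) a(3)[OF j] v a(4)[OF j]] by simp
    qed
    finally show ?thesis .
  qed
  then show ?thesis using zr_closed[OF a(1) v] by blast
qed

text \<open>
  The cone \<open>P\<close> of a minimal approximation \<open>A \<rightarrow> t\<close> is orthogonal to \<open>D\<close> by Wakamatsu's lemma.  The extension
  \<open>e\<close> in that lemma is left orthogonal to the right orthogonal of \<open>D\<close>, and so are its indecomposable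
  summands; by \<open>perp_closed\<close> these belong to \<open>D\<close>, so that morphisms from \<open>e\<close> to \<open>t\<close> factor through the
  approximation.
\<close>

lemma torsion_pair_if:
  assumes D: "D \<subseteq> diagonals Z" and fd: "finitely_dominated D" and pc: "perp_closed D"
  shows "torsion_pair C (add_closure C (E ` D)) {v \<in> Ob C. \<forall>P\<in>D. mor (E P) v = {zr (E P) v}}"
    (is "torsion_pair C ?U ?V")
  unfolding torsion_pair_def
proof (intro conjI ballI)
  have EO: "E P \<in> Ob C" if "P \<in> D" for P using E_Ob D that by blast
  show "?U \<subseteq> Ob C" by (auto elim: add_closureE)
  show "?V \<subseteq> Ob C" by blast
  show "is_zero_space (Hom C u v)" if "u \<in> ?U" "v \<in> ?V" for u v
    unfolding is_zero_space_def by (rule mor_add_closure_zero[OF that(1)]) (use that(2) in auto)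
  fix t assume t: "t \<in> Ob C"
  have EDO: "E ` D \<subseteq> Ob C" using EO by blast
  obtain I :: "(nat \<times> complex set) set" and f where I0: "finite I" "\<forall>i\<in>I. snd i \<in> D"
    "\<forall>i\<in>I. f i \<in> mor (E (snd i)) t" "approximates (E ` D) t (\<lambda>i. E (snd i)) f I"
    by (rule approximation_exists[OF D fd t])
  note I = I0(1) I0(2,3)[rule_format] I0(4)
  have loc: "local_endomorphism_ring C (E (snd i))" if "i \<in> I" for i using E_local I(2)[OF that] D by blast
  obtain A F As where A: "direct_sum C As A" "set As \<subseteq> (\<lambda>i. E (snd i)) ` I" "A \<in> Ob C" "F \<in> mor A t"
    and ap: "\<forall>B\<in>E ` D. \<forall>g\<in>mor B t. \<exists>c\<in>mor B A. g = F \<star> c"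
    and min: "\<forall>\<phi>\<in>mor A A. F \<star> \<phi> = F \<longrightarrow> (\<exists>l\<in>mor A A. l \<star> \<phi> = Id C A)"
    by (rule minimal_approximation[where A = "\<lambda>i. E (snd i)" and I = I and S = "E ` D" and f = f,
          OF finite_direct_sums t EDO I(1) loc I(3,4)])
  have AsD: "set As \<subseteq> E ` D" using A(2) I(2) by blast
  obtain P g h where T: "(A, t, P, F, g, h) \<in> Tri C" using Tri_cone[OF A(3) t A(4)] by blast
  note tr = TriD[OF T]
  have AU: "A \<in> ?U" by (rule add_closureI[OF finite_direct_sums A(1) AsD])
  have "k = zr (E P0) P" if P0: "P0 \<in> D" and k: "k \<in> mor (E P0) P" for P0 k
  proof (rule wakamatsu[OF T min[rule_format] EO[OF P0] k])
    show "\<exists>r\<in>mor (E P0) A. s = F \<star> r" if "s \<in> mor (E P0) t" for s using ap P0 that by blast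
    fix e b
    assume e: "e \<in> Ob C" and perp: "\<And>v. v \<in> Ob C \<Longrightarrow> mor A v = {zr A v} \<Longrightarrow> mor (E P0) v = {zr (E P0) v} \<Longrightarrow> mor e v = {zr e v}"
      and bm: "b \<in> mor e t"
    obtain n :: nat and Q \<iota> \<pi> where Q0: "\<forall>j<n. Q j \<in> diagonals Z" and b: "biprod {..<n} (\<lambda>j. E (Q j)) e \<iota> \<pi>"
      by (rule decomposition[OF e])
  note Q = Q0[rule_format]
    note d = biprodD[OF b]
    \<comment> \<open>the hypothesis \<open>perp\<close> puts \<open>e\<close> into the left orthogonal of the right orthogonal of \<open>D\<close>\<close>
    have QD: "Q j \<in> D" if j: "j < n" for j
    proof -
      have jn: "j \<in> {..<n}" using j by simp
      have "\<not> hom_nonzero (Q j) R" if R: "R \<in> diagonals Z" "\<forall>P\<in>D. \<not> hom_nonzero P R" for R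
      proof -
        have zD: "mor (E P) (E R) = {zr (E P) (E R)}" if "P \<in> D" for P
          using mor_E_zero_iff[of P R] D R that by blast
        have "mor A (E R) = {zr A (E R)}" by (rule mor_add_closure_zero[OF AU E_Ob[OF R(1)]]) (use zD in blast)
        then have ze: "mor e (E R) = {zr e (E R)}" using perp[OF E_Ob[OF R(1)]] zD[OF P0] by blast
        have "s = zr (E (Q j)) (E R)" if s: "s \<in> mor (E (Q j)) (E R)" for s
        proof -
          have "s \<star> \<pi> j \<in> mor e (E R)" using cmp_closed[OF d(5)[OF jn] s e d(3)[OF jn] E_Ob[OF R(1)]] .
          then have "s \<star> \<pi> j = zr e (E R)" using ze by blast
          then have "s \<star> (\<pi> j \<star> \<iota> j) = zr (E (Q j)) (E R)"
            using Comp_assoc[OF d(3)[OF jn] e d(3)[OF jn] E_Ob[OF R(1)] d(4)[OF jn] d(5)[OF jn] s, symmetric]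
              cmp_zr(2)[OF d(3)[OF jn] e E_Ob[OF R(1)] d(4)[OF jn]] by simp
          then show ?thesis using d(6)[OF jn] Comp_Id[OF d(3)[OF jn] E_Ob[OF R(1)] s] by simp
        qed
        then have "mor (E (Q j)) (E R) = {zr (E (Q j)) (E R)}" using zr_closed[OF d(3)[OF jn] E_Ob[OF R(1)]] by blast
        then show ?thesis using mor_E_zero_iff[OF Q[OF j] R(1)] by blast
      qed
      then show ?thesis using pc Q[OF j] unfolding perp_closed_def by blast
    qed
    have "\<forall>j. \<exists>r. j < n \<longrightarrow> r \<in> mor (E (Q j)) A \<and> b \<star> \<iota> j = F \<star> r"
    proof
      fix j
      show "\<exists>r. j < n \<longrightarrow> r \<in> mor (E (Q j)) A \<and> b \<star> \<iota> j = F \<star> r"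
      proof (cases "j < n")
        case True
        have "b \<star> \<iota> j \<in> mor (E (Q j)) t" using cmp_closed[OF d(4) bm d(3) e t, of j] True by blast
        then show ?thesis using ap QD[OF True] by blast
      qed blast
    qed
    then obtain r where r: "\<And>j. j < n \<Longrightarrow> r j \<in> mor (E (Q j)) A" "\<And>j. j < n \<Longrightarrow> b \<star> \<iota> j = F \<star> r j" by metis
    have rp: "r j \<star> \<pi> j \<in> mor e A" if "j \<in> {..<n}" for j
      using cmp_closed[OF d(5)[OF that] r(1) e d(3)[OF that] A(3)] that by blast
    let ?r = "\<Oplus>\<^bsub>Hom C e A\<^esub>j\<in>{..<n}. r j \<star> \<pi> j"
    have "F \<star> ?r = (\<Oplus>\<^bsub>Hom C e t\<^esub>j\<in>{..<n}. F \<star> (r j \<star> \<pi> j))"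
      by (rule cmp_finsum_right[OF e A(3) t _ rp A(4)]) auto
    also have "\<dots> = (\<Oplus>\<^bsub>Hom C e t\<^esub>j\<in>{..<n}. (b \<star> \<iota> j) \<star> \<pi> j)"
    proof (rule finsum_cong_mor[OF e t])
      fix j assume j: "j \<in> {..<n}"
      have rj: "r j \<in> mor (E (Q j)) A" "b \<star> \<iota> j = F \<star> r j" using r j by auto
      show 1: "F \<star> (r j \<star> \<pi> j) = (b \<star> \<iota> j) \<star> \<pi> j"
        unfolding rj(2) by (rule Comp_assoc[OF e d(3)[OF j] A(3) t d(5)[OF j] rj(1) A(4), symmetric])
      show "(b \<star> \<iota> j) \<star> \<pi> j \<in> mor e t"
        unfolding 1[symmetric] using cmp_closed[OF rp[OF j] A(4) e A(3) t] .
    qed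
    also have "\<dots> = b" by (rule biprod_expand_left[OF b t bm, symmetric])
    finally have "b = F \<star> ?r" by simp
    moreover have "?r \<in> mor e A" by (rule finsum_mor_closed[OF e A(3) rp])
    ultimately show "\<exists>r\<in>mor e A. b = F \<star> r" by blast
  qed
  then have "P \<in> ?V" using tr(3) zr_closed[OF EO tr(3)] by blast
  then show "\<exists>u\<in>?U. \<exists>v\<in>?V. \<exists>f g h. (u, t, v, f, g, h) \<in> Tri C" using T AU by blast
qed

lemma torsion_pair_approximation:
  assumes D: "D \<subseteq> diagonals Z" and tp: "torsion_pair C (add_closure C (E ` D)) Y" and t: "t \<in> Ob C"
  obtains u v f g h S \<alpha> \<beta> and n :: nat where "(u, t, v, f, g, h) \<in> Tri C" "\<forall>P\<in>D. mor (E P) v = {zr (E P) v}"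
    "\<forall>j<n. S j \<in> D \<and> \<alpha> j \<in> mor u (E (S j)) \<and> \<beta> j \<in> mor (E (S j)) u"
    "(\<Oplus>\<^bsub>Hom C u u\<^esub>j\<in>{..<n}. \<beta> j \<star> \<alpha> j) = Id C u"
proof -
  obtain u v f g h where T: "u \<in> add_closure C (E ` D)" "v \<in> Y" "(u, t, v, f, g, h) \<in> Tri C"
    using tp t unfolding torsion_pair_def by blast
  obtain n :: nat and B \<alpha> \<beta> where "u \<in> Ob C"
    and all: "\<forall>j<n. B j \<in> E ` D \<and> B j \<in> Ob C \<and> \<alpha> j \<in> mor u (B j) \<and> \<beta> j \<in> mor (B j) u"
    and sum: "(\<Oplus>\<^bsub>Hom C u u\<^esub>j\<in>{..<n}. \<beta> j \<star> \<alpha> j) = Id C u"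
    by (rule add_closureE[OF T(1)])
  have "\<forall>j. \<exists>S. j < n \<longrightarrow> S \<in> D \<and> B j = E S" using all by blast
  then obtain S where S: "\<forall>j. j < n \<longrightarrow> S j \<in> D \<and> B j = E (S j)" by metis
  have "E P \<in> add_closure C (E ` D)" if "P \<in> D" for P
    by (rule add_closureI[OF finite_direct_sums direct_sum_single[OF E_Ob]]) (use that D in auto)
  then have "\<forall>P\<in>D. mor (E P) v = {zr (E P) v}"
    using tp T(2) unfolding torsion_pair_def is_zero_space_def by blast
  moreover have "\<forall>j<n. S j \<in> D \<and> \<alpha> j \<in> mor u (E (S j)) \<and> \<beta> j \<in> mor (E (S j)) u"
    using all S by auto
  ultimately show ?thesis using that T(3) sum by blast
qed

lemma factor_through_sum:
  assumes O: "u \<in> Ob C" "t \<in> Ob C" "B \<in> Ob C" and EO: "\<forall>j<n. A j \<in> Ob C"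
    and all: "\<forall>j<(n::nat). \<alpha> j \<in> mor u (A j) \<and> \<beta> j \<in> mor (A j) u"
    and sum: "(\<Oplus>\<^bsub>Hom C u u\<^esub>j\<in>{..<n}. \<beta> j \<star> \<alpha> j) = Id C u"
    and f: "f \<in> mor u t" and s: "s \<in> mor B u"
  shows "f \<star> s = (\<Oplus>\<^bsub>Hom C B t\<^esub>j\<in>{..<n}. (f \<star> \<beta> j) \<star> (\<alpha> j \<star> s))"
proof -
  have m: "A j \<in> Ob C" "\<alpha> j \<in> mor u (A j)" "\<beta> j \<in> mor (A j) u" if "j \<in> {..<n}" for j
    using all EO that by auto
  have ba: "\<beta> j \<star> \<alpha> j \<in> mor u u" if "j \<in> {..<n}" for j
    using cmp_closed[OF m(2,3)[OF that] O(1) m(1)[OF that] O(1)] .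
  have bas: "(\<beta> j \<star> \<alpha> j) \<star> s \<in> mor B u" if "j \<in> {..<n}" for j
    using cmp_closed[OF s ba[OF that] O(3,1,1)] .
  have "s = (\<Oplus>\<^bsub>Hom C u u\<^esub>j\<in>{..<n}. \<beta> j \<star> \<alpha> j) \<star> s" unfolding sum using Id_Comp[OF O(3,1) s] by simp
  also have "\<dots> = (\<Oplus>\<^bsub>Hom C B u\<^esub>j\<in>{..<n}. (\<beta> j \<star> \<alpha> j) \<star> s)"
    by (rule cmp_finsum_left[OF O(3,1,1) _ ba s]) auto
  finally have "f \<star> s = f \<star> (\<Oplus>\<^bsub>Hom C B u\<^esub>j\<in>{..<n}. (\<beta> j \<star> \<alpha> j) \<star> s)" by simp
  also have "\<dots> = (\<Oplus>\<^bsub>Hom C B t\<^esub>j\<in>{..<n}. f \<star> ((\<beta> j \<star> \<alpha> j) \<star> s))"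
    by (rule cmp_finsum_right[OF O(3,1,2) _ bas f]) auto
  also have "\<dots> = (\<Oplus>\<^bsub>Hom C B t\<^esub>j\<in>{..<n}. (f \<star> \<beta> j) \<star> (\<alpha> j \<star> s))"
  proof (rule finsum_cong_mor[OF O(3,2)])
    fix j assume j: "j \<in> {..<n}"
    have as: "\<alpha> j \<star> s \<in> mor B (A j)" using cmp_closed[OF s m(2)[OF j] O(3,1) m(1)[OF j]] .
    have fb: "f \<star> \<beta> j \<in> mor (A j) t" using cmp_closed[OF m(3)[OF j] f m(1)[OF j] O(1,2)] .
    show "(f \<star> \<beta> j) \<star> (\<alpha> j \<star> s) \<in> mor B t" using cmp_closed[OF as fb O(3) m(1)[OF j] O(2)] .
    show "f \<star> ((\<beta> j \<star> \<alpha> j) \<star> s) = (f \<star> \<beta> j) \<star> (\<alpha> j \<star> s)"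
      using Comp_assoc[OF O(3,1) m(1)[OF j] O(1) s m(2,3)[OF j]] Comp_assoc[OF O(3) m(1)[OF j] O(1,2) as m(3)[OF j] f]
      by simp
  qed
  finally show ?thesis .
qed

text \<open>
  In the triangle \<open>u \<rightarrow> E T \<rightarrow> v\<close> of \<open>T = {a, b}\<close>, every nonzero morphism from \<open>D\<close> to \<open>E T\<close> factors through \<open>u\<close>, and
  then, as the morphism space is one-dimensional, through one of the finitely many objects of \<open>D\<close> that
  \<open>u\<close> is built from.
\<close>

lemma torsion_pair_imp_finitely_dominated:
  assumes D: "D \<subseteq> diagonals Z" and tp: "torsion_pair C (add_closure C (E ` D)) Y"
  shows "finitely_dominated D"
  unfolding finitely_dominated_def
proof (intro allI impI)
  fix a b assume T: "{a, b} \<in> diagonals Z"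
  let ?T = "{a, b}"
  have TO: "E ?T \<in> Ob C" using E_Ob T by blast
  obtain u v f g h S \<alpha> \<beta> and n :: nat where Tr: "(u, E ?T, v, f, g, h) \<in> Tri C"
    and vz: "\<forall>P\<in>D. mor (E P) v = {zr (E P) v}"
    and all: "\<forall>j<n. S j \<in> D \<and> \<alpha> j \<in> mor u (E (S j)) \<and> \<beta> j \<in> mor (E (S j)) u"
    and sum: "(\<Oplus>\<^bsub>Hom C u u\<^esub>j\<in>{..<n}. \<beta> j \<star> \<alpha> j) = Id C u"
    by (rule torsion_pair_approximation[OF D tp TO])
  note tr = TriD[OF Tr]
  have Sd: "S j \<in> diagonals Z" if "j < n" for j using all D that by blast
  have "\<exists>s0 s1. {s0, s1} \<in> S ` {..<n} \<and> cyc_le [x0, s0, a] \<and> cyc_le [x1, s1, b]"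
    if P: "{x0, x1} \<in> D" and hp: "hom_position Z x0 x1 a b" for x0 x1
  proof -
    let ?P = "{x0, x1}"
    have Pd: "?P \<in> diagonals Z" using P D by blast
    have PO: "E ?P \<in> Ob C" using E_Ob Pd by blast
    have h: "hom_nonzero ?P ?T" using hp unfolding hom_nonzero_def by blast
    note one = one_dimensional_of_hom_nonzero[OF Pd T h]
    obtain q where q: "q \<in> mor (E ?P) (E ?T)" "q \<noteq> zr (E ?P) (E ?T)"
      by (rule one_dimensional_nonzero[OF PO TO one])
    have "g \<star> q \<in> mor (E ?P) v" using cmp_closed[OF q(1) tr(5) PO TO tr(3)] .
    then have "g \<star> q = zr (E ?P) v" using vz P by blast
    then obtain s where s: "s \<in> mor (E ?P) u" "q = f \<star> s" using Tri_exact_left[OF Tr PO q(1)] by blast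
    have "\<exists>j<n. (f \<star> \<beta> j) \<star> (\<alpha> j \<star> s) \<noteq> zr (E ?P) (E ?T)"
    proof (rule ccontr)
      assume "\<not> ?thesis"
      then have "(\<Oplus>\<^bsub>Hom C (E ?P) (E ?T)\<^esub>j\<in>{..<n}. (f \<star> \<beta> j) \<star> (\<alpha> j \<star> s)) = zr (E ?P) (E ?T)"
        by (intro finsum_zr[OF PO TO]) auto
      then show False
        using factor_through_sum[OF tr(1) TO PO _ _ sum tr(4) s(1), of "\<lambda>j. E (S j)"] all E_Ob Sd s(2) q(2) by auto
    qed
    then obtain j where j: "j < n" "(f \<star> \<beta> j) \<star> (\<alpha> j \<star> s) \<noteq> zr (E ?P) (E ?T)" by blast
    have SO: "E (S j) \<in> Ob C" using E_Ob Sd j by blast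
    have m: "\<alpha> j \<in> mor u (E (S j))" "\<beta> j \<in> mor (E (S j)) u" using all j by auto
    have fb: "f \<star> \<beta> j \<in> mor (E (S j)) (E ?T)" using cmp_closed[OF m(2) tr(4) SO tr(1) TO] .
    have as: "\<alpha> j \<star> s \<in> mor (E ?P) (E (S j))" using cmp_closed[OF s(1) m(1) PO tr(1) SO] .
    let ?q = "(f \<star> \<beta> j) \<star> (\<alpha> j \<star> s)"
    have q': "?q \<in> mor (E ?P) (E ?T)" using cmp_closed[OF as fb PO SO TO] .
    have "factors_through C (E ?P) (E ?T) ?q (E (S j))" unfolding factors_through_def using as fb by blast
    then have "\<exists>s0 s1. S j = {s0, s1} \<and> cyc_le [x0, s0, a] \<and> cyc_le [x1, s1, b]"
      using factors_E[OF Pd T Sd[OF j(1)] hp q' j(2)] by blast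
    then show ?thesis using j(1) by force
  qed
  moreover have "finite (S ` {..<n})" "S ` {..<n} \<subseteq> D" using all by auto
  ultimately show "\<exists>F. finite F \<and> F \<subseteq> D \<and> (\<forall>x0 x1. {x0, x1} \<in> D \<longrightarrow> hom_position Z x0 x1 a b \<longrightarrow>
      (\<exists>s0 s1. {s0, s1} \<in> F \<and> cyc_le [x0, s0, a] \<and> cyc_le [x1, s1, b]))" by blast
qed

text \<open>
  If \<open>E T\<close> has no morphisms to the orthogonal of \<open>D\<close>, the triangle \<open>u \<rightarrow> E T \<rightarrow> v\<close> makes the identity of \<open>E T\<close> factor
  through \<open>u\<close>.  As the endomorphism ring is local, \<open>E T\<close> is isomorphic to an object of \<open>D\<close>.
\<close>

lemma torsion_pair_imp_perp_closed:
  assumes D: "D \<subseteq> diagonals Z" and tp: "torsion_pair C (add_closure C (E ` D)) Y"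
  shows "perp_closed D"
  unfolding perp_closed_def
proof (intro ballI impI)
  fix T assume T: "T \<in> diagonals Z" and perp: "\<forall>Q\<in>diagonals Z. (\<forall>U\<in>D. \<not> hom_nonzero U Q) \<longrightarrow> \<not> hom_nonzero T Q"
  have TO: "E T \<in> Ob C" using E_Ob T by blast
  obtain u v f g h S \<alpha> \<beta> and n :: nat where Tr: "(u, E T, v, f, g, h) \<in> Tri C"
    and vz: "\<forall>P\<in>D. mor (E P) v = {zr (E P) v}"
    and all: "\<forall>j<n. S j \<in> D \<and> \<alpha> j \<in> mor u (E (S j)) \<and> \<beta> j \<in> mor (E (S j)) u"
    and sum: "(\<Oplus>\<^bsub>Hom C u u\<^esub>j\<in>{..<n}. \<beta> j \<star> \<alpha> j) = Id C u"
    by (rule torsion_pair_approximation[OF D tp TO])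
  note tr = TriD[OF Tr]
  have Sd: "S j \<in> diagonals Z" if "j < n" for j using all D that by blast
  have "mor (E T) v = {zr (E T) v}"
  proof -
    obtain m :: nat and Q \<iota> \<pi> where Q: "\<forall>j<m. Q j \<in> diagonals Z" and b: "biprod {..<m} (\<lambda>j. E (Q j)) v \<iota> \<pi>"
      by (rule decomposition[OF tr(3)])
    note d = biprodD[OF b]
    have "mor (E T) (E (Q j)) = {zr (E T) (E (Q j))}" if j: "j \<in> {..<m}" for j
    proof -
      have Qj: "Q j \<in> diagonals Z" using Q j by blast
      have "\<not> hom_nonzero P (Q j)" if P: "P \<in> D" for P
      proof -
        have Pd: "P \<in> diagonals Z" using P D by blast
        have PO: "E P \<in> Ob C" using E_Ob Pd by blast
        have "s = zr (E P) (E (Q j))" if s: "s \<in> mor (E P) (E (Q j))" for s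
        proof -
          have "\<iota> j \<star> s \<in> mor (E P) v" using cmp_closed[OF s d(4)[OF j] PO d(3)[OF j] d(2)] .
          then have "\<iota> j \<star> s = zr (E P) v" using vz P by blast
          then have "(\<pi> j \<star> \<iota> j) \<star> s = zr (E P) (E (Q j))"
            using Comp_assoc[OF PO d(3)[OF j] d(2) d(3)[OF j] s d(4)[OF j] d(5)[OF j]]
              cmp_zr(1)[OF PO d(2) d(3)[OF j] d(5)[OF j]] by simp
          then show ?thesis using d(6)[OF j] Id_Comp[OF PO d(3)[OF j] s] by simp
        qed
        then have "mor (E P) (E (Q j)) = {zr (E P) (E (Q j))}" using zr_closed[OF PO d(3)[OF j]] by blast
        then show ?thesis using mor_E_zero_iff[OF Pd Qj] by blast
      qed
      then have "\<not> hom_nonzero T (Q j)" using perp Qj by blast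
      then show ?thesis using mor_E_zero_iff[OF T Qj] by blast
    qed
    then show ?thesis by (rule biprod_mor_zero(2)[OF b TO])
  qed
  then have "g = zr (E T) v" using tr(5) by blast
  then have "g \<star> Id C (E T) = zr (E T) v" using Comp_Id[OF TO tr(3) tr(5)] by simp
  then obtain s where s: "s \<in> mor (E T) u" "Id C (E T) = f \<star> s"
    using Tri_exact_left[OF Tr TO Id_closed[OF TO]] by blast
  have SO: "E (S j) \<in> Ob C" if "j < n" for j using E_Ob Sd that by blast
  have fb: "f \<star> \<beta> j \<in> mor (E (S j)) (E T)" if "j < n" for j using cmp_closed[OF _ tr(4) SO tr(1) TO, of "\<beta> j" j] all that by blast
  have as: "\<alpha> j \<star> s \<in> mor (E T) (E (S j))" if "j < n" for j using cmp_closed[OF s(1) _ TO tr(1) SO, of "\<alpha> j" j] all that by blast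
  have "(\<Oplus>\<^bsub>Hom C (E T) (E T)\<^esub>j\<in>{..<n}. (f \<star> \<beta> j) \<star> (\<alpha> j \<star> s)) = Id C (E T)"
    using factor_through_sum[OF tr(1) TO TO _ _ sum tr(4) s(1), of "\<lambda>j. E (S j)"] all SO s(2) by auto
  moreover have "(f \<star> \<beta> j) \<star> (\<alpha> j \<star> s) \<in> mor (E T) (E T)" if "j \<in> {..<n}" for j
    using cmp_closed[OF as fb TO SO TO, of j] that by simp
  ultimately obtain j where j: "j < n" "isomorphism C (E T) (E T) ((f \<star> \<beta> j) \<star> (\<alpha> j \<star> s))"
    using local_sum_iso[OF E_local[OF T], of "{..<n}" "\<lambda>j. (f \<star> \<beta> j) \<star> (\<alpha> j \<star> s)"] by auto
  have "isomorphism C (E T) (E (S j)) (\<alpha> j \<star> s)"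
    by (rule local_split[OF E_local[OF Sd[OF j(1)]] TO E_nonzero[OF T] as[OF j(1)] fb[OF j(1)] j(2)])
  then have "T = S j" by (rule isomorphic_E[OF T Sd[OF j(1)]])
  then show "T \<in> D" using all j(1) by blast
qed

theorem torsion_pair_iff:
  assumes D: "D \<subseteq> diagonals Z"
  shows "(\<exists>Y. torsion_pair C (add_closure C (E ` D)) Y) \<longleftrightarrow> PC1 Z D \<and> PC2 Z D \<and> ptolemy Z D"
proof
  assume "\<exists>Y. torsion_pair C (add_closure C (E ` D)) Y"
  then obtain Y where tp: "torsion_pair C (add_closure C (E ` D)) Y" by blast
  show "PC1 Z D \<and> PC2 Z D \<and> ptolemy Z D"
    using finitely_dominated_imp_PC[OF D torsion_pair_imp_finitely_dominated[OF D tp]]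
      perp_closed_imp_ptolemy[OF D torsion_pair_imp_perp_closed[OF D tp]] by blast
next
  assume h: "PC1 Z D \<and> PC2 Z D \<and> ptolemy Z D"
  then have fd: "finitely_dominated D" using PC_imp_finitely_dominated[OF D] by blast
  then have "perp_closed D" using ptolemy_imp_perp_closed[OF D fd] h by blast
  then show "\<exists>Y. torsion_pair C (add_closure C (E ` D)) Y" using torsion_pair_if[OF D fd] by blast
qed

end

theorem theorem0p9:
  fixes Z :: "complex set" and K :: "'k ring" and C :: "('o, 'm, 'k) tricat"
    and E :: "complex set \<Rightarrow> 'o" and \<D> :: "complex set set"
  assumes "admissible Z"
    and "algebraically_closed K"
    and "igusa_todorov_category Z K C E"
    and "\<D> \<subseteq> diagonals Z"
  shows "(\<exists>Y. torsion_pair C (add_closure C (E ` \<D>)) Y) \<longleftrightarrow>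
    PC1 Z \<D> \<and> PC2 Z \<D> \<and> ptolemy Z \<D>"
proof -
  interpret igusa_todorov_admissible Z K C E
    using assms(1,3) by (simp add: igusa_todorov_admissible_def admissible_set_def)
  show ?thesis by (rule torsion_pair_iff[OF assms(4)])
qed

end
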